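(* (1) Let $\mathcal M(R,F)$ be a quantum matrix algebra of BMW-type with parameters $q,\mu$. If $j_q\ne0$ and $\mu\ne-q^{-2j+3}$ for all $j=2,3,\dots$, then the characteristic subalgebra $\mathcal C(R,F)$ is generated by the set $\{g,a_i\}_{i\ge0}$. If $j_q\neq0$ and $\mu\ne q^{2j-3}$ for all $j=2,3,\dots$, then $\mathcal C(R,F)$ is generated by the set $\{g,s_i\}_{i\ge0}$. (2) Let $k\ge 2$ and let $\mathcal M(R,F)$ be a quantum matrix algebra of type $Sp(2k)$ or of type $O(k)$ (which includes the restrictions $j_q\ne0$ for $j=2,\dots,k$). Then $\mathcal C(R,F)$ is generated by the set $\{g,a_i\}_{i=0}^k$.
   Context: Operators. $V$ is a complex vector space of finite dimension $N$ with a fixed basis (operators on $V^{\otimes n}$ are matrices), $I$ the identity, $P$ the flip on $V\otimes V$. For $X\in\mathrm{End}(V^{\otimes 2})$, $X_{mr}$ is $X$ acting in the tensor factors $m,r$ and trivially elsewhere, $X_m:=X_{m\,m+1}$; for an $N\times N$ matrix $Y$, $Y_m$ is $Y$ in factor $m$. $\mathrm{Tr}_{(i)}$ is the trace over the $i$-th factor. $X$ is skew invertible if there is $\Psi_X\in\mathrm{End}(V^{\otimes2})$ with $\mathrm{Tr}_{(2)}X_{12}(\Psi_X)_{23}=\mathrm{Tr}_{(2)}(\Psi_X)_{12}X_{23}=P_{13}$; then $C_X:=\mathrm{Tr}_{(1)}(\Psi_X)_{12}$, $D_X:=\mathrm{Tr}_{(2)}(\Psi_X)_{12}$, and $X$ is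 strict skew invertible if $C_X$ or $D_X$ is invertible. An R-matrix is an invertible $R\in\mathrm{End}(V^{\otimes 2})$ with $R_1R_2R_1=R_2R_1R_2$; it gives representations $\rho_R$ of the braid groups $\mathcal B_n$ (generators $\sigma_1,\dots,\sigma_{n-1}$, $\mathcal B_1=\{1\}$) and of $\mathbb C\mathcal B_n$ on $V^{\otimes n}$, $\sigma_i\mapsto R_i$. A pair $\{R,F\}$ is compatible if $R_1F_2F_1=F_2F_1R_2$ and $R_2F_1F_2=F_1F_2R_1$. For skew invertible $R$ the R-trace over spaces $i_1,\dots,i_s$ is $\mathrm{Tr}_{R(i_1,\dots,i_s)}X:=\mathrm{Tr}_{(i_1,\dots,i_s)}\big((D_R)_{i_1}\cdots(D_R)_{i_s}X\big)$. BMW-type. Let $q\in\mathbb C\setminus\{0,\pm1\}$, $\mu\in\mathbb C\setminus\{0,q,-q^{-1}\}$, $i_q:=(q^i-q^{-i})/(q-q^{-1})$, $\eta:=\frac{(q-\mu)(q^{-1}+\mu)}{\mu(q-q^{-1})}$. An R-matrix $R$ is of BMW-type if its minimal polynomial relation is $(qI-R)(q^{-1}I+R)(\mu I-R)=0$ and $K:=\mu^{-1}(q-q^{-1})^{-1}(qI-R)(q^{-1}I+R)$ satisfies $K_2K_1=R_1^{\pm1}R_2^{\pm1}K_1$ and $K_1K_2K_1=K_1$. Put $\kappa_i:=\frac{(q-\sigma_i)(q^{-1}+\sigma_i)}{\mu(q-q^{-1})}$ and $$\sigma_i^-(x):=1+\tfrac{x-1}{q-q^{-1}}\sigma_i+\tfrac{x-1}{q\mu^{-1}x+1}\kappa_i,\qquad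 \sigma_i^+(x):=1+\tfrac{x-1}{q-q^{-1}}\sigma_i+\tfrac{x-1}{1-q^{-1}\mu^{-1}x}\kappa_i .$$ $a^{(1)}=s^{(1)}:=1$, $a^{(i+1)}:=\frac{q^i}{(i+1)_q}a^{(i)}\sigma^-_i(q^{-2i})a^{(i)}$, $s^{(i+1)}:=\frac{q^{-i}}{(i+1)_q}s^{(i)}\sigma^+_i(q^{2i})s^{(i)}$. For $\alpha\in\mathbb C\mathcal B_n$, $\alpha^{\uparrow m}$ is its image under $\sigma_i\mapsto\sigma_{i+m}$. Types. Let $k\ge2$ and let $R$ be a skew invertible BMW-type R-matrix with $i_q\ne0$, $\rho_R(a^{(i)})\ne0$ for $i=2,\dots,k$ and $\rho_R\big(a^{(k)\uparrow1}\sigma_1^-(q^{-2k})a^{(k)\uparrow1}\big)=0$. $R$ is of type $Sp(2k)$ if $\mu=-q^{-1-2k}$; of type $O(k)$ if $\mu=q^{1-k}$ and $\mathrm{rk}\,\rho_R(a^{(k)})=1$. Quantum matrix algebra. Let $\{R,F\}$ be a compatible pair of strict skew invertible R-matrices. For an $N\times N$ matrix $M$ put $M_{\overline1}:=M_1$, $M_{\overline i}:=F_{i-1}M_{\overline{i-1}}F_{i-1}^{-1}$. $\mathcal M(R,F)$ is the unital associative $\mathbb C$-algebra generated by the entries $M_a^b$ of $M$ with relations $R_1M_{\overline1}M_{\overline2}=M_{\overline1}M_{\overline2}R_1$; its type is that of $R$. The characteristic subalgebra $\mathcal C(R,F)$ is the linear span of $1$ and all $ch(\alpha):=\mathrm{Tr}_{R(1,\dots,n)}(M_{\overline1}\cdots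 M_{\overline n}\,\rho_R(\alpha))$, $\alpha\in\mathbb C\mathcal B_n$, $n\ge1$; it is a commutative subalgebra. $a_0=s_0:=1$, $a_i:=ch(a^{(i)})$, $s_i:=ch(s^{(i)})$ for $i\ge1$, $g:=\eta^{-1}ch(\kappa_1)$. *)

theory Defs
  imports
    "HOL-Library.Function_Algebras"
    "HOL-Library.Poly_Mapping"
    "HOL-Computational_Algebra.Polynomial"
    "HOL-Analysis.Analysis"
    "HOL-Algebra.Subrings"
    "HOL-Algebra.Module"
begin

section \<open>Monoid algebras\<close>

text \<open>
  The type \<open>'w \<Rightarrow>\<^sub>0 complex\<close> with its convolution product is the algebra of a monoid
  \<open>'w\<close>; the library asks for the monoid to be written additively (but not commutatively).
\<close>

definition scal :: "'b::zero \<Rightarrow> ('w::zero \<Rightarrow>\<^sub>0 'b)" where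
  "scal c = Poly_Mapping.single 0 c"

datatype 'a word = Word (letters: "'a list")

instantiation word :: (type) monoid_add
begin

definition zero_word :: "'a word" where "0 = Word []"
definition plus_word :: "'a word \<Rightarrow> 'a word \<Rightarrow> 'a word" where
  "u + v = Word (letters u @ letters v)"

instance
proof
  fix a b c :: "'a word"
  show "a + b + c = a + (b + c)" by (simp add: plus_word_def)
  show "0 + a = a" by (simp add: plus_word_def zero_word_def)
  show "a + 0 = a" by (simp add: plus_word_def zero_word_def)
qed

end

text \<open>The free unital associative algebra on \<open>N\<^sup>2\<close> generators, \<open>N = CARD('n)\<close>.\<close>

type_synonym 'n falg = "('n \<times> 'n) word \<Rightarrow>\<^sub>0 complex"


section \<open>The braid groups and their group algebras\<close>

text \<open>
  All the groups \<open>\<B>\<^sub>n\<close> are regarded as subgroups of \<open>\<B>\<^sub>\<infinity>\<close>, presented by the letters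
  \<open>(j, True)\<close> for \<open>\<sigma>\<^bsub>j+1\<^esub>\<close> and \<open>(j, False)\<close> for its inverse.
\<close>

type_synonym braid_word = "(nat \<times> bool) list"

inductive braid_eq :: "braid_word \<Rightarrow> braid_word \<Rightarrow> bool" where
  refl: "braid_eq u u"
| sym: "braid_eq u v \<Longrightarrow> braid_eq v u"
| trans: "braid_eq u v \<Longrightarrow> braid_eq v w \<Longrightarrow> braid_eq u w"
| cong: "braid_eq u u' \<Longrightarrow> braid_eq v v' \<Longrightarrow> braid_eq (u @ v) (u' @ v')"
| cancel: "braid_eq [(j, e), (j, \<not> e)] []"
| braid: "braid_eq [(j, True), (Suc j, True), (j, True)]
                   [(Suc j, True), (j, True), (Suc j, True)]"
| far: "j + 2 \<le> l \<Longrightarrow> braid_eq [(j, True), (l, True)] [(l, True), (j, True)]"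

definition inv_word :: "braid_word \<Rightarrow> braid_word" where
  "inv_word w = rev (map (\<lambda>(j, e). (j, \<not> e)) w)"

definition shift_word :: "nat \<Rightarrow> braid_word \<Rightarrow> braid_word" where
  "shift_word m w = map (\<lambda>(j, e). (j + m, e)) w"

lemma braid_eq_inv_right: "braid_eq (w @ inv_word w) []"
proof (induction w)
  case Nil
  then show ?case by (simp add: inv_word_def braid_eq.refl)
next
  case (Cons x w)
  obtain j e where x: "x = (j, e)" by (cases x)
  have "braid_eq ([x] @ ((w @ inv_word w) @ [(j, \<not> e)])) ([x] @ ([] @ [(j, \<not> e)]))"
    by (intro braid_eq.cong braid_eq.refl Cons.IH)
  moreover have "braid_eq ([x] @ ([] @ [(j, \<not> e)])) []"
    using braid_eq.cancel[of j e] by (simp add: x)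
  ultimately show ?case
    by (simp add: inv_word_def x) (meson braid_eq.trans)
qed

lemma inv_word_inv_word: "inv_word (inv_word w) = w"
  by (simp add: inv_word_def rev_map case_prod_beta o_def)

lemma braid_eq_inv_left: "braid_eq (inv_word w @ w) []"
  using braid_eq_inv_right[of "inv_word w"] by (simp add: inv_word_inv_word)

lemma braid_eq_inv_word:
  assumes "braid_eq u v"
  shows "braid_eq (inv_word u) (inv_word v)"
proof -
  have "braid_eq (inv_word u @ []) (inv_word u @ (v @ inv_word v))"
    by (intro braid_eq.cong braid_eq.refl braid_eq.sym[OF braid_eq_inv_right])
  moreover have "braid_eq (inv_word u @ (v @ inv_word v)) (inv_word u @ (u @ inv_word v))"
    by (intro braid_eq.cong braid_eq.refl braid_eq.sym[OF assms])
  moreover have "braid_eq ((inv_word u @ u) @ inv_word v) ([] @ inv_word v)"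
    by (intro braid_eq.cong braid_eq.refl braid_eq_inv_left)
  ultimately show ?thesis
    by (simp) (meson braid_eq.trans)
qed

lemma braid_eq_shift_word:
  "braid_eq u v \<Longrightarrow> braid_eq (shift_word m u) (shift_word m v)"
proof (induction rule: braid_eq.induct)
  case (braid j)
  show ?case using braid_eq.braid[of "j + m"] by (simp add: shift_word_def)
next
  case (far j l)
  then show ?case using braid_eq.far[of "j + m" "l + m"] by (simp add: shift_word_def)
qed (auto simp: shift_word_def intro: braid_eq.intros)

quotient_type braid = braid_word / braid_eq
  by (rule equivpI)
    (auto simp: reflp_def symp_def transp_def intro: braid_eq.refl braid_eq.sym braid_eq.trans)

instantiation braid :: group_add
begin

lift_definition zero_braid :: braid is "[]" .
lift_definition plus_braid :: "braid \<Rightarrow> braid \<Rightarrow> braid" is "(@)" by (rule braid_eq.cong)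
lift_definition uminus_braid :: "braid \<Rightarrow> braid" is inv_word by (rule braid_eq_inv_word)
definition minus_braid :: "braid \<Rightarrow> braid \<Rightarrow> braid" where "minus_braid x y = x + - y"

instance
proof
  fix a b c :: braid
  show "a + b + c = a + (b + c)" by transfer (simp add: braid_eq.refl)
  show "0 + a = a" by transfer (simp add: braid_eq.refl)
  show "a + 0 = a" by transfer (simp add: braid_eq.refl)
  show "- a + a = 0" by transfer (rule braid_eq_inv_left)
  show "a + - b = a - b" by (simp add: minus_braid_def)
qed

end

lift_definition shift_braid :: "nat \<Rightarrow> braid \<Rightarrow> braid" is shift_word
  by (rule braid_eq_shift_word)

definition braid_words :: "nat \<Rightarrow> braid_word set" where
  "braid_words n = {w. \<forall>(j, e) \<in> set w. j + 1 < n}"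

definition braid_group :: "nat \<Rightarrow> braid set" where
  "braid_group n = abs_braid ` braid_words n"

type_synonym braid_alg = "braid \<Rightarrow>\<^sub>0 complex"

definition braid_algebra :: "nat \<Rightarrow> braid_alg set" where
  "braid_algebra n = {\<alpha>. Poly_Mapping.keys \<alpha> \<subseteq> braid_group n}"

text \<open>The generator \<open>\<sigma>\<^sub>i\<close>; only meaningful for \<open>i \<ge> 1\<close>.\<close>

definition sigma :: "nat \<Rightarrow> braid_alg" where
  "sigma i = Poly_Mapping.single (abs_braid [(i - 1, True)]) 1"

definition shift_alg :: "nat \<Rightarrow> braid_alg \<Rightarrow> braid_alg" where
  "shift_alg m \<alpha> = (\<Sum>b\<in>Poly_Mapping.keys \<alpha>.
     Poly_Mapping.single (shift_braid m b) (Poly_Mapping.lookup \<alpha> b))"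


section \<open>Operators on tensor powers\<close>

text \<open>
  The basis of \<open>V\<^sup>\<otimes>\<^sup>n\<close> is indexed by the lists of length \<open>n\<close> over the index type \<open>'n\<close> of the basis
  of \<open>V\<close>. An operator on \<open>V\<^sup>\<otimes>\<^sup>n\<close>, possibly with coefficients in a noncommutative algebra \<open>'a\<close>,
  is a matrix (row index first) that vanishes outside the lists of length \<open>n\<close>; all operators
  below have this property, so equality of operators is equality of functions.
  Tensor factors are numbered from 1.
\<close>

type_synonym ('n, 'a) oper = "'n list \<Rightarrow> 'n list \<Rightarrow> 'a"

definition op_id :: "nat \<Rightarrow> ('n, 'a::zero_neq_one) oper" where
  "op_id n xs ys = (if length xs = n \<and> xs = ys then 1 else 0)"

definition op_zero :: "('n, 'a::zero) oper" where
  "op_zero xs ys = 0"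

definition op_mult :: "nat \<Rightarrow> ('n, 'a::semiring_0) oper \<Rightarrow> ('n, 'a) oper \<Rightarrow> ('n, 'a) oper" where
  "op_mult n A B xs ys = (\<Sum>zs | length zs = n. A xs zs * B zs ys)"

definition op_prod :: "nat \<Rightarrow> ('n, 'a::semiring_1) oper list \<Rightarrow> ('n, 'a) oper" where
  "op_prod n As = foldr (op_mult n) As (op_id n)"

definition op_trace :: "nat \<Rightarrow> ('n, 'a::comm_monoid_add) oper \<Rightarrow> 'a" where
  "op_trace n A = (\<Sum>xs | length xs = n. A xs xs)"

text \<open>
  Trace over the \<open>i\<close>-th factor; the remaining factors keep their order and are renumbered.
\<close>

definition insert_at :: "nat \<Rightarrow> 'n \<Rightarrow> 'n list \<Rightarrow> 'n list" where
  "insert_at i a xs = take (i - 1) xs @ a # drop (i - 1) xs"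

definition op_ptrace :: "nat \<Rightarrow> ('n::finite, 'a::comm_monoid_add) oper \<Rightarrow> ('n, 'a) oper" where
  "op_ptrace i A xs ys = (\<Sum>a\<in>UNIV. A (insert_at i a xs) (insert_at i a ys))"

definition fac :: "'n list \<Rightarrow> nat \<Rightarrow> 'n" where
  "fac xs m = xs ! (m - 1)"

definition leg1 :: "nat \<Rightarrow> nat \<Rightarrow> 'a::zero^'n^'n \<Rightarrow> ('n::finite, 'a) oper" where
  "leg1 n m Y xs ys =
     (if length xs = n \<and> length ys = n \<and> (\<forall>j\<in>{1..n} - {m}. fac xs j = fac ys j)
      then Y $ fac xs m $ fac ys m else 0)"

definition leg2 :: "nat \<Rightarrow> nat \<Rightarrow> nat \<Rightarrow> 'a::zero^('n \<times> 'n)^('n \<times> 'n) \<Rightarrow> ('n::finite, 'a) oper" where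
  "leg2 n m r X xs ys =
     (if length xs = n \<and> length ys = n \<and> (\<forall>j\<in>{1..n} - {m, r}. fac xs j = fac ys j)
      then X $ (fac xs m, fac xs r) $ (fac ys m, fac ys r) else 0)"

abbreviation adj :: "nat \<Rightarrow> nat \<Rightarrow> 'a::zero^('n \<times> 'n)^('n \<times> 'n) \<Rightarrow> ('n::finite, 'a) oper" where
  "adj n m X \<equiv> leg2 n m (m + 1) X"

definition op_scal :: "('n, complex) oper \<Rightarrow> ('n, 'n falg) oper" where
  "op_scal A xs ys = scal (A xs ys)"

definition op_rank :: "('n, complex) oper \<Rightarrow> nat" where
  "op_rank A = vector_space.dim (\<lambda>c f xs. c * f xs :: complex) {(\<lambda>xs. A xs ys) | ys. True}"


section \<open>R-matrices\<close>

type_synonym 'n mat2 = "complex^('n \<times> 'n)^('n \<times> 'n)"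

definition flip :: "'n::finite mat2" where
  "flip = (\<chi> x y. if fst x = snd y \<and> snd x = fst y then 1 else 0)"

definition skew_inverse :: "'n::finite mat2 \<Rightarrow> 'n mat2 \<Rightarrow> bool" where
  "skew_inverse X \<Psi> \<longleftrightarrow>
     op_ptrace 2 (op_mult 3 (leg2 3 1 2 X) (leg2 3 2 3 \<Psi>)) = leg2 2 1 2 flip \<and>
     op_ptrace 2 (op_mult 3 (leg2 3 1 2 \<Psi>) (leg2 3 2 3 X)) = leg2 2 1 2 flip"

definition skew_invertible :: "'n::finite mat2 \<Rightarrow> bool" where
  "skew_invertible X \<longleftrightarrow> (\<exists>\<Psi>. skew_inverse X \<Psi>)"

definition Psi :: "'n::finite mat2 \<Rightarrow> 'n mat2" where
  "Psi X = (SOME \<Psi>. skew_inverse X \<Psi>)"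

definition Cmat :: "'n::finite mat2 \<Rightarrow> complex^'n^'n" where
  "Cmat X = (\<chi> a b. op_ptrace 1 (leg2 2 1 2 (Psi X)) [a] [b])"

definition Dmat :: "'n::finite mat2 \<Rightarrow> complex^'n^'n" where
  "Dmat X = (\<chi> a b. op_ptrace 2 (leg2 2 1 2 (Psi X)) [a] [b])"

definition strict_skew_invertible :: "'n::finite mat2 \<Rightarrow> bool" where
  "strict_skew_invertible X \<longleftrightarrow>
     skew_invertible X \<and> (invertible (Cmat X) \<or> invertible (Dmat X))"

definition R_matrix :: "'n::finite mat2 \<Rightarrow> bool" where
  "R_matrix R \<longleftrightarrow> invertible R \<and>
     op_prod 3 [adj 3 1 R, adj 3 2 R, adj 3 1 R] = op_prod 3 [adj 3 2 R, adj 3 1 R, adj 3 2 R]"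

definition compatible_pair :: "'n::finite mat2 \<Rightarrow> 'n mat2 \<Rightarrow> bool" where
  "compatible_pair R F \<longleftrightarrow>
     op_prod 3 [adj 3 1 R, adj 3 2 F, adj 3 1 F] = op_prod 3 [adj 3 2 F, adj 3 1 F, adj 3 2 R] \<and>
     op_prod 3 [adj 3 2 R, adj 3 1 F, adj 3 2 F] = op_prod 3 [adj 3 1 F, adj 3 2 F, adj 3 1 R]"

text \<open>
  The representation \<open>\<rho>\<^sub>R\<close> on \<open>V\<^sup>\<otimes>\<^sup>n\<close>. For an R-matrix the value on a braid in \<open>\<B>\<^sub>n\<close> does not depend
  on the chosen word in \<open>\<sigma>\<^sub>1, \<dots>, \<sigma>\<^bsub>n-1\<^esub>\<close> and their inverses; elements of the algebra outside
  \<open>\<complex>\<B>\<^sub>n\<close> have no meaningful image.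
\<close>

definition rho_word :: "'n::finite mat2 \<Rightarrow> nat \<Rightarrow> braid_word \<Rightarrow> ('n, complex) oper" where
  "rho_word R n w =
     op_prod n (map (\<lambda>(j, e). adj n (j + 1) (if e then R else matrix_inv R)) w)"

definition rho :: "'n::finite mat2 \<Rightarrow> nat \<Rightarrow> braid_alg \<Rightarrow> ('n, complex) oper" where
  "rho R n \<alpha> xs ys = (\<Sum>b\<in>Poly_Mapping.keys \<alpha>. Poly_Mapping.lookup \<alpha> b *
     rho_word R n (SOME w. w \<in> braid_words n \<and> abs_braid w = b) xs ys)"


section \<open>BMW-type R-matrices\<close>

text \<open>Below \<open>mat c\<close> is the scalar matrix \<open>cI\<close>, so \<open>mat c ** A\<close> is the multiple \<open>cA\<close>.\<close>

definition matrix_poly :: "complex poly \<Rightarrow> complex^'m^'m \<Rightarrow> complex^'m^'m" where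
  "matrix_poly p A = (\<Sum>i\<le>Polynomial.degree p. mat (Polynomial.coeff p i) ** (((**) A) ^^ i) (mat 1))"

definition is_minimal_poly :: "complex poly \<Rightarrow> complex^'m^'m \<Rightarrow> bool" where
  "is_minimal_poly p A \<longleftrightarrow> Polynomial.lead_coeff p = 1 \<and> matrix_poly p A = 0 \<and>
     (\<forall>f. matrix_poly f A = 0 \<longrightarrow> p dvd f)"

definition Kmat :: "complex \<Rightarrow> complex \<Rightarrow> 'n::finite mat2 \<Rightarrow> 'n mat2" where
  "Kmat q \<mu> R =
     mat (inverse \<mu> * inverse (q - inverse q)) ** (mat q - R) ** (mat (inverse q) + R)"

definition bmw_type :: "complex \<Rightarrow> complex \<Rightarrow> 'n::finite mat2 \<Rightarrow> bool" where
  "bmw_type q \<mu> R \<longleftrightarrow>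
     q \<notin> {0, 1, -1} \<and> \<mu> \<notin> {0, q, - inverse q} \<and> R_matrix R \<and>
     is_minimal_poly ([:- q, 1:] * [:inverse q, 1:] * [:- \<mu>, 1:]) R \<and>
     (let K1 = adj 3 1 (Kmat q \<mu> R); K2 = adj 3 2 (Kmat q \<mu> R) in
       op_prod 3 [K2, K1] = op_prod 3 [adj 3 1 R, adj 3 2 R, K1] \<and>
       op_prod 3 [K2, K1] = op_prod 3 [adj 3 1 (matrix_inv R), adj 3 2 (matrix_inv R), K1] \<and>
       op_prod 3 [K1, K2, K1] = K1)"

definition qnum :: "complex \<Rightarrow> nat \<Rightarrow> complex" where
  "qnum q i = (q ^ i - inverse q ^ i) / (q - inverse q)"

definition eta :: "complex \<Rightarrow> complex \<Rightarrow> complex" where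
  "eta q \<mu> = (q - \<mu>) * (inverse q + \<mu>) / (\<mu> * (q - inverse q))"

definition kappa :: "complex \<Rightarrow> complex \<Rightarrow> nat \<Rightarrow> braid_alg" where
  "kappa q \<mu> i = scal (1 / (\<mu> * (q - inverse q))) *
     (scal q - sigma i) * (scal (inverse q) + sigma i)"

definition sigma_minus :: "complex \<Rightarrow> complex \<Rightarrow> nat \<Rightarrow> complex \<Rightarrow> braid_alg" where
  "sigma_minus q \<mu> i x = 1 + scal ((x - 1) / (q - inverse q)) * sigma i
     + scal ((x - 1) / (q * inverse \<mu> * x + 1)) * kappa q \<mu> i"

definition sigma_plus :: "complex \<Rightarrow> complex \<Rightarrow> nat \<Rightarrow> complex \<Rightarrow> braid_alg" where
  "sigma_plus q \<mu> i x = 1 + scal ((x - 1) / (q - inverse q)) * sigma i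
     + scal ((x - 1) / (1 - inverse q * inverse \<mu> * x)) * kappa q \<mu> i"

text \<open>\<open>a\<^sup>(\<^sup>i\<^sup>)\<close> and \<open>s\<^sup>(\<^sup>i\<^sup>)\<close>; the value at index 0 is a filler.\<close>

primrec antisym_el :: "complex \<Rightarrow> complex \<Rightarrow> nat \<Rightarrow> braid_alg" where
  "antisym_el q \<mu> 0 = 1"
| "antisym_el q \<mu> (Suc i) = (if i = 0 then 1 else
     scal (q ^ i / qnum q (i + 1)) * antisym_el q \<mu> i
       * sigma_minus q \<mu> i (q powi (- 2 * int i)) * antisym_el q \<mu> i)"

primrec sym_el :: "complex \<Rightarrow> complex \<Rightarrow> nat \<Rightarrow> braid_alg" where
  "sym_el q \<mu> 0 = 1"
| "sym_el q \<mu> (Suc i) = (if i = 0 then 1 else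
     scal (q powi (- int i) / qnum q (i + 1)) * sym_el q \<mu> i
       * sigma_plus q \<mu> i (q ^ (2 * i)) * sym_el q \<mu> i)"

definition finite_height :: "complex \<Rightarrow> complex \<Rightarrow> nat \<Rightarrow> 'n::finite mat2 \<Rightarrow> bool" where
  "finite_height q \<mu> k R \<longleftrightarrow> k \<ge> 2 \<and> skew_invertible R \<and> bmw_type q \<mu> R \<and>
     (\<forall>i\<in>{2..k}. qnum q i \<noteq> 0 \<and> rho R i (antisym_el q \<mu> i) \<noteq> op_zero) \<and>
     rho R (k + 1) (shift_alg 1 (antisym_el q \<mu> k) * sigma_minus q \<mu> 1 (q powi (- 2 * int k))
       * shift_alg 1 (antisym_el q \<mu> k)) = op_zero"

definition type_Sp :: "complex \<Rightarrow> complex \<Rightarrow> nat \<Rightarrow> 'n::finite mat2 \<Rightarrow> bool" where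
  "type_Sp q \<mu> k R \<longleftrightarrow> finite_height q \<mu> k R \<and> \<mu> = - (q powi (- 1 - 2 * int k))"

definition type_O :: "complex \<Rightarrow> complex \<Rightarrow> nat \<Rightarrow> 'n::finite mat2 \<Rightarrow> bool" where
  "type_O q \<mu> k R \<longleftrightarrow> finite_height q \<mu> k R \<and> \<mu> = q powi (1 - int k) \<and>
     op_rank (rho R k (antisym_el q \<mu> k)) = 1"


section \<open>The quantum matrix algebra\<close>

definition class_ring :: "'a::ring_1 ring" where
  "class_ring = \<lparr>carrier = UNIV, mult = (*), one = 1, zero = 0, add = (+)\<rparr>"

definition M_free :: "'n::finite falg^'n^'n" where
  "M_free = (\<chi> a b. Poly_Mapping.single (Word [(a, b)]) 1)"

text \<open>\<open>Mbar F n i\<close> is the copy of \<open>M\<close> with overlined index \<open>i \<ge> 1\<close>, acting on \<open>V\<^sup>\<otimes>\<^sup>n\<close>.\<close>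

primrec Mbar :: "'n::finite mat2 \<Rightarrow> nat \<Rightarrow> nat \<Rightarrow> ('n, 'n falg) oper" where
  "Mbar F n 0 = op_zero"
| "Mbar F n (Suc i) = (if i = 0 then leg1 n 1 M_free else
     op_prod n [op_scal (adj n i F), Mbar F n i, op_scal (adj n i (matrix_inv F))])"

definition qma_relation :: "'n::finite mat2 \<Rightarrow> 'n mat2 \<Rightarrow> 'n list \<Rightarrow> 'n list \<Rightarrow> 'n falg" where
  "qma_relation R F xs ys =
     op_prod 2 [op_scal (adj 2 1 R), Mbar F 2 1, Mbar F 2 2] xs ys
     - op_prod 2 [Mbar F 2 1, Mbar F 2 2, op_scal (adj 2 1 R)] xs ys"

definition qma_ideal :: "'n::finite mat2 \<Rightarrow> 'n mat2 \<Rightarrow> 'n falg set" where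
  "qma_ideal R F =
     genideal class_ring {qma_relation R F xs ys | xs ys. length xs = 2 \<and> length ys = 2}"

definition qma_proj :: "'n::finite mat2 \<Rightarrow> 'n mat2 \<Rightarrow> 'n falg \<Rightarrow> 'n falg set" where
  "qma_proj R F x = a_r_coset class_ring (qma_ideal R F) x"

definition qma :: "'n::finite mat2 \<Rightarrow> 'n mat2 \<Rightarrow> (complex, 'n falg set) module" where
  "qma R F = (let Q = class_ring Quot qma_ideal R F in
     \<lparr>carrier = carrier Q, mult = mult Q, one = one Q, zero = zero Q, add = add Q,
      smult = (\<lambda>c X. qma_proj R F (scal c) \<otimes>\<^bsub>Q\<^esub> X)\<rparr>)"

lemma ring_class_ring: "ring (class_ring :: 'a::ring_1 ring)"
  by (intro ringI abelian_groupI monoidI)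
    (auto simp: class_ring_def algebra_simps intro: exI[of _ "- x" for x] left_minus)

lemma cring_class_ring: "cring (class_ring :: complex ring)"
proof -
  interpret ring "class_ring :: complex ring" by (rule ring_class_ring)
  show ?thesis by unfold_locales (simp add: class_ring_def)
qed

lemma ideal_qma_ideal: "ideal (qma_ideal R F) class_ring"
  unfolding qma_ideal_def
  by (rule ring.genideal_ideal[OF ring_class_ring]) (simp add: class_ring_def)

lemma ring_qma: "ring (qma R F)"
proof -
  let ?Q = "class_ring Quot qma_ideal R F"
  interpret Q: ring ?Q
    by (rule ideal.quotient_is_ring[OF ideal_qma_ideal])
  have eqs: "carrier (qma R F) = carrier ?Q" "mult (qma R F) = mult ?Q" "one (qma R F) = one ?Q"
      "zero (qma R F) = zero ?Q" "add (qma R F) = add ?Q"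
    by (simp_all add: qma_def Let_def)
  show ?thesis
  proof (intro ringI abelian_groupI monoidI, unfold eqs)
    show "\<exists>y\<in>carrier ?Q. y \<oplus>\<^bsub>?Q\<^esub> x = \<zero>\<^bsub>?Q\<^esub>" if "x \<in> carrier ?Q" for x
      using that Q.l_neg by blast
  qed (simp_all add: Q.a_ac Q.m_assoc Q.l_distr Q.r_distr)
qed

lemma module_qma: "module class_ring (qma R F)"
proof -
  interpret I: ideal "qma_ideal R F" "class_ring" by (rule ideal_qma_ideal)
  let ?p = "qma_proj R F"
  have carr: "carrier (qma R F) = range ?p"
    by (auto simp: qma_def Let_def FactRing_def A_RCOSETS_def' qma_proj_def class_ring_def)
  have add: "?p x \<oplus>\<^bsub>qma R F\<^esub> ?p y = ?p (x + y)" for x y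
    using I.a_rcos_sum[of x y]
    by (simp add: qma_def Let_def FactRing_def qma_proj_def class_ring_def)
  have mult: "?p x \<otimes>\<^bsub>class_ring Quot qma_ideal R F\<^esub> ?p y = ?p (x * y)" for x y
    using I.rcoset_mult_add[of x y]
    by (simp add: FactRing_def qma_proj_def class_ring_def)
  have smult: "c \<odot>\<^bsub>qma R F\<^esub> ?p x = ?p (scal c * x)" for c x
    by (simp add: qma_def Let_def mult)
  have scal_mult: "scal (c * d) = scal c * (scal d :: 'a falg)" for c d :: complex
    by (simp add: scal_def mult_single)
  have scal_add: "scal (c + d) = scal c + (scal d :: 'a falg)" for c d :: complex
    by (simp add: scal_def single_add)
  have scal_1: "scal 1 = (1 :: 'a falg)"
    by (simp add: scal_def)
  interpret Q: ring "qma R F" by (rule ring_qma)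
  show ?thesis
  proof (intro moduleI cring_class_ring Q.is_abelian_group)
  qed (auto simp: carr smult add scal_mult scal_add scal_1 class_ring_def distrib_left
        distrib_right mult.assoc)
qed

definition lin_span :: "(complex, 'm) module \<Rightarrow> 'm set \<Rightarrow> 'm set" where
  "lin_span A S = \<Inter>{H. submodule H class_ring A \<and> S \<subseteq> H}"

definition generated_subalgebra :: "(complex, 'm) module \<Rightarrow> 'm set \<Rightarrow> 'm set" where
  "generated_subalgebra A S = \<Inter>{H. submodule H class_ring A \<and> subring H A \<and> S \<subseteq> H}"

definition ch :: "'n::finite mat2 \<Rightarrow> 'n mat2 \<Rightarrow> nat \<Rightarrow> braid_alg \<Rightarrow> 'n falg set" where
  "ch R F n \<alpha> = qma_proj R F (op_trace n (op_prod n
     (map (\<lambda>i. op_scal (leg1 n i (Dmat R))) [1..<n + 1] @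
      map (\<lambda>i. Mbar F n i) [1..<n + 1] @
      [op_scal (rho R n \<alpha>)])))"

definition char_subalgebra :: "'n::finite mat2 \<Rightarrow> 'n mat2 \<Rightarrow> 'n falg set set" where
  "char_subalgebra R F = lin_span (qma R F)
     ({\<one>\<^bsub>qma R F\<^esub>} \<union> {ch R F n \<alpha> | n \<alpha>. n \<ge> 1 \<and> \<alpha> \<in> braid_algebra n})"

definition a_el :: "complex \<Rightarrow> complex \<Rightarrow> 'n::finite mat2 \<Rightarrow> 'n mat2 \<Rightarrow> nat \<Rightarrow> 'n falg set" where
  "a_el q \<mu> R F i = (if i = 0 then \<one>\<^bsub>qma R F\<^esub> else ch R F i (antisym_el q \<mu> i))"

definition s_el :: "complex \<Rightarrow> complex \<Rightarrow> 'n::finite mat2 \<Rightarrow> 'n mat2 \<Rightarrow> nat \<Rightarrow> 'n falg set" where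
  "s_el q \<mu> R F i = (if i = 0 then \<one>\<^bsub>qma R F\<^esub> else ch R F i (sym_el q \<mu> i))"

definition g_el :: "complex \<Rightarrow> complex \<Rightarrow> 'n::finite mat2 \<Rightarrow> 'n mat2 \<Rightarrow> 'n falg set" where
  "g_el q \<mu> R F = inverse (eta q \<mu>) \<odot>\<^bsub>qma R F\<^esub> ch R F 2 (kappa q \<mu> 1)"

definition qma_pair :: "'n::finite mat2 \<Rightarrow> 'n mat2 \<Rightarrow> bool" where
  "qma_pair R F \<longleftrightarrow> R_matrix R \<and> R_matrix F \<and>
     strict_skew_invertible R \<and> strict_skew_invertible F \<and> compatible_pair R F"

end

theory Submission
  imports Defs
begin

text \<open>
  All the algebras \<open>End (V\<^sup>\<otimes>\<^sup>n)\<close> are embedded in one ring, the endomorphisms of an infinite tensor power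
  with coefficients in the free algebra. On the image of \<open>\<B>\<^sub>n\<close> the functional
  \<open>x \<mapsto> Tr\<^bsub>R(1,\<dots>,n)\<^esub> (M\<^bsub>1\<^esub> \<dots> M\<^bsub>n\<^esub> x)\<close> (with overlined indices) is cyclic modulo the defining relations, since
  \<open>D\<^sub>1 D\<^sub>2\<close> commutes with \<open>R\<close>. Conjugation by \<open>F\<^sub>m \<dots> F\<^bsub>m+n-1\<^esub>\<close> shifts overlined indices by one and does not
  change R-traces, so \<open>ch (\<alpha> \<beta>\<^bsup>\<up>m\<^esup>) = ch \<alpha> ch \<beta>\<close> for \<open>\<alpha>\<close> on \<open>m\<close> strands.

  Let \<open>W\<^sub>n\<close> be the image of \<open>\<complex>\<B>\<^sub>n\<close>. The BMW relations give
  \<open>W\<^bsub>n+1\<^esub> = W\<^sub>n + W\<^sub>n \<sigma>\<^sub>n W\<^sub>n + W\<^sub>n \<kappa>\<^sub>n W\<^sub>n\<close> and \<open>\<kappa>\<^sub>n W\<^bsub>n+1\<^esub> \<kappa>\<^sub>n = W\<^bsub>n-1\<^esub> \<kappa>\<^sub>n\<close>. Hence the value of \<open>ch\<close> on an element of the ideal of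
  the contractors \<open>\<kappa>\<^sub>i\<close> is \<open>g\<close> times a value on two strands less, and by cyclicity everything else reduces to the
  power sums \<open>p\<^sub>n = ch (\<sigma>\<^bsub>n-1\<^esub> \<dots> \<sigma>\<^sub>1)\<close>. Modulo the contractors \<open>a\<^bsup>(n)\<^esup>\<close> is the idempotent antisymmetrizer of the
  Hecke algebra; splitting off its generators one at a time shows that \<open>a\<^sub>n\<close> is \<open>\<plusminus>p\<^sub>n / n\<^sub>q\<close> up to products
  of characters on fewer strands, so that \<open>p\<^sub>n\<close> may be replaced by \<open>a\<^sub>n\<close>. For \<open>n > k\<close> the height condition,
  shifted and multiplied by a string of \<open>\<sigma>\<close>s, yields in the same way that \<open>p\<^sub>n\<close> is superfluous. The
  substitution \<open>q \<mapsto> - q\<^sup>-\<^sup>1\<close> exchanges \<open>a\<^sub>i\<close> and \<open>s\<^sub>i\<close>.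
\<close>

section \<open>Endomorphisms of the infinite tensor power\<close>

text \<open>Two obstacles shape the proof. First, over the noncommutative free algebra a trace can
  be rotated only past a factor with scalar entries, and the copies of \<open>M\<close> have none.
  So endomorphisms are right linear with coefficients acting from the left, and the main claim is
  not proved by formulas in the quotient. Instead an arbitrary subalgebra containing the proposed
  generators is fixed, \<open>B\<close> is its preimage in the free algebra, and induction on the
  number of strands shows that \<open>B\<close> contains every trace. Whatever decomposes into fewer
  strands then lies in \<open>B\<close> at once, without bookkeeping of the products, and the
  antisymmetrizers may be computed modulo the contractors. Second, the antisymmetrizer is built by
  adjoining generators upwards, whereas the height condition adjoins one below its block. Up to
  contractors, however, it depends only on the set of its generators (\<open>h_unique\<close>), so
  it can be rebuilt downwards, and one telescoping argument serves both the generators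
  \<open>a\<^sub>i\<close> and the height condition.\<close>

typedef (overloaded) ('v, 'a::ring_1) endo =
  "{f :: ('v \<Rightarrow> 'a) \<Rightarrow> ('v \<Rightarrow> 'a). (\<forall>u v. f (\<lambda>x. u x + v x) = (\<lambda>x. f u x + f v x)) \<and>
      (\<forall>u c. f (\<lambda>x. u x * c) = (\<lambda>x. f u x * c))}"
  morphisms app Endo
  by (rule exI[of _ id]) simp

lemma endo_eqI: "(\<And>f s. app x f s = app y f s) \<Longrightarrow> x = y"
  by (metis app_inject ext)

lemma app_fadd: "app x (\<lambda>t. u t + v t) s = app x u s + app x v s"
  using app[of x] by (auto simp: fun_eq_iff)

lemma app_fmult: "app x (\<lambda>t. u t * c) s = app x u s * c"
  using app[of x] by (auto simp: fun_eq_iff)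

lemma app_fzero [simp]: "app x (\<lambda>t. 0) s = 0"
  using app_fmult[of x "\<lambda>t. 0" 0 s] by simp

lemma app_fsum: "app x (\<lambda>t. \<Sum>a\<in>A. u a t) s = (\<Sum>a\<in>A. app x (u a) s)"
  by (induction A rule: infinite_finite_induct) (simp_all add: app_fadd)

text \<open>Endomorphisms are linear on the right, so only a central factor can be pulled out on the
  left.\<close>

lemma app_fcentral:
  assumes "\<And>d. c * d = d * c"
  shows "app x (\<lambda>t. c * u t) s = c * app x u s"
  using app_fmult[of x u c s] by (simp add: assms)

lemma app_Endo:
  assumes "\<And>u v s. f (\<lambda>x. u x + v x) s = f u s + f v s"
    and "\<And>u c s. f (\<lambda>x. u x * c) s = f u s * c"
  shows "app (Endo f) = f"
  by (rule Endo_inverse) (auto simp: assms fun_eq_iff)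

instantiation endo :: (type, ring_1) ring_1
begin

definition "0 = Endo (\<lambda>u s. 0)"
definition "1 = Endo (\<lambda>u. u)"
definition "x + y = Endo (\<lambda>u s. app x u s + app y u s)"
definition "x - y = Endo (\<lambda>u s. app x u s - app y u s)"
definition "- x = Endo (\<lambda>u s. - app x u s)"
definition "x * y = Endo (\<lambda>u. app x (app y u))"

lemma app_zero: "app 0 u s = 0"
  by (simp add: zero_endo_def app_Endo)
lemma app_one: "app 1 u s = u s"
  by (simp add: one_endo_def app_Endo)
lemma app_plus: "app (x + y) u s = app x u s + app y u s"
  unfolding plus_endo_def by (subst app_Endo) (simp_all add: app_fadd app_fmult algebra_simps)
lemma app_minus: "app (x - y) u s = app x u s - app y u s"
  unfolding minus_endo_def by (subst app_Endo) (simp_all add: app_fadd app_fmult algebra_simps)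
lemma app_uminus: "app (- x) u s = - app x u s"
  unfolding uminus_endo_def by (subst app_Endo) (simp_all add: app_fadd app_fmult algebra_simps)
lemma app_times: "app (x * y) u s = app x (app y u) s"
proof -
  have "app y (\<lambda>x. u x + v x) = (\<lambda>t. app y u t + app y v t)"
    "app y (\<lambda>x. u x * c) = (\<lambda>t. app y u t * c)" for u v c
    by (simp_all add: fun_eq_iff app_fadd app_fmult)
  then show ?thesis
    unfolding times_endo_def by (subst app_Endo) (simp_all add: app_fadd app_fmult)
qed

lemma app_one': "app 1 u = u"
  by (simp add: fun_eq_iff app_one)
lemma app_times': "app (x * y) u = app x (app y u)"
  by (simp add: fun_eq_iff app_times)

lemmas app_simps = app_zero app_one app_plus app_minus app_uminus app_times

instance
proof
  fix a b c :: "('a, 'b) endo"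
  show "a * b * c = a * (b * c)" "a + b + c = a + (b + c)" "a + b = b + a" "0 + a = a"
    "- a + a = 0" "a - b = a + - b" "1 * a = a" "a * 1 = a"
    "(a + b) * c = a * c + b * c" 
    by (rule endo_eqI, simp add: app_simps app_times' app_one' algebra_simps)+
  show "a * (b + c) = a * b + a * c"
  proof (rule endo_eqI)
    fix u s
    have "app (b + c) u = (\<lambda>t. app b u t + app c u t)"
      by (simp add: fun_eq_iff app_plus)
    then show "app (a * (b + c)) u s = app (a * b + a * c) u s"
      by (simp add: app_times app_plus app_fadd)
  qed
  show "(0 :: ('a, 'b) endo) \<noteq> 1"
  proof
    assume "(0 :: ('a, 'b) endo) = 1"
    then have "app (0 :: ('a, 'b) endo) (\<lambda>_. 1) s = app 1 (\<lambda>_. 1) s" for s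
      by simp
    then show False by (simp add: app_zero app_one)
  qed
qed

end

lemma app_sum: "app (\<Sum>a\<in>A. x a) u s = (\<Sum>a\<in>A. app (x a) u s)"
  by (induction A rule: infinite_finite_induct) (simp_all add: app_simps)

text \<open>Left multiplications are right linear, so they embed the coefficient ring into the
  endomorphisms. The image is not central: the entries of \<open>M\<close> do not commute with one
  another.\<close>

definition lm :: "'a::ring_1 \<Rightarrow> ('v, 'a) endo" where
  "lm c = Endo (\<lambda>u s. c * u s)"

lemma app_lm: "app (lm c) u s = c * u s"
  unfolding lm_def by (subst app_Endo) (simp_all add: algebra_simps)

lemma lm_add: "lm (a + b) = lm a + lm b"
  by (rule endo_eqI) (simp add: app_lm app_simps algebra_simps)
lemma lm_mult: "lm (a * b) = lm a * lm b"
  by (rule endo_eqI) (simp add: app_lm app_simps algebra_simps)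
lemma lm_diff: "lm (a - b) = lm a - lm b"
  by (rule endo_eqI) (simp add: app_lm app_simps algebra_simps)
lemma lm_uminus: "lm (- a) = - lm a"
  by (rule endo_eqI) (simp add: app_lm app_simps algebra_simps)
lemma lm_0 [simp]: "lm 0 = 0"
  by (rule endo_eqI) (simp add: app_lm app_simps)
lemma lm_1 [simp]: "lm 1 = 1"
  by (rule endo_eqI) (simp add: app_lm app_simps)
lemma lm_central:
  assumes "\<And>d. c * d = d * c"
  shows "lm c * x = x * lm c"
  by (rule endo_eqI) (simp add: app_simps app_lm[abs_def] app_fcentral[OF assms] ext)

lemma scal_mult: "scal (c * d) = scal c * (scal d :: 'w::monoid_add \<Rightarrow>\<^sub>0 complex)"
  by (simp add: scal_def mult_single)
lemma scal_add: "scal (c + d) = scal c + scal (d :: 'b::monoid_add)"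
  by (simp add: scal_def single_add)
lemma scal_0 [simp]: "scal 0 = 0"
  by (simp add: scal_def)
lemma scal_1 [simp]: "scal 1 = 1"
  by (simp add: scal_def)
lemma scal_uminus: "scal (- c) = - scal (c :: 'b::ab_group_add)"
  by (simp add: scal_def single_uminus)
lemma scal_diff: "scal (c - d) = scal c - scal (d :: 'b::ab_group_add)"
  by (simp add: scal_def single_diff)
lemma scal_sum: "scal (\<Sum>a\<in>A. c a) = (\<Sum>a\<in>A. scal (c a :: 'b::comm_monoid_add))"
  by (induction A rule: infinite_finite_induct) (simp_all add: scal_add)

lemma poly_mapping_sum_single:
  "x = (\<Sum>k\<in>Poly_Mapping.keys x. Poly_Mapping.single k (Poly_Mapping.lookup x k))"
proof (rule poly_mapping_eqI)
  fix k
  have "(\<Sum>j\<in>Poly_Mapping.keys x. Poly_Mapping.lookup x j when j = k) = Poly_Mapping.lookup x k"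
    by (cases "k \<in> Poly_Mapping.keys x") (auto simp: when_def in_keys_iff)
  then show "Poly_Mapping.lookup x k = Poly_Mapping.lookup
      (\<Sum>k\<in>Poly_Mapping.keys x. Poly_Mapping.single k (Poly_Mapping.lookup x k)) k"
    by (simp add: lookup_sum lookup_single)
qed

lemma scal_central: "scal c * x = x * (scal c :: 'w::monoid_add \<Rightarrow>\<^sub>0 complex)"
  by (subst (1 2) poly_mapping_sum_single[of x])
    (simp add: scal_def mult_single sum_distrib_left sum_distrib_right mult.commute)

lemma inj_scal: "scal c = scal d \<longleftrightarrow> c = d"
  by (metis scal_def lookup_single_eq)

abbreviation sc :: "complex \<Rightarrow> ('v, 'w::monoid_add \<Rightarrow>\<^sub>0 complex) endo" where
  "sc c \<equiv> lm (scal c)"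

lemma sc_central: "x * sc c = sc c * x"
  by (rule lm_central[symmetric]) (rule scal_central)

lemma sc_left_commute: "x * (sc c * y) = sc c * (x * y)"
  by (simp only: sc_central[of x c] mult.assoc[symmetric])

lemma app_fscal:
  "app x (\<lambda>t. scal c * u t) s = scal c * (app x u s :: 'w::monoid_add \<Rightarrow>\<^sub>0 complex)"
  by (rule app_fcentral) (rule scal_central)


subsection \<open>Local operators\<close>

type_synonym ('n, 'a) chain = "(nat \<Rightarrow> 'n, 'a) endo"

text \<open>Vectors are arbitrary functions on index sequences. Supports need not be controlled,
  because an operator changes finitely many positions and the index type is finite.\<close>

definition op1 :: "nat \<Rightarrow> 'a::ring_1^'n^'n \<Rightarrow> ('n::finite, 'a) chain" where
  "op1 i Y = Endo (\<lambda>u s. \<Sum>a\<in>UNIV. Y $ s i $ a * u (s(i := a)))"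

lemma app_op1: "app (op1 i Y) u s = (\<Sum>a\<in>UNIV. Y $ s i $ a * u (s(i := a)))"
  unfolding op1_def
  by (subst app_Endo) (simp_all add: algebra_simps sum.distrib sum_distrib_right)

definition smat :: "complex^'m^'k \<Rightarrow> ('w::monoid_add \<Rightarrow>\<^sub>0 complex)^'m^'k" where
  "smat A = (\<chi> i j. scal (A $ i $ j))"

text \<open>Positions are counted from 0: \<open>op2 i X\<close> is \<open>X\<close> in the tensor factors \<open>i + 1\<close> and \<open>i + 2\<close>.\<close>

definition op2 :: "nat \<Rightarrow> 'n mat2 \<Rightarrow> ('n::finite, 'w::monoid_add \<Rightarrow>\<^sub>0 complex) chain" where
  "op2 i X = Endo (\<lambda>u s. \<Sum>a\<in>UNIV. \<Sum>b\<in>UNIV.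
     scal (X $ (s i, s (Suc i)) $ (a, b)) * u (s(i := a, Suc i := b)))"

lemma app_op2: "app (op2 i X) u s = (\<Sum>a\<in>UNIV. \<Sum>b\<in>UNIV.
     scal (X $ (s i, s (Suc i)) $ (a, b)) * u (s(i := a, Suc i := b)))"
  unfolding op2_def
  by (subst app_Endo) (simp_all add: algebra_simps sum.distrib sum_distrib_right)

abbreviation cop1 :: "nat \<Rightarrow> complex^'n^'n \<Rightarrow> ('n::finite, 'w::monoid_add \<Rightarrow>\<^sub>0 complex) chain" where
  "cop1 i Y \<equiv> op1 i (smat Y)"

lemma app_cop1: "app (cop1 i Y) u s = (\<Sum>a\<in>UNIV. scal (Y $ s i $ a) * u (s(i := a)))"
  by (simp add: app_op1 smat_def)

text \<open>\<open>triv n x\<close>: the operator \<open>x\<close> acts as the identity on the factor at position \<open>n\<close>.\<close>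

definition triv :: "nat \<Rightarrow> ('n, 'a::ring_1) chain \<Rightarrow> bool" where
  "triv n x \<longleftrightarrow> (\<forall>u s a. app x u (s(n := a)) = app x (\<lambda>t. u (t(n := a))) s)"

lemma trivD: "triv n x \<Longrightarrow> app x u (s(n := a)) = app x (\<lambda>t. u (t(n := a))) s"
  by (simp add: triv_def)

lemma trivD': "triv n x \<Longrightarrow> app x u s = app x (\<lambda>t. u (t(n := s n))) s"
  using trivD[of n x u s "s n"] by simp

lemma triv_0 [simp]: "triv n 0" and triv_1 [simp]: "triv n 1" and triv_lm [simp]: "triv n (lm c)"
  by (simp_all add: triv_def app_simps app_lm)

lemma triv_add: "triv n x \<Longrightarrow> triv n y \<Longrightarrow> triv n (x + y)"
  by (simp add: triv_def app_simps)

lemma triv_mult: "triv n x \<Longrightarrow> triv n y \<Longrightarrow> triv n (x * y)"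
  by (simp add: triv_def app_times)

lemma triv_sum: "(\<And>a. a \<in> A \<Longrightarrow> triv n (x a)) \<Longrightarrow> triv n (sum x A)"
  by (induction A rule: infinite_finite_induct) (simp_all add: triv_add)

lemma triv_prod_list: "(\<And>x. x \<in> set xs \<Longrightarrow> triv n x) \<Longrightarrow> triv n (prod_list xs)"
  by (induction xs) (simp_all add: triv_mult)

lemma triv_op1: "i \<noteq> n \<Longrightarrow> triv n (op1 i Y)"
  by (simp add: triv_def app_op1 fun_upd_twist)

lemma triv_op2:
  assumes "i \<noteq> n" "Suc i \<noteq> n"
  shows "triv n (op2 i Y)"
proof -
  have "s(n := a, i := b, Suc i := c) = s(i := b, Suc i := c, n := a)" for s :: "nat \<Rightarrow> 'a" and a b c
    using assms by (auto simp: fun_eq_iff)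
  then show ?thesis using assms by (simp add: triv_def app_op2)
qed

text \<open>The entry \<open>Y $ t i $ a\<close> is constant for \<open>x\<close>, which leaves
  position \<open>i\<close> alone, and it is a scalar, hence central. With entries in the free
  algebra the second point would fail.\<close>

lemma triv_commute_cop1:
  assumes "triv i x"
  shows "x * cop1 i Y = cop1 i Y * x"
proof (rule endo_eqI)
  fix u s
  have "app (x * cop1 i Y) u s = app x (\<lambda>t. \<Sum>a\<in>UNIV. scal (Y $ t i $ a) * u (t(i := a))) s"
    by (simp add: app_times app_cop1[abs_def])
  also have "\<dots> = app x (\<lambda>t. \<Sum>a\<in>UNIV. scal (Y $ s i $ a) * u (t(i := a))) s"
    by (subst trivD'[OF assms]) simp
  also have "\<dots> = (\<Sum>a\<in>UNIV. scal (Y $ s i $ a) * app x u (s(i := a)))"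
    by (simp add: app_fsum app_fscal trivD[OF assms])
  finally show "app (x * cop1 i Y) u s = app (cop1 i Y * x) u s"
    by (simp add: app_times app_cop1)
qed

lemma triv_commute_op2:
  assumes "triv i x" "triv (Suc i) x"
  shows "x * op2 i Y = op2 i Y * x"
proof (rule endo_eqI)
  fix u s
  have "app (x * op2 i Y) u s = app x (\<lambda>t. \<Sum>a\<in>UNIV. \<Sum>b\<in>UNIV.
      scal (Y $ (t i, t (Suc i)) $ (a, b)) * u (t(i := a, Suc i := b))) s"
    by (simp add: app_times app_op2[abs_def])
  also have "\<dots> = app x (\<lambda>t. \<Sum>a\<in>UNIV. \<Sum>b\<in>UNIV.
      scal (Y $ (s i, s (Suc i)) $ (a, b)) * u (t(i := a, Suc i := b))) s"
    apply (subst trivD'[OF assms(1)])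
    apply (subst trivD'[OF assms(2)])
    apply (simp add: fun_upd_twist[of i "Suc i"])
    done
  also have "\<dots> = (\<Sum>a\<in>UNIV. \<Sum>b\<in>UNIV. scal (Y $ (s i, s (Suc i)) $ (a, b)) * app x u (s(i := a, Suc i := b)))"
    by (simp add: app_fsum app_fscal trivD[OF assms(1)] trivD[OF assms(2)])
  finally show "app (x * op2 i Y) u s = app (op2 i Y * x) u s"
    by (simp add: app_times app_op2)
qed

lemma sum_UNIV_prod: "(\<Sum>x\<in>UNIV. f x) = (\<Sum>a\<in>UNIV. \<Sum>b\<in>UNIV. f (a, b))"
  by (simp add: sum.cartesian_product)

lemma app_op2': "app (op2 i X) u s = (\<Sum>p\<in>UNIV.
     scal (X $ (s i, s (Suc i)) $ p) * u (s(i := fst p, Suc i := snd p)))"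
  by (simp add: app_op2 sum_UNIV_prod)

lemma op2_mult: "op2 i A * op2 i B = op2 i (A ** B)"
proof (rule endo_eqI)
  fix u s
  have "app (op2 i A * op2 i B) u s =
      (\<Sum>p\<in>UNIV. \<Sum>r\<in>UNIV. scal (A $ (s i, s (Suc i)) $ p) * (scal (B $ p $ r) *
        u (s(i := fst p, Suc i := snd p, i := fst r, Suc i := snd r))))"
    by (simp add: app_times app_op2' sum_distrib_left mult.assoc)
  also have "\<dots> = (\<Sum>p\<in>UNIV. \<Sum>q\<in>UNIV. scal (A $ (s i, s (Suc i)) $ p) * (scal (B $ p $ q) *
        u (s(i := fst q, Suc i := snd q))))"
  proof ((rule sum.cong[OF HOL.refl])+, goal_cases)
    case (1 p q)
    have "s(i := fst p, Suc i := snd p, i := fst q, Suc i := snd q) = s(i := fst q, Suc i := snd q)"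
      by (simp add: fun_eq_iff)
    then show ?case
      by simp
  qed
  also have "\<dots> = app (op2 i (A ** B)) u s"
    by (subst sum.swap)
      (simp add: app_op2' matrix_matrix_mult_def scal_sum scal_mult sum_distrib_right mult.assoc)
  finally show "app (op2 i A * op2 i B) u s = app (op2 i (A ** B)) u s" .
qed

lemma op2_add: "op2 i (A + B) = op2 i A + op2 i B"
  by (rule endo_eqI) (simp add: app_op2 app_simps scal_add algebra_simps sum.distrib)
lemma op2_diff: "op2 i (A - B) = op2 i A - op2 i B"
  by (rule endo_eqI) (simp add: app_op2 app_simps scal_diff algebra_simps sum_subtractf)

lemma op2_mat: "op2 i (mat c) = sc c"
proof (rule endo_eqI)
  fix u s
  have "app (op2 i (mat c)) u s = (\<Sum>p\<in>UNIV. if (s i, s (Suc i)) = p then 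
     scal c * u (s(i := fst p, Suc i := snd p)) else 0)"
    unfolding app_op2' by (rule sum.cong) (auto simp: mat_def)
  then show "app (op2 i (mat c)) u s = app (sc c) u s"
    by (simp add: app_lm)
qed

lemma op2_0 [simp]: "op2 i 0 = 0"
  by (rule endo_eqI) (simp add: app_op2 app_simps)


subsection \<open>Partial traces\<close>

text \<open>\<open>blk n r p x\<close> is the block of \<open>x\<close> at row \<open>r\<close> and column \<open>p\<close> of the factor at position \<open>n\<close>.\<close>

definition blk :: "nat \<Rightarrow> 'n \<Rightarrow> 'n \<Rightarrow> ('n, 'a::ring_1) chain \<Rightarrow> ('n, 'a) chain" where
  "blk n r p x = Endo (\<lambda>u s. app x (\<lambda>t. if t n = p then u (t(n := s n)) else 0) (s(n := r)))"

lemma app_blk: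
  "app (blk n r p x) u s = app x (\<lambda>t. if t n = p then u (t(n := s n)) else 0) (s(n := r))"
proof -
  have "(\<lambda>t. if t n = p then u (t(n := s n)) + v (t(n := s n)) else 0) =
     (\<lambda>t. (if t n = p then u (t(n := s n)) else 0) + (if t n = p then v (t(n := s n)) else 0))"
   "(\<lambda>t. if t n = p then u (t(n := s n)) * c else 0) =
     (\<lambda>t. (if t n = p then u (t(n := s n)) else 0) * c)" for u v :: "(nat \<Rightarrow> 'b) \<Rightarrow> 'a" and s c
    by (auto simp: fun_eq_iff)
  then show ?thesis
    unfolding blk_def by (subst app_Endo) (simp_all add: app_fadd app_fmult)
qed

definition ptr :: "nat \<Rightarrow> ('n::finite, 'a::ring_1) chain \<Rightarrow> ('n, 'a) chain" where
  "ptr n x = (\<Sum>a\<in>UNIV. blk n a a x)"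

lemma triv_blk: "triv n (blk n r p x)"
  by (simp add: triv_def app_blk cong: if_cong)

lemma triv_blk':
  assumes "triv m x" "m \<noteq> n"
  shows "triv m (blk n r p x)"
  unfolding triv_def
proof (intro allI)
  fix u s a
  have "app x (\<lambda>t. if t n = p then u (t(n := s n)) else 0) (s(n := r, m := a)) =
     app x (\<lambda>t. if t n = p then u (t(n := s n, m := a)) else 0) (s(n := r))"
    unfolding trivD[OF assms(1)] using assms(2) by (simp add: fun_upd_twist[of n m] cong: if_cong)
  then show "app (blk n r p x) u (s(m := a)) = app (blk n r p x) (\<lambda>t. u (t(m := a))) s"
    using assms(2) by (simp add: app_blk fun_upd_twist[of n m] cong: if_cong)
qed

lemma triv_ptr: "triv n (ptr n x)"
  unfolding ptr_def by (intro triv_sum triv_blk)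

lemma triv_ptr': "triv m x \<Longrightarrow> triv m (ptr n x)"
  unfolding ptr_def by (cases "m = n") (auto intro!: triv_sum triv_blk triv_blk')

lemma blk_mult_right:
  assumes "triv n z"
  shows "blk n r p (x * z) = blk n r p x * z"
proof (rule endo_eqI)
  fix u s
  have "app z (\<lambda>t. if t n = p then u (t(n := s n)) else 0) = (\<lambda>t. if t n = p then app z u (t(n := s n)) else 0)"
    (is "?l = ?r")
  proof
    fix t
    show "?l t = ?r t"
      by (subst trivD'[OF assms]) (simp add: trivD[OF assms])
  qed
  then show "app (blk n r p (x * z)) u s = app (blk n r p x * z) u s"
    by (simp add: app_blk app_times)
qed

lemma blk_mult_left:
  assumes "triv n y"
  shows "blk n r p (y * x) = y * blk n r p x"
proof (rule endo_eqI)
  fix u s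
  have "app (y * blk n r p x) u s = app y (\<lambda>v. app (blk n r p x) u (v(n := s n))) s"
    unfolding app_times by (rule trivD'[OF assms])
  also have "\<dots> = app (blk n r p (y * x)) u s"
    by (simp add: app_blk app_times trivD[OF assms] cong: if_cong)
  finally show "app (blk n r p (y * x)) u s = app (y * blk n r p x) u s" ..
qed

lemma blk_add: "blk n r p (x + y) = blk n r p x + blk n r p y"
  by (rule endo_eqI) (simp add: app_blk app_simps)

lemma ptr_add: "ptr n (x + y) = ptr n x + ptr n y"
  by (simp add: ptr_def blk_add sum.distrib)

lemma ptr_0 [simp]: "ptr n 0 = 0"
  using ptr_add[of n 0 0] by simp

lemma ptr_sum: "ptr n (\<Sum>a\<in>A. x a) = (\<Sum>a\<in>A. ptr n (x a))"
  by (induction A rule: infinite_finite_induct) (simp_all add: ptr_add)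

lemma ptr_mult_right: "triv n z \<Longrightarrow> ptr n (x * z) = ptr n x * z"
  and ptr_mult_left: "triv n z \<Longrightarrow> ptr n (z * x) = z * ptr n x"
  by (simp_all add: ptr_def blk_mult_right blk_mult_left sum_distrib_left sum_distrib_right)

definition unit_mat :: "'n \<Rightarrow> 'n \<Rightarrow> complex^'n^'n" where
  "unit_mat r p = (\<chi> i j. if i = r \<and> j = p then 1 else 0)"

text \<open>Reduces an identity about partial traces to a single matrix unit: the blocks are trivial
  at position \<open>n\<close> and can be taken out of the trace.\<close>

lemma blk_decompose:
  fixes x :: "('n::finite, 'w::monoid_add \<Rightarrow>\<^sub>0 complex) chain"
  shows "x = (\<Sum>r\<in>UNIV. \<Sum>p\<in>UNIV. cop1 n (unit_mat r p) * blk n r p x)"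
proof (rule endo_eqI)
  fix u s
  have "app (cop1 n (unit_mat r p) * blk n r p x) u s =
     (if s n = r then app x (\<lambda>t. if t n = p then u t else 0) s else 0)" for r p
  proof -
    have "app (cop1 n (unit_mat r p) * blk n r p x) u s =
      (\<Sum>a\<in>UNIV. if a = p then (if s n = r then app (blk n r p x) u (s(n := p)) else 0) else 0)"
      unfolding app_times app_cop1 by (rule sum.cong) (auto simp: unit_mat_def)
    also have "\<dots> = (if s n = r then app (blk n r p x) u (s(n := p)) else 0)"
      by simp
    also have "\<dots> = (if s n = r then app x (\<lambda>t. if t n = p then u t else 0) s else 0)"
      by (auto simp: app_blk fun_eq_iff intro!: arg_cong[where f = "\<lambda>v. app x v s"])
    finally show ?thesis .
  qed
  then have "app (\<Sum>r\<in>UNIV. \<Sum>p\<in>UNIV. cop1 n (unit_mat r p) * blk n r p x) u s =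
     (\<Sum>p\<in>UNIV. \<Sum>r\<in>UNIV. (if s n = r then app x (\<lambda>t. if t n = p then u t else 0) s else 0))"
    by (subst sum.swap) (simp add: app_sum)
  also have "\<dots> = app x (\<lambda>t. \<Sum>p\<in>UNIV. if t n = p then u t else 0) s"
    by (subst app_fsum) simp
  finally show "app x u s = app (\<Sum>r\<in>UNIV. \<Sum>p\<in>UNIV. cop1 n (unit_mat r p) * blk n r p x) u s"
    by simp
qed

subsection \<open>Operators on lists as local endomorphisms\<close>

definition get :: "nat \<Rightarrow> nat \<Rightarrow> (nat \<Rightarrow> 'n) \<Rightarrow> 'n list" where
  "get i n s = map s [i..<i + n]"

definition put :: "nat \<Rightarrow> 'n list \<Rightarrow> (nat \<Rightarrow> 'n) \<Rightarrow> (nat \<Rightarrow> 'n)" where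
  "put i ys s = (\<lambda>j. if i \<le> j \<and> j < i + length ys then ys ! (j - i) else s j)"

lemma length_get [simp]: "length (get i n s) = n"
  by (simp add: get_def)

lemma nth_get [simp]: "j < n \<Longrightarrow> get i n s ! j = s (i + j)"
  by (simp add: get_def)

lemma get_put [simp]: "length ys = n \<Longrightarrow> get i n (put i ys s) = ys"
  by (rule nth_equalityI) (auto simp: put_def)

lemma put_get [simp]: "put i (get i n s) s = s"
  by (auto simp: put_def fun_eq_iff)

lemma put_put [simp]: "length ys = length zs \<Longrightarrow> put i ys (put i zs s) = put i ys s"
  by (auto simp: put_def fun_eq_iff)

lemma finite_lists_length [simp]: "finite {xs :: 'n::finite list. length xs = n}"
  using finite_lists_length_eq[of "UNIV :: 'n set" n] by simp

text \<open>The bridge from operators on lists to endomorphisms of the infinite power. The offset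
  \<open>i\<close> yields all shifted copies of one operator.\<close>

definition embo :: "nat \<Rightarrow> nat \<Rightarrow> ('n, 'a) oper \<Rightarrow> ('n::finite, 'a::ring_1) chain" where
  "embo i n A = Endo (\<lambda>u s. \<Sum>ys | length ys = n. A (get i n s) ys * u (put i ys s))"

lemma app_embo: "app (embo i n A) u s = (\<Sum>ys | length ys = n. A (get i n s) ys * u (put i ys s))"
  unfolding embo_def
  by (subst app_Endo) (simp_all add: algebra_simps sum.distrib sum_distrib_right)

lemma embo_mult: "embo i n (op_mult n A B) = embo i n A * embo i n B"
proof (rule endo_eqI)
  fix u s
  have "app (embo i n A * embo i n B) u s =
     (\<Sum>zs | length zs = n. \<Sum>ys | length ys = n. A (get i n s) zs * B zs ys * u (put i ys s))"
    by (simp add: app_times app_embo sum_distrib_left mult.assoc)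
  also have "\<dots> = app (embo i n (op_mult n A B)) u s"
    by (subst sum.swap) (simp add: app_embo op_mult_def sum_distrib_right)
  finally show "app (embo i n (op_mult n A B)) u s = app (embo i n A * embo i n B) u s" ..
qed

lemma embo_id: "embo i n (op_id n) = 1"
proof (rule endo_eqI)
  fix u s
  have "app (embo i n (op_id n)) u s =
      (\<Sum>ys | length ys = n. if get i n s = ys then u (put i ys s) else 0)"
    unfolding app_embo by (rule sum.cong) (auto simp: op_id_def)
  then show "app (embo i n (op_id n)) u s = app 1 u s"
    by (simp add: app_one)
qed

lemma embo_prod: "embo i n (op_prod n As) = prod_list (map (embo i n) As)"
  by (induction As) (simp_all add: op_prod_def embo_id embo_mult)

lemma embo_zero: "embo i n op_zero = 0"
  by (rule endo_eqI) (simp add: app_embo op_zero_def app_zero)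

lemma embo_sum: "embo i n (\<lambda>xs ys. \<Sum>b\<in>B. f b xs ys) = (\<Sum>b\<in>B. embo i n (f b))"
  by (rule endo_eqI) (simp add: app_embo app_sum sum_distrib_right sum.swap[of _ B])

lemma embo_lm: "embo i n (\<lambda>xs ys. c * A xs ys) = lm c * embo i n A"
  by (rule endo_eqI) (simp add: app_embo app_times app_lm sum_distrib_left mult.assoc)

definition delta :: "nat \<Rightarrow> 'n list \<Rightarrow> (nat \<Rightarrow> 'n) \<Rightarrow> 'a::ring_1" where
  "delta n ys t = (if get 0 n t = ys then 1 else 0)"

lemma app_embo_delta:
  assumes "length xs = n" "length ys = n"
  shows "app (embo 0 n A) (delta n ys) (put 0 xs s) = A xs ys"
proof -
  have "app (embo 0 n A) (delta n ys) (put 0 xs s) =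
      (\<Sum>zs | length zs = n. if zs = ys then A xs ys else 0)"
    unfolding app_embo by (rule sum.cong) (use assms in \<open>auto simp: delta_def\<close>)
  then show ?thesis using assms by simp
qed

text \<open>The trace over the first \<open>n\<close> factors, read off at one arbitrary tail. For
  operators living on these factors the tail does not matter, and additivity holds for all
  endomorphisms without any side condition.\<close>

definition tr :: "nat \<Rightarrow> ('n::finite, 'a::ring_1) chain \<Rightarrow> 'a" where
  "tr n x = (\<Sum>xs | length xs = n. app x (delta n xs) (put 0 xs undefined))"

lemma tr_embo: "tr n (embo 0 n A) = op_trace n A"
  by (simp add: tr_def op_trace_def app_embo_delta)

lemma tr_add: "tr n (x + y) = tr n x + tr n y"
  by (simp add: tr_def app_simps sum.distrib)

lemma tr_diff: "tr n (x - y) = tr n x - tr n y"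
  by (simp add: tr_def app_simps sum_subtractf)

lemma tr_sum: "tr n (\<Sum>a\<in>A. x a) = (\<Sum>a\<in>A. tr n (x a))"
  by (simp add: tr_def app_sum sum.swap[of _ A])

lemma tr_lm_left: "tr n (lm c * x) = c * tr n x"
  by (simp add: tr_def app_times app_lm sum_distrib_left)

lemma tr_lm_right:
  fixes x :: "('n::finite, 'a::ring_1) chain"
  shows "tr n (x * lm c) = tr n x * c"
proof -
  \<comment> \<open>The values 0 and 1 of \<open>delta\<close> commute with \<open>c\<close>, which
    can therefore move to the right, where \<open>x\<close> is linear.\<close>
  have "app (lm c) (delta n xs) = (\<lambda>t. delta n xs t * c)" for xs :: "'n list"
    by (auto simp: fun_eq_iff app_lm delta_def)
  then show ?thesis
    by (simp add: tr_def app_times app_fmult sum_distrib_right)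
qed

lemma sum_lists_Suc:
  fixes f :: "'n::finite list \<Rightarrow> 'a::comm_monoid_add"
  shows "(\<Sum>xs | length xs = Suc n. f xs) = (\<Sum>xs | length xs = n. \<Sum>a\<in>UNIV. f (xs @ [a]))"
proof -
  have "(\<Sum>xs | length xs = Suc n. f xs) = (\<Sum>(xs, a)\<in>{xs. length xs = n} \<times> UNIV. f (xs @ [a]))"
    by (rule sum.reindex_bij_witness[where i = "\<lambda>(xs, a). xs @ [a]" and j = "\<lambda>xs. (butlast xs, last xs)"])
      (auto simp: snoc_eq_iff_butlast intro!: arg_cong[where f = f])
  then show ?thesis by (simp add: sum.cartesian_product)
qed

lemma tr_ptr:
  fixes x :: "('n::finite, 'a::ring_1) chain"
  shows "tr (Suc n) x = tr n (ptr n x)"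
proof -
  have "app (ptr n x) (delta n xs) (put 0 xs undefined) =
      (\<Sum>a\<in>UNIV. app x (delta (Suc n) (xs @ [a])) (put 0 (xs @ [a]) undefined))"
    if "length xs = n" for xs
  proof -
    have "(\<lambda>t. if t n = a then delta n xs (t(n := b)) else 0) = (delta (Suc n) (xs @ [a]) :: _ \<Rightarrow> 'a)" for a b
    proof
      fix t :: "nat \<Rightarrow> 'n"
      have "get 0 n (t(n := b)) = get 0 n t"
        by (auto simp: get_def)
      moreover have "get 0 (Suc n) t = get 0 n t @ [t n]"
        by (simp add: get_def)
      ultimately show "(if t n = a then delta n xs (t(n := b)) else 0) = (delta (Suc n) (xs @ [a]) t :: 'a)"
        by (simp add: delta_def)
    qed
    moreover have "(put 0 xs undefined)(n := a) = put 0 (xs @ [a]) undefined" for a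
      using that by (auto simp: put_def fun_eq_iff nth_append)
    ultimately show ?thesis
      by (simp add: ptr_def app_sum app_blk)
  qed
  then show ?thesis
    by (simp add: tr_def sum_lists_Suc)
qed

lemma tr_0_lm: "tr 0 (lm c) = c"
  by (simp add: tr_def app_lm delta_def get_def)

text \<open>Over a noncommutative ring the trace is cyclic only if the entries of one factor are
  central.\<close>

lemma op_trace_commute:
  assumes "\<And>xs ys c. A xs ys * c = c * A xs ys"
  shows "op_trace n (op_mult n A B) = op_trace n (op_mult n B A)"
  unfolding op_trace_def op_mult_def by (subst sum.swap) (simp add: assms)

lemma tr_commute:
  assumes "\<And>xs ys c. A xs ys * c = c * A xs ys"
  shows "tr n (embo 0 n A * embo 0 n B) = tr n (embo 0 n B * embo 0 n A)"
  by (simp add: op_trace_commute[OF assms] tr_embo flip: embo_mult)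

definition local :: "nat \<Rightarrow> ('n::finite, 'a::ring_1) chain \<Rightarrow> bool" where
  "local n x \<longleftrightarrow> (\<exists>A. x = embo 0 n A)"

lemma local_mult: "local n x \<Longrightarrow> local n y \<Longrightarrow> local n (x * y)"
  unfolding local_def by (metis embo_mult)

lemma local_1: "local n 1"
  unfolding local_def by (metis embo_id)

lemma embo_op1:
  fixes Y :: "'a::ring_1^'n::finite^'n"
  assumes "j < n"
  shows "embo i n (leg1 n (Suc j) Y) = op1 (i + j) Y"
proof (rule endo_eqI)
  fix u and s :: "nat \<Rightarrow> 'n"
  let ?g = "get i n s"
  \<comment> \<open>A nonzero entry forces \<open>ys\<close> to agree with the row index outside
    position \<open>j\<close>, so the sum over lists collapses to a sum over one letter.\<close>
  have "app (embo i n (leg1 n (Suc j) Y)) u s =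
      (\<Sum>ys\<in>(\<lambda>a. ?g[j := a]) ` UNIV. leg1 n (Suc j) Y ?g ys * u (put i ys s))"
    unfolding app_embo
  proof (rule sum.mono_neutral_right)
    show "\<forall>ys\<in>{ys. length ys = n} - range (\<lambda>a. ?g[j := a]). leg1 n (Suc j) Y ?g ys * u (put i ys s) = 0"
    proof
      fix ys assume ys: "ys \<in> {ys. length ys = n} - range (\<lambda>a. ?g[j := a])"
      have "leg1 n (Suc j) Y ?g ys = 0"
      proof (rule ccontr)
        assume "leg1 n (Suc j) Y ?g ys \<noteq> 0"
        then have *: "\<forall>k\<in>{1..n} - {Suc j}. fac ?g k = fac ys k"
          by (auto simp: leg1_def split: if_splits)
        have "ys = ?g[j := ys ! j]"
        proof (rule nth_equalityI)
          fix k assume "k < length ys"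
          then show "ys ! k = ?g[j := ys ! j] ! k"
            using *[rule_format, of "Suc k"] ys by (cases "k = j") (auto simp: fac_def)
        qed (use ys in auto)
        then show False using ys by blast
      qed
      then show "leg1 n (Suc j) Y ?g ys * u (put i ys s) = 0" by simp
    qed
  qed auto
  also have "\<dots> = (\<Sum>a\<in>UNIV. leg1 n (Suc j) Y ?g (?g[j := a]) * u (put i (?g[j := a]) s))"
  proof (subst sum.reindex)
    show "inj (\<lambda>a. ?g[j := a])"
      by (rule injI) (metis assms length_get nth_list_update_eq)
  qed simp
  also have "\<dots> = app (op1 (i + j) Y) u s"
    unfolding app_op1
  proof (rule sum.cong[OF HOL.refl])
    fix a
    have "put i (?g[j := a]) s = s(i + j := a)"
      using assms by (auto simp: put_def fun_eq_iff nth_list_update)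
    moreover have "leg1 n (Suc j) Y ?g (?g[j := a]) = Y $ s (i + j) $ a"
      using assms by (auto simp: leg1_def fac_def nth_list_update)
    ultimately show "leg1 n (Suc j) Y ?g (?g[j := a]) * u (put i (?g[j := a]) s) = Y $ s (i + j) $ a * u (s(i + j := a))"
      by simp
  qed
  finally show "app (embo i n (leg1 n (Suc j) Y)) u s = app (op1 (i + j) Y) u s" .
qed

lemma embo_op2:
  fixes X :: "'n::finite mat2"
  assumes "Suc j < n"
  shows "embo i n (op_scal (adj n (Suc j) X)) = op2 (i + j) X"
proof (rule endo_eqI)
  fix u and s :: "nat \<Rightarrow> 'n"
  let ?g = "get i n s"
  let ?h = "\<lambda>p. ?g[j := fst p, Suc j := snd p]"
  let ?A = "op_scal (adj n (Suc j) X)"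
  have "app (embo i n ?A) u s = (\<Sum>ys\<in>?h ` UNIV. ?A ?g ys * u (put i ys s))"
    unfolding app_embo
  proof (rule sum.mono_neutral_right)
    show "\<forall>ys\<in>{ys. length ys = n} - range ?h. ?A ?g ys * u (put i ys s) = 0"
    proof
      fix ys assume ys: "ys \<in> {ys. length ys = n} - range ?h"
      have "?A ?g ys = 0"
      proof (rule ccontr)
        assume "?A ?g ys \<noteq> 0"
        then have *: "\<forall>k\<in>{1..n} - {Suc j, Suc (Suc j)}. fac ?g k = fac ys k"
          by (auto simp: op_scal_def leg2_def split: if_splits)
        have "ys = ?h (ys ! j, ys ! Suc j)"
        proof (rule nth_equalityI)
          fix k assume "k < length ys"
          then show "ys ! k = ?h (ys ! j, ys ! Suc j) ! k"
            using *[rule_format, of "Suc k"] ys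
            by (cases "k = j"; cases "k = Suc j") (auto simp: fac_def)
        qed (use ys in auto)
        then show False using ys by blast
      qed
      then show "?A ?g ys * u (put i ys s) = 0" by simp
    qed
  qed auto
  also have "\<dots> = (\<Sum>p\<in>UNIV. ?A ?g (?h p) * u (put i (?h p) s))"
  proof (subst sum.reindex)
    have "?h p ! j = fst p" "?h p ! Suc j = snd p" for p
      using assms by (auto simp: nth_list_update)
    then show "inj ?h"
      by (metis (no_types, lifting) injI prod_eqI)
  qed simp
  also have "\<dots> = app (op2 (i + j) X) u s"
    unfolding app_op2'
  proof (rule sum.cong[OF HOL.refl])
    fix p
    have "put i (?h p) s = s(i + j := fst p, Suc (i + j) := snd p)"
      using assms by (auto simp: put_def fun_eq_iff nth_list_update)
    moreover have "?A ?g (?h p) = scal (X $ (s (i + j), s (Suc (i + j))) $ p)"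
      using assms by (auto simp: op_scal_def leg2_def fac_def nth_list_update)
    ultimately show "?A ?g (?h p) * u (put i (?h p) s) =
        scal (X $ (s (i + j), s (Suc (i + j))) $ p) * u (s(i + j := fst p, Suc (i + j) := snd p))"
      by simp
  qed
  finally show "app (embo i n ?A) u s = app (op2 (i + j) X) u s" .
qed

lemma embo_cop1:
  assumes "j < n"
  shows "embo i n (op_scal (leg1 n (Suc j) Y)) = cop1 (i + j) Y"
proof -
  have "op_scal (leg1 n (Suc j) Y) = leg1 n (Suc j) (smat Y)"
    by (auto simp: fun_eq_iff op_scal_def leg1_def smat_def)
  then show ?thesis using embo_op1[OF assms] by metis
qed

lemma op_scal_mult: "op_scal (op_mult n A B) = op_mult n (op_scal A) (op_scal B)"
  by (simp add: fun_eq_iff op_scal_def op_mult_def scal_sum scal_mult)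

lemma op_scal_id: "op_scal (op_id n) = op_id n"
  by (auto simp: fun_eq_iff op_scal_def op_id_def)

lemma op_scal_prod: "op_scal (op_prod n As) = op_prod n (map op_scal As)"
  by (induction As) (simp_all add: op_prod_def op_scal_id op_scal_mult)

lemma embo_scal_prod: "embo i n (op_scal (op_prod n As)) = prod_list (map (\<lambda>A. embo i n (op_scal A)) As)"
  by (simp add: op_scal_prod embo_prod o_def)

lemma local_op1: "i < n \<Longrightarrow> local n (op1 i Y)"
  unfolding local_def using embo_op1[of i n 0 Y] by (auto dest: HOL.sym)

lemma local_op2: "Suc i < n \<Longrightarrow> local n (op2 i (Y :: 'n::finite mat2) :: ('n, 'n falg) chain)"
  unfolding local_def using embo_op2[of i n 0 Y] by (auto dest: HOL.sym)

lemma tr_commute_op2: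
  fixes x :: "('n::finite, 'n falg) chain"
  assumes "Suc i < n" "local n x"
  shows "tr n (op2 i Y * x) = tr n (x * op2 i Y)"
proof -
  obtain B where B: "x = embo 0 n B" using assms by (auto simp: local_def)
  show ?thesis
    using tr_commute[of "op_scal (adj n (Suc i) Y)" n B] embo_op2[OF assms(1), of 0 Y]
    by (simp add: B op_scal_def scal_central)
qed

section \<open>Skew inverses and the R-trace\<close>

lemma sum_lists_3:
  fixes f :: "'n::finite list \<Rightarrow> 'a::comm_monoid_add"
  shows "(\<Sum>xs | length xs = 3. f xs) = (\<Sum>a\<in>UNIV. \<Sum>b\<in>UNIV. \<Sum>c\<in>UNIV. f [a, b, c])"
  by (simp add: sum_lists_Suc numeral_3_eq_3)

lemma leg2_12_3: "leg2 3 1 2 X [a, b, c] [d, e, f] = (if c = f then X $ (a, b) $ (d, e) else 0)"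
  and leg2_23_3: "leg2 3 2 3 X [a, b, c] [d, e, f] = (if a = d then X $ (b, c) $ (e, f) else 0)"
  and leg2_12_2: "leg2 2 1 2 X [a, b] [c, d] = X $ (a, b) $ (c, d)"
proof -
  have "{1..3} - {1, 2} = {3::nat}" "{1..3} - {2, 3} = {1::nat}" "{1..2} - {1, 2} = ({} :: nat set)"
    by auto
  then show "leg2 3 1 2 X [a, b, c] [d, e, f] = (if c = f then X $ (a, b) $ (d, e) else 0)"
    "leg2 3 2 3 X [a, b, c] [d, e, f] = (if a = d then X $ (b, c) $ (e, f) else 0)"
    "leg2 2 1 2 X [a, b] [c, d] = X $ (a, b) $ (c, d)"
    by (simp_all only: leg2_def) (simp_all add: fac_def)
qed

lemma sum_if_const: "(\<Sum>x\<in>A. if P then f x else 0) = (if P then sum f A else 0)"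
  by simp

lemma sum_delta_mult:
  fixes f :: "'n::finite \<Rightarrow> 'a::semiring_0"
  shows "(\<Sum>x\<in>UNIV. (if x = c then f x else 0) * g x) = f c * g c"
    and "(\<Sum>x\<in>UNIV. (if c = x then f x else 0) * g x) = f c * g c"
    and "(\<Sum>x\<in>UNIV. g x * (if x = c then f x else 0)) = g c * f c"
    and "(\<Sum>x\<in>UNIV. g x * (if c = x then f x else 0)) = g c * f c"
  by (simp_all add: if_distrib[of "\<lambda>y. y * _"] if_distrib[of "(*) _"] cong: if_cong)

lemma skew_inverse_sums:
  assumes "skew_inverse X \<Psi>"
  shows "(\<Sum>x\<in>UNIV. \<Sum>z\<in>UNIV. X $ (a, x) $ (d, z) * \<Psi> $ (z, c) $ (x, f)) =
      (if a = f \<and> c = d then 1 else 0)" (is ?A)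
    and "(\<Sum>x\<in>UNIV. \<Sum>z\<in>UNIV. \<Psi> $ (a, x) $ (d, z) * X $ (z, c) $ (x, f)) =
      (if a = f \<and> c = d then 1 else 0)" (is ?B)
proof -
  have "op_ptrace 2 (op_mult 3 (leg2 3 1 2 A) (leg2 3 2 3 B)) [a, c] [d, f] =
      (\<Sum>x\<in>UNIV. \<Sum>z\<in>UNIV. A $ (a, x) $ (d, z) * B $ (z, c) $ (x, f))" for A B :: "'a mat2"
    unfolding op_ptrace_def
  proof (rule sum.cong[OF HOL.refl])
    fix x
    have "op_mult 3 (leg2 3 1 2 A) (leg2 3 2 3 B) [a, x, c] [d, x, f] =
        (\<Sum>u\<in>UNIV. \<Sum>v\<in>UNIV. \<Sum>w\<in>UNIV. (if c = w then A $ (a, x) $ (u, v) else 0) *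
          (if u = d then B $ (v, w) $ (x, f) else 0))"
      by (simp only: op_mult_def sum_lists_3 leg2_12_3 leg2_23_3)
    also have "\<dots> = (\<Sum>u\<in>UNIV. if u = d then (\<Sum>v\<in>UNIV. \<Sum>w\<in>UNIV. if c = w then
        A $ (a, x) $ (u, v) * B $ (v, w) $ (x, f) else 0) else 0)"
      by (rule sum.cong) (auto intro!: sum.cong simp: sum_delta_mult)
    finally show "op_mult 3 (leg2 3 1 2 A) (leg2 3 2 3 B) (insert_at 2 x [a, c]) (insert_at 2 x [d, f]) =
        (\<Sum>z\<in>UNIV. A $ (a, x) $ (d, z) * B $ (z, c) $ (x, f))"
      by (simp add: insert_at_def sum_delta_mult)
  qed
  moreover have "leg2 2 1 2 flip [a, c] [d, f] = (if a = f \<and> c = d then 1 else (0::complex))"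
    unfolding leg2_12_2 by (simp add: flip_def)
  ultimately show ?A ?B
    using assms by (metis skew_inverse_def)+
qed

lemma Dmat_nth: "Dmat X $ a $ b = (\<Sum>x\<in>UNIV. Psi X $ (a, x) $ (b, x))"
  by (simp add: Dmat_def op_ptrace_def insert_at_def leg2_12_2[simplified])

lemma skew_inverse_Psi: "skew_invertible X \<Longrightarrow> skew_inverse X (Psi X)"
  unfolding skew_invertible_def Psi_def by (rule someI_ex)

text \<open>The normalisation
  \<open>Tr\<^sub>R\<^sub>(\<^sub>2\<^sub>) X\<^sub>1\<^sub>2 = I\<close>: in the first skew inverse
  equation, setting \<open>f = c\<close> and summing over \<open>c\<close> turns
  \<open>Psi X\<close> into \<open>Dmat X\<close>.\<close>

lemma sum_X_D:
  assumes "skew_invertible X"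
  shows "(\<Sum>x\<in>UNIV. \<Sum>z\<in>UNIV. X $ (a, x) $ (d, z) * Dmat X $ z $ x) = (if a = d then 1 else 0)"
proof -
  have "(\<Sum>x\<in>UNIV. \<Sum>z\<in>UNIV. X $ (a, x) $ (d, z) * Dmat X $ z $ x) =
      (\<Sum>x\<in>UNIV. \<Sum>z\<in>UNIV. \<Sum>c\<in>UNIV. X $ (a, x) $ (d, z) * Psi X $ (z, c) $ (x, c))"
    by (simp add: Dmat_nth sum_distrib_left)
  also have "\<dots> = (\<Sum>x\<in>UNIV. \<Sum>c\<in>UNIV. \<Sum>z\<in>UNIV. X $ (a, x) $ (d, z) * Psi X $ (z, c) $ (x, c))"
    by (rule sum.cong[OF HOL.refl], rule sum.swap)
  also have "\<dots> = (\<Sum>c\<in>UNIV. \<Sum>x\<in>UNIV. \<Sum>z\<in>UNIV. X $ (a, x) $ (d, z) * Psi X $ (z, c) $ (x, c))"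
    by (rule sum.swap)
  also have "\<dots> = (\<Sum>c\<in>UNIV. if a = c then (if c = d then 1 else 0) else 0)"
    by (rule sum.cong) (auto simp: skew_inverse_sums(1)[OF skew_inverse_Psi[OF assms]])
  finally show ?thesis by simp
qed

lemma app_op2_3:
  assumes "s 0 = a" "s (Suc 0) = b" "s (Suc (Suc 0)) = c"
  shows "app (op2 (Suc 0) A * op2 0 B * op2 (Suc 0) C) (delta 3 [d, e, f]) s =
      scal (\<Sum>b'\<in>UNIV. \<Sum>c'\<in>UNIV. \<Sum>e'\<in>UNIV. A $ (b, c) $ (b', c') * B $ (a, b') $ (d, e') * C $ (e', c') $ (e, f))"
    (is ?P)
    and "app (op2 0 A * op2 (Suc 0) B * op2 0 C) (delta 3 [d, e, f]) s =
      scal (\<Sum>a'\<in>UNIV. \<Sum>b'\<in>UNIV. \<Sum>b''\<in>UNIV. A $ (a, b) $ (a', b') * B $ (b', c) $ (b'', f) * C $ (a', b'') $ (d, e))"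
    (is ?Q)
proof -
  have delta: "delta 3 [d, e, f] t =
      (if t 0 = d then if t (Suc 0) = e then if t (Suc (Suc 0)) = f then 1 else 0 else 0 else 0)" for t
    by (simp add: delta_def get_def numeral_3_eq_3)
  show ?P
    by (simp add: app_times app_op2 delta assms if_distrib[of "(*) _"] scal_sum scal_mult
        sum_distrib_left mult.assoc sum_if_const cong: if_cong)
  show ?Q
    apply (simp add: app_times app_op2 delta assms if_distrib[of "(*) _"] scal_sum scal_mult
        sum_distrib_left mult.assoc sum_if_const cong: if_cong)
    done
qed

lemma matrix_mult_inverse_sum:
  fixes A B :: "'n::finite mat2"
  assumes "A ** B = mat 1"
  shows "(\<Sum>u\<in>UNIV. \<Sum>v\<in>UNIV. A $ (a, b) $ (u, v) * B $ (u, v) $ (d, e)) = (if a = d \<and> b = e then 1 else 0)"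
proof -
  have "(A ** B) $ (a, b) $ (d, e) = (\<Sum>u\<in>UNIV. \<Sum>v\<in>UNIV. A $ (a, b) $ (u, v) * B $ (u, v) $ (d, e))"
    by (simp add: matrix_matrix_mult_def sum_UNIV_prod)
  then show ?thesis by (simp add: assms mat_def)
qed

text \<open>Index form of \<open>Tr\<^bsub>R(2)\<^esub> (G\<^sub>1 Y\<^sub>1 F\<^sub>1) = Tr\<^bsub>R\<^esub> Y\<close> with \<open>Y\<close> the matrix unit at \<open>(r, p)\<close>: contract
  the hypothesis with the skew inverse in the first leg and with \<open>D\<close> in the last one.\<close>

lemma R_trace_conjugation_sum:
  fixes X F G :: "'n::finite mat2"
  assumes skew: "skew_invertible X" and inv: "F ** G = mat 1"
    and comm: "op2 (Suc 0) G * op2 0 X * op2 (Suc 0) F =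
        (op2 0 F * op2 (Suc 0) X * op2 0 G :: ('n, 'n falg) chain)"
  shows "(\<Sum>c\<in>UNIV. \<Sum>c'\<in>UNIV. \<Sum>f\<in>UNIV. G $ (b, c) $ (r, c') * F $ (p, c') $ (e, f) * Dmat X $ f $ c) =
    (if b = e then Dmat X $ p $ r else 0)"
proof -
  let ?D = "Dmat X" and ?\<Psi> = "Psi X"
  have C: "(\<Sum>b'\<in>UNIV. \<Sum>c'\<in>UNIV. \<Sum>e'\<in>UNIV. G $ (b, c) $ (b', c') * X $ (a, b') $ (d, e') * F $ (e', c') $ (e, f)) =
    (\<Sum>a'\<in>UNIV. \<Sum>b'\<in>UNIV. \<Sum>b''\<in>UNIV. F $ (a, b) $ (a', b') * X $ (b', c) $ (b'', f) * G $ (a', b'') $ (d, e))"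
    for a b c d e f
  proof -
    define s :: "nat \<Rightarrow> 'n" where "s = (\<lambda>_. c)(0 := a, 1 := b)"
    have s: "s 0 = a" "s (Suc 0) = b" "s (Suc (Suc 0)) = c" by (auto simp: s_def)
    show ?thesis
      using arg_cong[OF comm, of "\<lambda>x. app x (delta 3 [d, e, f]) s"]
      unfolding app_op2_3[OF s] inj_scal .
  qed
  \<comment> \<open>\<open>H r p\<close> is the sum to be computed; with both indices free it can be
    contracted with the skew inverse.\<close>
  define H where "H = (\<lambda>b' e'. \<Sum>c\<in>UNIV. \<Sum>c'\<in>UNIV. \<Sum>f\<in>UNIV. G $ (b, c) $ (b', c') * F $ (e', c') $ (e, f) * ?D $ f $ c)"
  have "H r p = (\<Sum>b'\<in>UNIV. \<Sum>e'\<in>UNIV. (if p = e' \<and> b' = r then 1 else 0) * H b' e')"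
    by (simp add: if_distrib[of "\<lambda>x. x * _"] if_conn sum_if_const cong: if_cong)
  also have "\<dots> = (\<Sum>b'\<in>UNIV. \<Sum>e'\<in>UNIV. (\<Sum>d\<in>UNIV. \<Sum>a\<in>UNIV. ?\<Psi> $ (p, d) $ (r, a) * X $ (a, b') $ (d, e')) * H b' e')"
    by (simp add: skew_inverse_sums(2)[OF skew_inverse_Psi[OF skew]])
  also have "\<dots> = (\<Sum>t\<in>UNIV. \<Sum>v\<in>UNIV. ?\<Psi> $ (p, fst v) $ (r, snd v) * (X $ (snd v, fst t) $ (fst v, snd t) * H (fst t) (snd t)))"
    by (simp add: sum_UNIV_prod sum_distrib_right mult.assoc)
  also have "\<dots> = (\<Sum>v\<in>UNIV. ?\<Psi> $ (p, fst v) $ (r, snd v) * (\<Sum>t\<in>UNIV. X $ (snd v, fst t) $ (fst v, snd t) * H (fst t) (snd t)))"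
    by (subst sum.swap) (simp add: sum_distrib_left)
  also have "\<dots> = (\<Sum>v\<in>UNIV. ?\<Psi> $ (p, fst v) $ (r, snd v) * (if fst v = snd v \<and> b = e then 1 else 0))"
  proof (rule sum.cong[OF HOL.refl])
    fix v :: "'n \<times> 'n"
    obtain d a where v: "v = (d, a)" by (cases v)
    have "(\<Sum>t\<in>UNIV. X $ (snd v, fst t) $ (fst v, snd t) * H (fst t) (snd t)) =
      (\<Sum>t\<in>UNIV. \<Sum>w\<in>UNIV. ?D $ snd w $ fst w * (\<Sum>c'\<in>UNIV. G $ (b, fst w) $ (fst t, c') * X $ (a, fst t) $ (d, snd t) * F $ (snd t, c') $ (e, snd w)))"
    proof (rule sum.cong[OF HOL.refl])
      fix t :: "'n \<times> 'n"
      obtain b' e' where t: "t = (b', e')" by (cases t)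
      have "H b' e' = (\<Sum>c\<in>UNIV. \<Sum>f\<in>UNIV. \<Sum>c'\<in>UNIV. G $ (b, c) $ (b', c') * F $ (e', c') $ (e, f) * ?D $ f $ c)"
        unfolding H_def by (rule sum.cong[OF HOL.refl], rule sum.swap)
      then show "X $ (snd v, fst t) $ (fst v, snd t) * H (fst t) (snd t) =
        (\<Sum>w\<in>UNIV. ?D $ snd w $ fst w * (\<Sum>c'\<in>UNIV. G $ (b, fst w) $ (fst t, c') * X $ (a, fst t) $ (d, snd t) * F $ (snd t, c') $ (e, snd w)))"
        by (simp add: v t sum_UNIV_prod sum_distrib_left mult_ac)
    qed
    also have "\<dots> = (\<Sum>w\<in>UNIV. ?D $ snd w $ fst w * (\<Sum>t\<in>UNIV. \<Sum>c'\<in>UNIV. G $ (b, fst w) $ (fst t, c') * X $ (a, fst t) $ (d, snd t) * F $ (snd t, c') $ (e, snd w)))"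
      by (subst sum.swap) (simp add: sum_distrib_left)
    also have "\<dots> = (\<Sum>w\<in>UNIV. ?D $ snd w $ fst w * (\<Sum>b'\<in>UNIV. \<Sum>c'\<in>UNIV. \<Sum>e'\<in>UNIV. G $ (b, fst w) $ (b', c') * X $ (a, b') $ (d, e') * F $ (e', c') $ (e, snd w)))"
    proof (rule sum.cong[OF HOL.refl], rule arg_cong[where f = "(*) _"])
      fix w :: "'n \<times> 'n"
      show "(\<Sum>t\<in>UNIV. \<Sum>c'\<in>UNIV. G $ (b, fst w) $ (fst t, c') * X $ (a, fst t) $ (d, snd t) * F $ (snd t, c') $ (e, snd w)) =
        (\<Sum>b'\<in>UNIV. \<Sum>c'\<in>UNIV. \<Sum>e'\<in>UNIV. G $ (b, fst w) $ (b', c') * X $ (a, b') $ (d, e') * F $ (e', c') $ (e, snd w))"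
        unfolding sum_UNIV_prod fst_conv snd_conv by (rule sum.cong[OF HOL.refl], rule sum.swap)
    qed
    \<comment> \<open>The hypothesis moves \<open>X\<close> from the first two legs to the last two,
      where it meets \<open>?D\<close> and \<open>sum_X_D\<close> removes it.\<close>
    also have "\<dots> = (\<Sum>w\<in>UNIV. ?D $ snd w $ fst w * (\<Sum>a'\<in>UNIV. \<Sum>t\<in>UNIV. F $ (a, b) $ (a', fst t) * G $ (a', snd t) $ (d, e) * X $ (fst t, fst w) $ (snd t, snd w)))"
      unfolding C by (simp add: sum_UNIV_prod mult_ac)
    also have "\<dots> = (\<Sum>w\<in>UNIV. \<Sum>z\<in>UNIV. F $ (a, b) $ (fst z, fst (snd z)) * G $ (fst z, snd (snd z)) $ (d, e) *
       (X $ (fst (snd z), fst w) $ (snd (snd z), snd w) * ?D $ snd w $ fst w))"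
      by (simp add: sum_UNIV_prod sum_distrib_left mult_ac)
    also have "\<dots> = (\<Sum>z\<in>UNIV. F $ (a, b) $ (fst z, fst (snd z)) * G $ (fst z, snd (snd z)) $ (d, e) *
       (\<Sum>w\<in>UNIV. X $ (fst (snd z), fst w) $ (snd (snd z), snd w) * ?D $ snd w $ fst w))"
      by (subst sum.swap) (simp add: sum_distrib_left)
    also have "\<dots> = (\<Sum>a'\<in>UNIV. \<Sum>b'\<in>UNIV. \<Sum>b''\<in>UNIV. F $ (a, b) $ (a', b') * G $ (a', b'') $ (d, e) *
       (if b' = b'' then 1 else 0))"
      by (simp add: sum_UNIV_prod sum_X_D[OF skew])
    also have "\<dots> = (\<Sum>a'\<in>UNIV. \<Sum>b'\<in>UNIV. F $ (a, b) $ (a', b') * G $ (a', b') $ (d, e))"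
      by (simp add: if_distrib[of "(*) _"] cong: if_cong)
    also have "\<dots> = (if a = d \<and> b = e then 1 else 0)"
      by (rule matrix_mult_inverse_sum[OF inv])
    finally show "?\<Psi> $ (p, fst v) $ (r, snd v) * (\<Sum>t\<in>UNIV. X $ (snd v, fst t) $ (fst v, snd t) * H (fst t) (snd t)) =
        ?\<Psi> $ (p, fst v) $ (r, snd v) * (if fst v = snd v \<and> b = e then 1 else 0)"
      by (auto simp: v)
  qed
  also have "\<dots> = (if b = e then ?D $ p $ r else 0)"
    by (simp add: sum_UNIV_prod Dmat_nth if_distrib[of "(*) _"] if_conn cong: if_cong)
  finally show ?thesis by (simp add: H_def)
qed

lemma embo_adj_3:
  fixes X :: "'n::finite mat2"
  shows "embo i 3 (op_scal (adj 3 1 X)) = op2 i X"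
    and "embo i 3 (op_scal (adj 3 2 X)) = op2 (Suc i) X"
  using embo_op2[of 0 3 i X] embo_op2[of 1 3 i X] by (simp_all add: numeral_2_eq_2)

lemma op2_3_relation:
  fixes X Y Z :: "'n::finite mat2"
  shows "op_prod 3 [adj 3 1 X, adj 3 2 Y, adj 3 1 Z] = op_prod 3 [adj 3 2 X', adj 3 1 Y', adj 3 2 Z'] \<Longrightarrow>
      op2 i X * op2 (Suc i) Y * op2 i Z = (op2 (Suc i) X' * op2 i Y' * op2 (Suc i) Z' :: ('n, 'n falg) chain)" (is "?A \<Longrightarrow> ?B")
proof -
  assume ?A
  from arg_cong[OF this, of "\<lambda>A. embo i 3 (op_scal A)"] show ?B
    by (simp only: embo_scal_prod list.map embo_adj_3) (simp add: mult.assoc)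
qed

definition DD :: "'n::finite mat2 \<Rightarrow> 'n mat2" where
  "DD X = (\<chi> x y. Dmat X $ fst x $ fst y * Dmat X $ snd x $ snd y)"

lemma op2_DD: "op2 i (DD X) = cop1 i (Dmat X) * cop1 (Suc i) (Dmat X)"
  by (rule endo_eqI)
    (simp add: app_op2 app_times app_cop1 DD_def scal_mult sum_distrib_left mult.assoc)

lemma matrix_inv_unique:
  fixes A :: "complex^'n^'n"
  assumes "A ** B = mat 1"
  shows "B ** A = mat 1"
  using assms by (simp add: matrix_left_right_inverse)

text \<open>The commutation follows from \<open>\<Psi>\<^sub>1\<^sub>2 D\<^sub>2 = D\<^sub>1 R\<^sub>2\<^sub>1\<^sup>-\<^sup>1\<close> and \<open>D\<^sub>2 \<Psi>\<^sub>1\<^sub>2 = R\<^sub>2\<^sub>1\<^sup>-\<^sup>1 D\<^sub>1\<close>.\<close>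

lemma DD_commute_inverse:
  fixes X F G :: "'n::finite mat2"
  assumes skew: "skew_invertible X" and inv: "X ** G = mat 1"
    and comm1: "op2 (Suc 0) G * op2 0 X * op2 (Suc 0) X =
        (op2 0 X * op2 (Suc 0) X * op2 0 G :: ('n, 'n falg) chain)"
    and comm2: "op2 (Suc 0) X * op2 0 X * op2 (Suc 0) G =
        (op2 0 G * op2 (Suc 0) X * op2 0 X :: ('n, 'n falg) chain)"
  shows "DD X ** G = G ** DD X"
proof -
  let ?D = "Dmat X" and ?\<Psi> = "Psi X"
  \<comment> \<open>This is \<open>\<Psi>\<^sub>1\<^sub>2 D\<^sub>2 = D\<^sub>1
    R\<^sub>2\<^sub>1\<^sup>-\<^sup>1\<close> entrywise: take \<open>R_trace_conjugation_sum\<close>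
    with \<open>F = X\<close> and contract it with \<open>?\<Psi>\<close>, which cancels
    \<open>X\<close>. The second equation arises in the same way with the roles of \<open>X\<close>
    and \<open>G\<close> exchanged.\<close>
  have I: "(\<Sum>c\<in>UNIV. G $ (b, c) $ (r, h) * ?D $ g $ c) = (\<Sum>p\<in>UNIV. ?\<Psi> $ (g, b) $ (h, p) * ?D $ p $ r)" for b r h g
  proof -
    have "(\<Sum>p\<in>UNIV. ?\<Psi> $ (g, b) $ (h, p) * ?D $ p $ r) =
        (\<Sum>e\<in>UNIV. \<Sum>p\<in>UNIV. ?\<Psi> $ (g, e) $ (h, p) * (if b = e then ?D $ p $ r else 0))"
      by (subst sum.swap) (simp add: if_distrib[of "(*) _"] cong: if_cong)
    also have "\<dots> = (\<Sum>v\<in>UNIV. ?\<Psi> $ (g, fst v) $ (h, snd v) *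
        (\<Sum>w\<in>UNIV. G $ (b, fst w) $ (r, fst (snd w)) * X $ (snd v, fst (snd w)) $ (fst v, snd (snd w)) * ?D $ snd (snd w) $ fst w))"
      by (simp add: sum_UNIV_prod R_trace_conjugation_sum[OF skew inv comm1] cong: if_cong)
    also have "\<dots> = (\<Sum>w\<in>UNIV. \<Sum>v\<in>UNIV. ?\<Psi> $ (g, fst v) $ (h, snd v) *
        (G $ (b, fst w) $ (r, fst (snd w)) * X $ (snd v, fst (snd w)) $ (fst v, snd (snd w)) * ?D $ snd (snd w) $ fst w))"
      by (subst sum.swap) (simp add: sum_distrib_left)
    also have "\<dots> = (\<Sum>w\<in>UNIV. (\<Sum>v\<in>UNIV. ?\<Psi> $ (g, fst v) $ (h, snd v) * X $ (snd v, fst (snd w)) $ (fst v, snd (snd w))) *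
        (G $ (b, fst w) $ (r, fst (snd w)) * ?D $ snd (snd w) $ fst w))"
      by (simp add: sum_distrib_left sum_distrib_right mult_ac)
    also have "\<dots> = (\<Sum>c\<in>UNIV. \<Sum>c'\<in>UNIV. \<Sum>f\<in>UNIV. (if g = f \<and> c' = h then 1 else 0) * (G $ (b, c) $ (r, c') * ?D $ f $ c))"
      by (simp add: sum_UNIV_prod skew_inverse_sums(2)[OF skew_inverse_Psi[OF skew]])
    also have "\<dots> = (\<Sum>c\<in>UNIV. G $ (b, c) $ (r, h) * ?D $ g $ c)"
      by (simp add: if_distrib[of "\<lambda>x. x * _"] if_conn sum_if_const cong: if_cong)
    finally show ?thesis ..
  qed
  have II: "(\<Sum>f\<in>UNIV. G $ (p, g) $ (e, f) * ?D $ f $ h) = (\<Sum>r\<in>UNIV. ?D $ p $ r * ?\<Psi> $ (g, r) $ (h, e))" for p g e h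
  proof -
    have "(\<Sum>r\<in>UNIV. ?D $ p $ r * ?\<Psi> $ (g, r) $ (h, e)) =
        (\<Sum>r\<in>UNIV. \<Sum>b\<in>UNIV. ?\<Psi> $ (g, r) $ (h, b) * (if b = e then ?D $ p $ r else 0))"
      by (simp add: if_distrib[of "(*) _"] mult.commute cong: if_cong)
    also have "\<dots> = (\<Sum>v\<in>UNIV. ?\<Psi> $ (g, fst v) $ (h, snd v) *
        (\<Sum>w\<in>UNIV. X $ (snd v, fst w) $ (fst v, fst (snd w)) * G $ (p, fst (snd w)) $ (e, snd (snd w)) * ?D $ snd (snd w) $ fst w))"
      by (simp add: sum_UNIV_prod R_trace_conjugation_sum[OF skew matrix_inv_unique[OF inv] comm2] cong: if_cong)
    also have "\<dots> = (\<Sum>w\<in>UNIV. \<Sum>v\<in>UNIV. ?\<Psi> $ (g, fst v) $ (h, snd v) *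
        (X $ (snd v, fst w) $ (fst v, fst (snd w)) * G $ (p, fst (snd w)) $ (e, snd (snd w)) * ?D $ snd (snd w) $ fst w))"
      by (subst sum.swap) (simp add: sum_distrib_left)
    also have "\<dots> = (\<Sum>w\<in>UNIV. (\<Sum>v\<in>UNIV. ?\<Psi> $ (g, fst v) $ (h, snd v) * X $ (snd v, fst w) $ (fst v, fst (snd w))) *
        (G $ (p, fst (snd w)) $ (e, snd (snd w)) * ?D $ snd (snd w) $ fst w))"
      by (simp add: sum_distrib_left sum_distrib_right mult_ac)
    also have "\<dots> = (\<Sum>c\<in>UNIV. \<Sum>c'\<in>UNIV. \<Sum>f\<in>UNIV. (if g = c' \<and> c = h then 1 else 0) * (G $ (p, c') $ (e, f) * ?D $ f $ c))"
      by (simp add: sum_UNIV_prod skew_inverse_sums(2)[OF skew_inverse_Psi[OF skew]])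
    also have "\<dots> = (\<Sum>f\<in>UNIV. G $ (p, g) $ (e, f) * ?D $ f $ h)"
      by (simp add: if_distrib[of "\<lambda>x. x * _"] if_conn sum_if_const cong: if_cong)
    finally show ?thesis ..
  qed
  \<comment> \<open>By the two equations both sides are the same entry of
    \<open>D\<^sub>2 \<Psi>\<^sub>1\<^sub>2 D\<^sub>2\<close>.\<close>
  have "(DD X ** G) $ (x, g) $ (r, h) = (G ** DD X) $ (x, g) $ (r, h)" for x g r h
  proof -
    have "(DD X ** G) $ (x, g) $ (r, h) = (\<Sum>b\<in>UNIV. ?D $ x $ b * (\<Sum>c\<in>UNIV. G $ (b, c) $ (r, h) * ?D $ g $ c))"
      by (simp add: matrix_matrix_mult_def DD_def sum_UNIV_prod sum_distrib_left mult_ac)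
    also have "\<dots> = (\<Sum>p\<in>UNIV. (\<Sum>b\<in>UNIV. ?D $ x $ b * ?\<Psi> $ (g, b) $ (h, p)) * ?D $ p $ r)"
      unfolding I sum_distrib_left sum_distrib_right by (subst sum.swap) (simp add: mult_ac)
    also have "\<dots> = (G ** DD X) $ (x, g) $ (r, h)"
      unfolding II[symmetric] 
      by (simp add: matrix_matrix_mult_def DD_def sum_UNIV_prod sum_distrib_left mult_ac)
    finally show ?thesis .
  qed
  then show ?thesis by (simp add: vec_eq_iff)
qed

text \<open>The operator form of \<open>R_trace_conjugation_sum\<close>: the traced matrix unit has
  the same value as the unconjugated one in \<open>ptr_cop1_unit\<close>.\<close>

lemma ptr_conjugation_unit:
  fixes X F G :: "'n::finite mat2"
  assumes "skew_invertible X" and "F ** G = mat 1"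
    and "op2 (Suc 0) G * op2 0 X * op2 (Suc 0) F =
        (op2 0 F * op2 (Suc 0) X * op2 0 G :: ('n, 'n falg) chain)"
  shows "ptr (Suc i) (cop1 (Suc i) (Dmat X) * op2 i G * cop1 i (unit_mat r p) * op2 i F) =
    (sc (Dmat X $ p $ r) :: ('n, 'n falg) chain)"
proof (rule endo_eqI)
  fix u :: "(nat \<Rightarrow> 'n) \<Rightarrow> 'n falg" and s :: "nat \<Rightarrow> 'n"
  let ?D = "Dmat X"
  have unit: "app (cop1 i (unit_mat r p)) v t = (if t i = r then v (t(i := p)) else 0)"
    for v :: "(nat \<Rightarrow> 'n) \<Rightarrow> 'n falg" and t
  proof -
    have "app (cop1 i (unit_mat r p)) v t = (\<Sum>a\<in>UNIV. if a = p then (if t i = r then v (t(i := p)) else 0) else 0)"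
      unfolding app_cop1 by (rule sum.cong) (auto simp: unit_mat_def)
    then show ?thesis by simp
  qed
  have upd: "s(i := a, Suc i := b, i := c) = s(i := c, Suc i := b)"
      "s(Suc i := a, i := b, Suc i := c) = s(i := b, Suc i := c)" for a b c
    by (auto simp: fun_eq_iff)
  have "app (ptr (Suc i) (cop1 (Suc i) ?D * op2 i G * cop1 i (unit_mat r p) * op2 i F)) u s =
    (\<Sum>f\<in>UNIV. \<Sum>c\<in>UNIV. \<Sum>c'\<in>UNIV. \<Sum>e\<in>UNIV. scal (?D $ f $ c * G $ (s i, c) $ (r, c') * F $ (p, c') $ (e, f)) * u (s(i := e)))"
    by (simp add: ptr_def app_sum app_blk app_times app_op2 app_cop1[of "Suc i" ?D] unit sum_if_const upd
        scal_mult sum_distrib_left mult.assoc fun_upd_twist[of i "Suc i"]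
        if_distrib[of "(*) _"] cong: if_cong)
  also have "\<dots> = (\<Sum>e\<in>UNIV. scal (\<Sum>c\<in>UNIV. \<Sum>c'\<in>UNIV. \<Sum>f\<in>UNIV. G $ (s i, c) $ (r, c') * F $ (p, c') $ (e, f) * ?D $ f $ c) * u (s(i := e)))"
  proof -
    have "(\<Sum>f\<in>UNIV. \<Sum>c\<in>UNIV. \<Sum>c'\<in>UNIV. \<Sum>e\<in>UNIV. h f c c' e) = (\<Sum>e\<in>UNIV. \<Sum>c\<in>UNIV. \<Sum>c'\<in>UNIV. \<Sum>f\<in>UNIV. h f c c' e)"
      for h :: "'n \<Rightarrow> 'n \<Rightarrow> 'n \<Rightarrow> 'n \<Rightarrow> 'n falg"
    proof -
      have "(\<Sum>f\<in>UNIV. \<Sum>c\<in>UNIV. \<Sum>c'\<in>UNIV. \<Sum>e\<in>UNIV. h f c c' e) = (\<Sum>v\<in>UNIV. \<Sum>w\<in>UNIV. h (fst v) (fst (snd v)) (snd (snd v)) w)"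
        by (simp add: sum_UNIV_prod)
      also have "\<dots> = (\<Sum>e\<in>UNIV. \<Sum>f\<in>UNIV. \<Sum>w\<in>UNIV. h f (fst w) (snd w) e)"
        by (subst sum.swap) (simp add: sum_UNIV_prod)
      also have "\<dots> = (\<Sum>e\<in>UNIV. \<Sum>c\<in>UNIV. \<Sum>c'\<in>UNIV. \<Sum>f\<in>UNIV. h f c c' e)"
        by (rule sum.cong[OF HOL.refl], subst sum.swap) (simp add: sum_UNIV_prod)
      finally show ?thesis .
    qed
    then show ?thesis
      by (simp add: scal_sum sum_distrib_right mult_ac)
  qed
  also have "\<dots> = (\<Sum>e\<in>UNIV. if s i = e then scal (?D $ p $ r) * u (s(i := e)) else 0)"
    unfolding R_trace_conjugation_sum[OF assms] by (rule sum.cong) auto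
  finally show "app (ptr (Suc i) (cop1 (Suc i) ?D * op2 i G * cop1 i (unit_mat r p) * op2 i F)) u s = app (sc (?D $ p $ r)) u s"
    by (simp add: app_lm)
qed

lemma ptr_cop1_unit: "ptr i (cop1 i D * cop1 i (unit_mat r p)) = sc (D $ p $ r)"
proof (rule endo_eqI)
  fix u s
  have "app (ptr i (cop1 i D * cop1 i (unit_mat r p))) u s =
     (\<Sum>a\<in>UNIV. \<Sum>b\<in>UNIV. \<Sum>c\<in>UNIV. if c = a then (if c = p then (if b = r then scal (D $ a $ b) * u s else 0) else 0) else 0)"
    unfolding ptr_def app_sum app_blk app_times app_cop1 sum_distrib_left
    by (intro sum.cong HOL.refl) (auto simp: unit_mat_def)
  then show "app (ptr i (cop1 i D * cop1 i (unit_mat r p))) u s = app (sc (D $ p $ r)) u s"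
    by (simp add: app_lm sum_if_const)
qed

text \<open>By expansion of \<open>z\<close> in matrix units of the factor at position \<open>i\<close>.\<close>

lemma ptr_conjugation:
  fixes X F G :: "'n::finite mat2" and z :: "('n, 'n falg) chain"
  assumes "skew_invertible X" and "F ** G = mat 1"
    and "op2 (Suc 0) G * op2 0 X * op2 (Suc 0) F =
        (op2 0 F * op2 (Suc 0) X * op2 0 G :: ('n, 'n falg) chain)"
    and z: "triv (Suc i) z"
  shows "ptr (Suc i) (cop1 (Suc i) (Dmat X) * op2 i G * z * op2 i F) = ptr i (cop1 i (Dmat X) * z)"
proof -
  let ?D = "Dmat X"
  have tz: "triv i (blk i r p z)" "triv (Suc i) (blk i r p z)" for r p
    using z by (simp_all add: triv_blk triv_blk')
  have "cop1 (Suc i) ?D * op2 i G * z * op2 i F =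
     (\<Sum>r\<in>UNIV. \<Sum>p\<in>UNIV. cop1 (Suc i) ?D * op2 i G * (cop1 i (unit_mat r p) * blk i r p z) * op2 i F)"
    by (subst blk_decompose[of z i]) (simp add: sum_distrib_left sum_distrib_right)
  also have "\<dots> = (\<Sum>r\<in>UNIV. \<Sum>p\<in>UNIV. (cop1 (Suc i) ?D * op2 i G * cop1 i (unit_mat r p) * op2 i F) * blk i r p z)"
    by (simp add: mult.assoc triv_commute_op2[OF tz])
  finally have "ptr (Suc i) (cop1 (Suc i) ?D * op2 i G * z * op2 i F) = (\<Sum>r\<in>UNIV. \<Sum>p\<in>UNIV. sc (?D $ p $ r) * blk i r p z)"
    by (simp add: ptr_sum ptr_mult_right[OF tz(2)] ptr_conjugation_unit[OF assms(1-3)])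
  moreover have "cop1 i ?D * z = (\<Sum>r\<in>UNIV. \<Sum>p\<in>UNIV. (cop1 i ?D * cop1 i (unit_mat r p)) * blk i r p z)"
    by (subst blk_decompose[of z i]) (simp add: sum_distrib_left mult.assoc)
  then have "ptr i (cop1 i ?D * z) = (\<Sum>r\<in>UNIV. \<Sum>p\<in>UNIV. sc (?D $ p $ r) * blk i r p z)"
    by (simp add: ptr_sum ptr_mult_right[OF tz(1)] ptr_cop1_unit)
  ultimately show ?thesis by simp
qed

section \<open>Traces in the quantum matrix algebra\<close>

lemma prod_list_commute:
  fixes x :: "'a::monoid_mult"
  assumes "\<And>y. y \<in> set ys \<Longrightarrow> x * y = y * x"
  shows "x * prod_list ys = prod_list ys * x"
  using assms
proof (induction ys)
  case (Cons y ys)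
  then have "x * y = y * x" "x * prod_list ys = prod_list ys * x" by simp_all
  then show ?case by (metis mult.assoc prod_list.Cons)
qed simp

lemma conjugate_eq:
  fixes x :: "'a::monoid_mult"
  assumes "p * x = y * p" and "p * p' = 1"
  shows "y = p * x * p'"
  unfolding assms(1) mult.assoc by (simp add: assms(2))

lemma embo_Suc_ptr:
  fixes A :: "('n::finite, 'a::ring_1) oper"
  shows "ptr n (embo 0 (Suc n) A) = embo 0 n (\<lambda>xs ys. \<Sum>a\<in>UNIV. A (xs @ [a]) (ys @ [a]))"
proof (rule endo_eqI)
  fix u and s :: "nat \<Rightarrow> 'n"
  have get: "get 0 (Suc n) (s(n := a)) = get 0 n s @ [a]" for a
    by (simp add: get_def)
  have put: "put 0 (ys @ [b]) (s(n := a)) = (put 0 ys s)(n := b)" if "length ys = n" for ys a b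
    using that by (auto simp: put_def fun_eq_iff nth_append)
  have put_upd: "(put 0 ys s)(n := s n) = put 0 ys s" if "length ys = n" for ys
    using that by (auto simp: put_def fun_eq_iff)
  have "app (ptr n (embo 0 (Suc n) A)) u s =
      (\<Sum>a\<in>UNIV. \<Sum>ys | length ys = n. \<Sum>b\<in>UNIV. A (get 0 n s @ [a]) (ys @ [b]) * (if b = a then u (put 0 ys s) else 0))"
    unfolding ptr_def app_sum app_blk app_embo sum_lists_Suc
    by (intro sum.cong HOL.refl) (auto simp: get put put_upd)
  also have "\<dots> = (\<Sum>a\<in>UNIV. \<Sum>ys | length ys = n. A (get 0 n s @ [a]) (ys @ [a]) * u (put 0 ys s))"
    by (simp add: if_distrib[of "(*) _"] cong: if_cong)
  also have "\<dots> = app (embo 0 n (\<lambda>xs ys. \<Sum>a\<in>UNIV. A (xs @ [a]) (ys @ [a]))) u s"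
    by (subst sum.swap) (simp add: app_embo sum_distrib_right)
  finally show "app (ptr n (embo 0 (Suc n) A)) u s = app (embo 0 n (\<lambda>xs ys. \<Sum>a\<in>UNIV. A (xs @ [a]) (ys @ [a]))) u s" .
qed

text \<open>Traces the positions from \<open>m\<close> to \<open>m + n - 1\<close>, the last one
  first. The result is again an endomorphism, so a block can be traced inside a larger
  product.\<close>

primrec ptrs :: "nat \<Rightarrow> nat \<Rightarrow> ('n::finite, 'a::ring_1) chain \<Rightarrow> ('n, 'a) chain" where
  "ptrs m 0 x = x"
| "ptrs m (Suc n) x = ptrs m n (ptr (m + n) x)"

lemma tr_ptrs: "tr (m + n) x = tr m (ptrs m n x)"
  by (induction n arbitrary: x) (simp_all add: tr_ptr)

lemma ptrs_embo: "ptrs 0 n (embo 0 n A) = lm (op_trace n A)"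
proof (induction n arbitrary: A)
  case 0
  show ?case
    by (rule endo_eqI) (simp add: app_embo app_lm op_trace_def get_def put_def)
next
  case (Suc n)
  then show ?case
    by (simp add: embo_Suc_ptr op_trace_def sum_lists_Suc)
qed

lemma ptrs_local: "local n x \<Longrightarrow> ptrs 0 n x = lm (tr n x)"
  by (auto simp: local_def ptrs_embo tr_embo)

lemma ptrs_mult_left: "(\<And>i. m \<le> i \<Longrightarrow> i < m + n \<Longrightarrow> triv i y) \<Longrightarrow> ptrs m n (y * x) = y * ptrs m n x"
  by (induction n arbitrary: x) (simp_all add: ptr_mult_left)

lemma ptrs_mult_right: "(\<And>i. m \<le> i \<Longrightarrow> i < m + n \<Longrightarrow> triv i y) \<Longrightarrow> ptrs m n (x * y) = ptrs m n x * y"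
  by (induction n arbitrary: x) (simp_all add: ptr_mult_right)

lemma embo_diff: "embo i n (\<lambda>xs ys. A xs ys - B xs ys) = embo i n A - embo i n B"
  by (rule endo_eqI) (simp add: app_embo app_simps sum_subtractf algebra_simps)

text \<open>The entries of \<open>X\<close> are scalars. This is what lets the noncommutative value
  of a traced block pass a word in \<open>R\<close>.\<close>

lemma op2_lm_commute: "op2 i X * lm c = lm c * op2 i X"
proof (rule endo_eqI)
  fix u s
  have "scal d * (c * x) = c * (scal d * x)" for d and x :: "'b \<Rightarrow>\<^sub>0 complex"
    by (metis mult.assoc scal_central)
  then show "app (op2 i X * lm c) u s = app (lm c * op2 i X) u s"
    by (simp add: app_times app_op2 app_lm sum_distrib_left)
qed

lemma op2_far_commute: "i + 2 \<le> j \<Longrightarrow> op2 i X * op2 j Y = op2 j Y * op2 i X"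
  by (intro triv_commute_op2 triv_op2) auto

lemma matrix_inv_inverse:
  assumes "invertible A"
  shows "A ** matrix_inv A = mat 1" and "matrix_inv A ** A = mat 1"
  using someI_ex[OF assms[unfolded invertible_def]] by (simp_all add: matrix_inv_def)

section \<open>Operators attached to a compatible pair\<close>

locale qma_setup =
  fixes R F :: "'n::finite mat2"
  assumes qma_pair: "qma_pair R F"
begin

abbreviation r :: "nat \<Rightarrow> ('n, 'n falg) chain" where "r i \<equiv> op2 i R"
abbreviation r' :: "nat \<Rightarrow> ('n, 'n falg) chain" where "r' i \<equiv> op2 i (matrix_inv R)"
abbreviation f :: "nat \<Rightarrow> ('n, 'n falg) chain" where "f i \<equiv> op2 i F"
abbreviation f' :: "nat \<Rightarrow> ('n, 'n falg) chain" where "f' i \<equiv> op2 i (matrix_inv F)"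
abbreviation d :: "nat \<Rightarrow> ('n, 'n falg) chain" where "d i \<equiv> cop1 i (Dmat R)"

lemma R_inv: "R ** matrix_inv R = mat 1" "matrix_inv R ** R = mat 1"
  and F_inv: "F ** matrix_inv F = mat 1" "matrix_inv F ** F = mat 1"
  using qma_pair by (auto simp: qma_pair_def R_matrix_def matrix_inv_inverse)

lemma r_r' [simp]: "r i * r' i = 1" "r' i * r i = 1"
  and f_f' [simp]: "f i * f' i = 1" "f' i * f i = 1"
  by (simp_all add: op2_mult R_inv F_inv op2_mat)

lemma cancel_left [simp]: "r i * (r' i * x) = x" "r' i * (r i * x) = x" "f i * (f' i * x) = x" "f' i * (f i * x) = x"
  by (simp_all flip: mult.assoc)

lemma skew: "skew_invertible R"
  using qma_pair by (simp add: qma_pair_def strict_skew_invertible_def)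

lemma braid_r: "r i * r (Suc i) * r i = r (Suc i) * r i * r (Suc i)"
  and braid_f: "f i * f (Suc i) * f i = f (Suc i) * f i * f (Suc i)"
  using qma_pair by (auto simp: qma_pair_def R_matrix_def intro!: op2_3_relation)

lemma compat1: "r i * f (Suc i) * f i = f (Suc i) * f i * r (Suc i)"
  and compat2: "r (Suc i) * f i * f (Suc i) = f i * f (Suc i) * r i"
proof -
  have *: "op_prod 3 [adj 3 1 R, adj 3 2 F, adj 3 1 F] = op_prod 3 [adj 3 2 F, adj 3 1 F, adj 3 2 R]"
    "op_prod 3 [adj 3 2 R, adj 3 1 F, adj 3 2 F] = op_prod 3 [adj 3 1 F, adj 3 2 F, adj 3 1 R]"
    using qma_pair by (auto simp: qma_pair_def compatible_pair_def)
  show "r i * f (Suc i) * f i = f (Suc i) * f i * r (Suc i)"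
    using op2_3_relation[OF *(1)] .
  show "r (Suc i) * f i * f (Suc i) = f i * f (Suc i) * r i"
    using op2_3_relation[OF *(2)[symmetric]] by (rule HOL.sym)
qed

lemma move_left:
  fixes a b x y :: "('n, 'n falg) chain"
  assumes "x * f i * f j = f i * f j * y"
  shows "f' i * x * f i = f j * y * f' j"
proof -
  have "f' i * x * f i = f' i * (x * f i * f j) * f' j" by (simp add: mult.assoc)
  also have "\<dots> = f j * y * f' j" unfolding assms by (simp add: mult.assoc)
  finally show ?thesis .
qed

lemma d_commute_r: "d i * d (Suc i) * r i = r i * (d i * d (Suc i))"
proof -
  have b: "r' (Suc 0) * r 0 * r (Suc 0) = r 0 * r (Suc 0) * r' 0"
    "r (Suc 0) * r 0 * r' (Suc 0) = r' 0 * r (Suc 0) * r 0"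
  proof -
    have "r' (Suc 0) * r 0 * r (Suc 0) = r' (Suc 0) * (r 0 * r (Suc 0) * r 0) * r' 0"
      by (simp add: mult.assoc)
    also have "\<dots> = r 0 * r (Suc 0) * r' 0"
      unfolding braid_r by (simp add: mult.assoc)
    finally show "r' (Suc 0) * r 0 * r (Suc 0) = r 0 * r (Suc 0) * r' 0" .
    have "r (Suc 0) * r 0 * r' (Suc 0) = r' 0 * (r 0 * r (Suc 0) * r 0) * r' (Suc 0)"
      by (simp add: mult.assoc)
    also have "\<dots> = r' 0 * r (Suc 0) * r 0"
      unfolding braid_r by (simp add: mult.assoc)
    finally show "r (Suc 0) * r 0 * r' (Suc 0) = r' 0 * r (Suc 0) * r 0" .
  qed
  have "DD R ** matrix_inv R = matrix_inv R ** DD R"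
    by (rule DD_commute_inverse[OF skew R_inv(1) b])
  then have "op2 i (DD R) * r' i = r' i * op2 i (DD R)"
    by (simp add: op2_mult)
  then have "r i * (op2 i (DD R) * r' i) * r i = r i * (r' i * op2 i (DD R)) * r i"
    by simp
  then show ?thesis
    by (simp add: mult.assoc op2_DD)
qed

lemma ptr_conj_f:
  assumes "triv (Suc i) z"
  shows "ptr (Suc i) (d (Suc i) * f i * z * f' i) = ptr i (d i * z)"
proof (rule ptr_conjugation[OF skew F_inv(2) _ assms])
  show "f (Suc 0) * r 0 * f' (Suc 0) = f' 0 * r (Suc 0) * f 0"
    using move_left[OF compat2[of 0]] by simp
qed

text \<open>The copy of \<open>M\<close> with overlined index \<open>i + 1\<close>, now independent
  of the number of strands.\<close>

primrec M_bar :: "nat \<Rightarrow> ('n, 'n falg) chain" where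
  "M_bar 0 = op1 0 M_free"
| "M_bar (Suc i) = f i * M_bar i * f' i"

lemma triv_M_bar: "i < j \<Longrightarrow> triv j (M_bar i)"
  by (induction i) (auto intro!: triv_mult triv_op1 triv_op2)

lemma local_M_bar: "i < n \<Longrightarrow> local n (M_bar i)"
  by (induction i) (auto intro!: local_mult local_op1 local_op2)

lemma embo_Mbar: "i < n \<Longrightarrow> embo 0 n (Mbar F n (Suc i)) = M_bar i"
proof (induction i)
  case 0
  then show ?case using embo_op1[of 0 n 0 M_free] by simp
next
  case (Suc i)
  then show ?case
    using embo_op2[of i n 0 F] embo_op2[of i n 0 "matrix_inv F"]
    by (simp add: embo_prod mult.assoc del: Mbar.simps add: Mbar.simps(2)[of F n "Suc i"])
qed

lemma M_bar_commute_above: "i < j \<Longrightarrow> M_bar i * op2 j X = op2 j X * M_bar i"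
  by (rule triv_commute_op2) (auto intro: triv_M_bar)

text \<open>Passing \<open>f (Suc j) * f j\<close> moves \<open>op2 j X\<close> to position
  \<open>Suc j\<close>, beyond the reach of \<open>M_bar j\<close>. The operator \<open>X\<close> is
  left open because both \<open>R\<close> (by compatibility) and \<open>F\<close> (by the braid
  relation) are needed.\<close>

lemma M_bar_commute_below:
  assumes X: "\<And>i. op2 i X * f (Suc i) * f i = f (Suc i) * f i * op2 (Suc i) X"
    and "j + 2 \<le> i"
  shows "op2 j X * M_bar i = M_bar i * op2 j X"
  using assms(2)
proof (induction i rule: dec_induct)
  case base
  have inv: "op2 (Suc j) X * (f' j * f' (Suc j)) = f' j * f' (Suc j) * op2 j X"
  proof -
    have "op2 (Suc j) X * (f' j * f' (Suc j)) =
        f' j * f' (Suc j) * (f (Suc j) * f j * op2 (Suc j) X) * (f' j * f' (Suc j))"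
      by (simp add: mult.assoc)
    also have "\<dots> = f' j * f' (Suc j) * op2 j X"
      unfolding X[symmetric] by (simp add: mult.assoc)
    finally show ?thesis .
  qed
  have MM2: "M_bar (Suc (Suc j)) = f (Suc j) * f j * M_bar j * (f' j * f' (Suc j))"
    by (simp add: mult.assoc)
  have "op2 j X * M_bar (Suc (Suc j)) = (op2 j X * f (Suc j) * f j) * M_bar j * (f' j * f' (Suc j))"
    unfolding MM2 by (simp only: mult.assoc)
  also have "\<dots> = f (Suc j) * f j * (op2 (Suc j) X * M_bar j) * (f' j * f' (Suc j))"
    unfolding X by (simp only: mult.assoc)
  also have "\<dots> = f (Suc j) * f j * M_bar j * (op2 (Suc j) X * (f' j * f' (Suc j)))"
    unfolding M_bar_commute_above[of j "Suc j", symmetric, simplified] by (simp only: mult.assoc)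
  also have "\<dots> = M_bar (Suc (Suc j)) * op2 j X"
    unfolding inv MM2 by (simp only: mult.assoc)
  finally show ?case by simp
next
  case (step i)
  have c: "op2 j X * f i = f i * op2 j X" "op2 j X * f' i = f' i * op2 j X"
    using step.hyps by (auto intro!: op2_far_commute)
  have "op2 j X * M_bar (Suc i) = f i * (op2 j X * M_bar i) * f' i"
    by (simp add: c(1) flip: mult.assoc)
  also have "\<dots> = M_bar (Suc i) * op2 j X"
    unfolding step.IH by (simp add: c(2) mult.assoc)
  finally show ?case .
qed

section \<open>Shifting by conjugation with \<open>F\<close>\<close>

definition Phi :: "nat \<Rightarrow> nat \<Rightarrow> ('n, 'n falg) chain" where
  "Phi m n = prod_list (map f [m..<m + n])"

definition Phi' :: "nat \<Rightarrow> nat \<Rightarrow> ('n, 'n falg) chain" where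
  "Phi' m n = prod_list (rev (map f' [m..<m + n]))"

lemma Phi_Suc: "Phi m (Suc n) = Phi m n * f (m + n)" and Phi'_Suc: "Phi' m (Suc n) = f' (m + n) * Phi' m n"
  and Phi_0: "Phi m 0 = 1" and Phi'_0: "Phi' m 0 = 1"
  by (simp_all add: Phi_def Phi'_def)

lemma Phi_Phi': "Phi m n * Phi' m n = 1"
proof (induction n)
  case (Suc n)
  have "Phi m (Suc n) * Phi' m (Suc n) = Phi m n * (f (m + n) * (f' (m + n) * Phi' m n))"
    by (simp only: Phi_Suc Phi'_Suc mult.assoc)
  then show ?case by (simp only: cancel_left Suc)
qed (simp add: Phi_0 Phi'_0)

lemma triv_Phi: "m + n < j \<Longrightarrow> triv j (Phi m n)" and triv_Phi': "m + n < j \<Longrightarrow> triv j (Phi' m n)"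
  unfolding Phi_def Phi'_def by (auto intro!: triv_prod_list triv_op2)

text \<open>The factor \<open>f i\<close> raises \<open>M_bar i\<close> by definition; the factors
  to its right do not touch \<open>M_bar i\<close>, and those to its left commute with
  \<open>M_bar (Suc i)\<close>.\<close>

lemma Phi_M_bar: "m \<le> i \<Longrightarrow> i < m + n \<Longrightarrow> Phi m n * M_bar i = M_bar (Suc i) * Phi m n"
proof (induction n)
  case (Suc n)
  show ?case
  proof (cases "i = m + n")
    case True
    have "Phi m n * M_bar (Suc i) = M_bar (Suc i) * Phi m n"
      unfolding Phi_def
      by (rule prod_list_commute[symmetric], rule HOL.sym)
        (auto simp: True intro!: M_bar_commute_below braid_f simp del: M_bar.simps)
    then have "M_bar (Suc i) * Phi m n * f i = Phi m n * M_bar (Suc i) * f i" by simp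
    then show ?thesis
      by (simp add: Phi_Suc flip: True) (simp add: mult.assoc)
  next
    case False
    then have i: "i < m + n" using Suc.prems by simp
    show ?thesis
      by (simp only: Phi_Suc mult.assoc M_bar_commute_above[OF i, symmetric])
        (simp only: mult.assoc[symmetric] Suc.IH[OF Suc.prems(1) i])
  qed
qed simp

text \<open>The neighbouring factors \<open>f i * f (Suc i)\<close> shift the operator; all other
  factors of \<open>Phi\<close> are far from it before or after the shift.\<close>

lemma Phi_op2:
  assumes X: "\<And>i. op2 (Suc i) X * f i * f (Suc i) = f i * f (Suc i) * op2 i X"
  shows "m \<le> i \<Longrightarrow> Suc i < m + n \<Longrightarrow> Phi m n * op2 i X = op2 (Suc i) X * Phi m n"
proof (induction n)
  case (Suc n)
  show ?case
  proof (cases "Suc i = m + n")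
    case True
    then obtain k where k: "n = Suc k" "i = m + k" 
      using Suc.prems by (cases n) auto
    have c: "Phi m k * op2 (Suc i) X = op2 (Suc i) X * Phi m k"
      unfolding Phi_def
      by (rule prod_list_commute[symmetric], rule HOL.sym) (auto simp: k intro!: op2_far_commute)
    have P: "Phi m (Suc n) = Phi m k * (f i * f (Suc i))"
      by (simp add: Phi_Suc k mult.assoc)
    have "Phi m (Suc n) * op2 i X = Phi m k * (f i * f (Suc i) * op2 i X)"
      unfolding P by (simp only: mult.assoc)
    also have "\<dots> = (Phi m k * op2 (Suc i) X) * (f i * f (Suc i))"
      unfolding X[symmetric] by (simp only: mult.assoc)
    finally show ?thesis
      unfolding c P by (simp only: mult.assoc)
  next
    case False
    then have i: "i + 2 \<le> m + n" using Suc.prems by simp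
    have c: "op2 i X * f (m + n) = f (m + n) * op2 i X"
      using i by (rule op2_far_commute)
    have "Phi m (Suc n) * op2 i X = Phi m n * op2 i X * f (m + n)"
      by (simp add: Phi_Suc mult.assoc c)
    also have "\<dots> = op2 (Suc i) X * Phi m (Suc n)"
      using Suc.IH i Suc.prems by (simp add: Phi_Suc mult.assoc)
    finally show ?thesis .
  qed
qed simp

lemma Phi_prod_list:
  assumes "\<And>x. x \<in> set xs \<Longrightarrow> Phi m n * g x = h x * Phi m n"
  shows "Phi m n * prod_list (map g xs) = prod_list (map h xs) * Phi m n"
  using assms
proof (induction xs)
  case (Cons x xs)
  have "Phi m n * (g x * prod_list (map g xs)) = h x * (Phi m n * prod_list (map g xs))"
    using Cons.prems[of x] by (simp flip: mult.assoc)
  then show ?case using Cons by (simp add: mult.assoc)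
qed simp

definition D_prod :: "nat \<Rightarrow> nat \<Rightarrow> ('n, 'n falg) chain" where
  "D_prod m n = prod_list (map d [m..<m + n])"

definition M_prod :: "nat \<Rightarrow> nat \<Rightarrow> ('n, 'n falg) chain" where
  "M_prod m n = prod_list (map M_bar [m..<m + n])"

fun letter :: "nat \<times> bool \<Rightarrow> ('n, 'n falg) chain" where
  "letter (j, e) = op2 j (if e then R else matrix_inv R)"

definition rw :: "braid_word \<Rightarrow> ('n, 'n falg) chain" where
  "rw w = prod_list (map letter w)"

text \<open>\<open>T n (\<rho> \<alpha>)\<close> is a representative of \<open>ch \<alpha>\<close> in the free algebra.\<close>

definition T :: "nat \<Rightarrow> ('n, 'n falg) chain \<Rightarrow> 'n falg" where
  "T n x = tr n (D_prod 0 n * M_prod 0 n * x)"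

lemma D_prod_Suc: "D_prod m (Suc n) = D_prod m n * d (m + n)" and D_prod_0: "D_prod m 0 = 1"
  by (simp_all add: D_prod_def)

lemma M_prod_add: "M_prod m (k + n) = M_prod m k * M_prod (m + k) n"
  and D_prod_add: "D_prod m (k + n) = D_prod m k * D_prod (m + k) n"
  by (simp_all add: M_prod_def D_prod_def upt_add_eq_append[of m "m + k" n] flip: add.assoc prod_list.append map_append)

lemma triv_D_prod: "j < m \<or> m + n \<le> j \<Longrightarrow> triv j (D_prod m n)"
  unfolding D_prod_def by (auto intro!: triv_prod_list triv_op1)

lemma triv_M_prod: "m + n \<le> j \<Longrightarrow> triv j (M_prod m n)"
  unfolding M_prod_def by (auto intro!: triv_prod_list triv_M_bar)

lemma rw_Nil [simp]: "rw [] = 1" and rw_Cons: "rw (x # w) = letter x * rw w"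
  and rw_append: "rw (u @ v) = rw u * rw v"
  by (simp_all add: rw_def)

lemma braid_wordsD: "(j, e) \<in> set w \<Longrightarrow> w \<in> braid_words n \<Longrightarrow> Suc j < n"
  by (auto simp: braid_words_def)

lemma triv_rw: "w \<in> braid_words n \<Longrightarrow> n \<le> j \<Longrightarrow> triv j (rw w)"
  unfolding rw_def by (force intro!: triv_prod_list triv_op2 dest: braid_wordsD)

lemma local_prod_list: "(\<And>x. x \<in> set xs \<Longrightarrow> local n x) \<Longrightarrow> local n (prod_list xs)"
  by (induction xs) (simp_all add: local_1 local_mult)

lemma local_rw: "w \<in> braid_words n \<Longrightarrow> local n (rw w)"
  unfolding rw_def by (force intro!: local_prod_list local_op2 dest: braid_wordsD)

lemma local_D_prod: "local n (D_prod 0 n)" and local_M_prod: "local n (M_prod 0 n)"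
  unfolding D_prod_def M_prod_def by (auto intro!: local_prod_list local_op1 local_M_bar)

text \<open>Invariance of the R-trace under conjugation by \<open>F\<close>, one factor at a time:
  \<open>ptr_conj_f\<close> absorbs the last factor, and the trace at position \<open>m + n\<close>
  leaves an operator trivial there, so that the induction continues.\<close>

lemma ptrs_shift:
  assumes "\<And>j. m + n \<le> j \<Longrightarrow> triv j z"
  shows "ptrs (Suc m) n (D_prod (Suc m) n * Phi m n * z * Phi' m n) = ptrs m n (D_prod m n * z)"
  using assms
proof (induction n arbitrary: z)
  case (Suc n)
  let ?i = "m + n"
  let ?z = "ptr ?i (d ?i * z)"
  have t: "triv (Suc ?i) z" using Suc.prems by simp
  have t': "triv (Suc ?i) (D_prod (Suc m) n * Phi m n)" "triv (Suc ?i) (Phi' m n)"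
    by (auto intro!: triv_mult triv_D_prod triv_Phi triv_Phi')
  have "d (Suc ?i) * Phi m n = Phi m n * d (Suc ?i)"
    by (rule triv_commute_cop1[symmetric]) (simp add: triv_Phi)
  then have "D_prod (Suc m) (Suc n) * Phi m (Suc n) * z * Phi' m (Suc n) =
      (D_prod (Suc m) n * Phi m n) * (d (Suc ?i) * f ?i * z * f' ?i) * Phi' m n"
    by (simp add: D_prod_Suc Phi_Suc Phi'_Suc mult.assoc) (simp flip: mult.assoc)
  then have "ptrs (Suc m) (Suc n) (D_prod (Suc m) (Suc n) * Phi m (Suc n) * z * Phi' m (Suc n)) =
      ptrs (Suc m) n (D_prod (Suc m) n * Phi m n * ?z * Phi' m n)"
    by (simp add: ptr_mult_left[OF t'(1)] ptr_mult_right[OF t'(2)] ptr_conj_f[OF t])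
  also have "\<dots> = ptrs m n (D_prod m n * ?z)"
  proof (rule Suc.IH)
    fix j assume "m + n \<le> j"
    then show "triv j ?z"
      by (cases "j = m + n") (auto intro!: triv_ptr triv_ptr' triv_mult triv_op1 Suc.prems)
  qed
  also have "\<dots> = ptrs m n (ptr ?i (D_prod m n * (d ?i * z)))"
    by (simp add: ptr_mult_left triv_D_prod)
  finally show ?case by (simp add: D_prod_Suc mult.assoc)
qed (simp add: Phi_0 Phi'_0 D_prod_0)

lemma compat2': "r' (Suc i) * f i * f (Suc i) = f i * f (Suc i) * r' i"
proof -
  have "r' (Suc i) * f i * f (Suc i) = r' (Suc i) * (f i * f (Suc i) * r i) * r' i"
    by (simp add: mult.assoc)
  then show ?thesis
    unfolding compat2[symmetric] by (simp add: mult.assoc)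
qed

lemma shift_word_0: "shift_word 0 w = w"
  by (simp add: shift_word_def case_prod_beta)

lemma Phi_rw:
  assumes "w \<in> braid_words n"
  shows "Phi m n * rw (shift_word m w) = rw (shift_word (Suc m) w) * Phi m n"
  unfolding rw_def shift_word_def map_map
  by (rule Phi_prod_list)
    (use assms in \<open>force intro!: Phi_op2 compat2 compat2' dest: braid_wordsD\<close>)

lemma triv_rw_shift: "w \<in> braid_words n \<Longrightarrow> m + n \<le> j \<Longrightarrow> triv j (rw (shift_word m w))"
  unfolding rw_def shift_word_def by (force intro!: triv_prod_list triv_op2 dest: braid_wordsD)

text \<open>The R-trace of a shifted block does not depend on the shift and is a mere left
  multiplication, which is the reason why characters multiply.\<close>

lemma ptrs_word:
  assumes w: "w \<in> braid_words n"
  shows "ptrs m n (D_prod m n * M_prod m n * rw (shift_word m w)) = lm (T n (rw w))"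
proof (induction m)
  case 0
  show ?case
    unfolding T_def shift_word_0
    by (intro ptrs_local local_mult local_D_prod local_M_prod local_rw w)
next
  case (Suc m)
  have "Phi m n * M_prod m n = M_prod (Suc m) n * Phi m n"
  proof -
    have "M_prod (Suc m) n = prod_list (map (\<lambda>i. M_bar (Suc i)) [m..<m + n])"
      unfolding M_prod_def by (rule arg_cong[where f = prod_list]) (simp add: map_Suc_upt[symmetric] o_def del: M_bar.simps upt_Suc)
    then show ?thesis
      unfolding M_prod_def[of m] by (metis (no_types, lifting) Phi_prod_list Phi_M_bar atLeastLessThan_iff set_upt)
  qed
  then have "Phi m n * (M_prod m n * rw (shift_word m w)) = M_prod (Suc m) n * rw (shift_word (Suc m) w) * Phi m n"
    using Phi_rw[OF w, of m] by (simp only: mult.assoc[symmetric]) (simp only: mult.assoc)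
  then have "M_prod (Suc m) n * rw (shift_word (Suc m) w) = Phi m n * (M_prod m n * rw (shift_word m w)) * Phi' m n"
    by (simp add: mult.assoc Phi_Phi')
  then have "D_prod (Suc m) n * M_prod (Suc m) n * rw (shift_word (Suc m) w) =
     D_prod (Suc m) n * Phi m n * (M_prod m n * rw (shift_word m w)) * Phi' m n"
    by (simp add: mult.assoc)
  then show ?case
    using ptrs_shift[of m n "M_prod m n * rw (shift_word m w)"] Suc
    by (simp add: triv_mult triv_M_prod triv_rw_shift[OF w] mult.assoc)
qed

lemma rw_lm_commute: "rw w * lm c = lm c * rw w"
  unfolding rw_def by (rule prod_list_commute[symmetric]) (auto simp: op2_lm_commute)

theorem T_mult:
  assumes u: "u \<in> braid_words m" and v: "v \<in> braid_words n"
  shows "T (m + n) (rw u * rw (shift_word m v)) = T m (rw u) * T n (rw v)"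
proof -
  let ?x = "rw u" and ?y = "rw (shift_word m v)"
  have xy: "?x * ?y = ?y * ?x"
    unfolding rw_def[of "shift_word m v"]
  proof (rule prod_list_commute)
    fix y assume "y \<in> set (map letter (shift_word m v))"
    then obtain j e where "y = op2 (j + m) (if e then R else matrix_inv R)"
      by (auto simp: shift_word_def)
    then show "?x * y = y * ?x"
      by (auto intro!: triv_commute_op2 triv_rw[OF u])
  qed
  \<comment> \<open>The first \<open>m\<close> copies of \<open>M\<close> do not reach the positions
    of the second block.\<close>
  have DM: "D_prod m n * M_prod 0 m = M_prod 0 m * D_prod m n"
    unfolding D_prod_def
    by (rule prod_list_commute[symmetric]) (auto intro!: triv_commute_cop1[symmetric] triv_commute_cop1 triv_M_prod)
  have "D_prod 0 (m + n) * M_prod 0 (m + n) * (?x * ?y) = D_prod 0 m * (D_prod m n * M_prod 0 m) * M_prod m n * (?y * ?x)"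
    by (simp add: D_prod_add M_prod_add mult.assoc xy)
  also have "\<dots> = (D_prod 0 m * M_prod 0 m) * (D_prod m n * M_prod m n * ?y) * ?x"
    unfolding DM by (simp only: mult.assoc)
  finally have eq: "D_prod 0 (m + n) * M_prod 0 (m + n) * (?x * ?y) = (D_prod 0 m * M_prod 0 m) * (D_prod m n * M_prod m n * ?y) * ?x" .
  have "triv i (D_prod 0 m * M_prod 0 m)" "triv i ?x" if "m \<le> i" for i
    using that by (auto intro!: triv_mult triv_D_prod triv_M_prod triv_rw[OF u])
  then have "ptrs m n (D_prod 0 (m + n) * M_prod 0 (m + n) * (?x * ?y)) = (D_prod 0 m * M_prod 0 m) * lm (T n (rw v)) * ?x"
    unfolding eq by (simp add: ptrs_mult_left ptrs_mult_right ptrs_word[OF v])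
  \<comment> \<open>The value of the second block must stand on the right of that of the first one.
    It gets there because it commutes with \<open>?x\<close>, whose entries are scalars.\<close>
  then have "T (m + n) (?x * ?y) = tr m (D_prod 0 m * M_prod 0 m * ?x * lm (T n (rw v)))"
    by (simp add: T_def tr_ptrs mult.assoc rw_lm_commute)
  then show ?thesis
    by (simp add: tr_lm_right T_def)
qed

subsection \<open>Cyclicity modulo the defining relations\<close>

lemma ideal_add: "a \<in> qma_ideal R F \<Longrightarrow> b \<in> qma_ideal R F \<Longrightarrow> a + b \<in> qma_ideal R F"
  and ideal_0: "0 \<in> qma_ideal R F"
  and ideal_mult_left: "a \<in> qma_ideal R F \<Longrightarrow> c * a \<in> qma_ideal R F"
  and ideal_mult_right: "a \<in> qma_ideal R F \<Longrightarrow> a * c \<in> qma_ideal R F"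
proof -
  interpret I: ideal "qma_ideal R F" class_ring by (rule ideal_qma_ideal)
  show "a \<in> qma_ideal R F \<Longrightarrow> b \<in> qma_ideal R F \<Longrightarrow> a + b \<in> qma_ideal R F"
    using additive_subgroup.a_closed[OF ideal.axioms(1)[OF ideal_qma_ideal], of a R F b] by (simp add: class_ring_def)
  show "0 \<in> qma_ideal R F"
    using additive_subgroup.zero_closed[OF ideal.axioms(1)[OF ideal_qma_ideal], of R F]
    by (simp add: class_ring_def)
  show "a \<in> qma_ideal R F \<Longrightarrow> c * a \<in> qma_ideal R F" "a \<in> qma_ideal R F \<Longrightarrow> a * c \<in> qma_ideal R F"
    using I.I_l_closed[of a c] I.I_r_closed[of a c] by (simp_all add: class_ring_def)
qed

lemma ideal_uminus: "a \<in> qma_ideal R F \<Longrightarrow> - a \<in> qma_ideal R F"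
  using ideal_mult_left[of a "- 1"] by simp

lemma ideal_sum: "(\<And>x. x \<in> A \<Longrightarrow> g x \<in> qma_ideal R F) \<Longrightarrow> sum g A \<in> qma_ideal R F"
  by (induction A rule: infinite_finite_induct) (simp_all add: ideal_0 ideal_add)

text \<open>Such an operator represents zero modulo the defining relations. Anything may be
  multiplied to it on the right, but on the left only operators that map ideal valued vectors to
  such vectors.\<close>

definition ideal_valued :: "('n, 'n falg) chain \<Rightarrow> bool" where
  "ideal_valued x \<longleftrightarrow> (\<forall>u s. app x u s \<in> qma_ideal R F)"

definition ideal_preserving :: "('n, 'n falg) chain \<Rightarrow> bool" where
  "ideal_preserving y \<longleftrightarrow> (\<forall>u. (\<forall>s. u s \<in> qma_ideal R F) \<longrightarrow> (\<forall>s. app y u s \<in> qma_ideal R F))"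

lemma ideal_valued_mult_right: "ideal_valued x \<Longrightarrow> ideal_valued (x * y)"
  and ideal_valued_mult_left: "ideal_preserving y \<Longrightarrow> ideal_valued x \<Longrightarrow> ideal_valued (y * x)"
  by (simp_all add: ideal_valued_def ideal_preserving_def app_times)

lemma ideal_preserving_op1: "ideal_preserving (op1 i Y)" and ideal_preserving_op2: "ideal_preserving (op2 i X)"
  by (auto simp: ideal_preserving_def app_op1 app_op2 intro!: ideal_sum ideal_mult_left)

lemma ideal_preserving_mult: "ideal_preserving x \<Longrightarrow> ideal_preserving y \<Longrightarrow> ideal_preserving (x * y)" and ideal_preserving_1: "ideal_preserving 1"
  by (simp_all add: ideal_preserving_def app_times app_one)

lemma ideal_preserving_prod_list: "(\<And>x. x \<in> set xs \<Longrightarrow> ideal_preserving x) \<Longrightarrow> ideal_preserving (prod_list xs)"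
  by (induction xs) (simp_all add: ideal_preserving_1 ideal_preserving_mult)

lemma ideal_preserving_M_bar: "ideal_preserving (M_bar i)"
  by (induction i) (simp_all add: ideal_preserving_op1 ideal_preserving_op2 ideal_preserving_mult)

lemma tr_ideal_valued: "ideal_valued x \<Longrightarrow> tr n x \<in> qma_ideal R F"
  by (auto simp: ideal_valued_def tr_def intro!: ideal_sum)

text \<open>The defining relations are the case \<open>i = 0\<close>; conjugation by
  \<open>Phi i 2\<close> carries the relation at \<open>i\<close> to the one at
  \<open>Suc i\<close>.\<close>

lemma qma_relation_ideal_valued: "ideal_valued (r i * (M_bar i * M_bar (Suc i)) - M_bar i * M_bar (Suc i) * r i)"
proof (induction i)
  case 0
  have "op_prod 2 [op_scal (adj 2 1 R), Mbar F 2 1, Mbar F 2 2] xs ys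
     - op_prod 2 [Mbar F 2 1, Mbar F 2 2, op_scal (adj 2 1 R)] xs ys = qma_relation R F xs ys" for xs ys
    by (simp only: qma_relation_def)
  moreover have "r 0 * (M_bar 0 * M_bar (Suc 0)) - M_bar 0 * M_bar (Suc 0) * r 0 =
     embo 0 2 (op_prod 2 [op_scal (adj 2 1 R), Mbar F 2 1, Mbar F 2 2]) -
     embo 0 2 (op_prod 2 [Mbar F 2 1, Mbar F 2 2, op_scal (adj 2 1 R)])"
  proof -
    have "embo 0 2 (op_scal (adj 2 1 R)) = r 0" "embo 0 2 (Mbar F 2 1) = M_bar 0" "embo 0 2 (Mbar F 2 2) = M_bar (Suc 0)"
      using embo_op2[of 0 2 0 R] embo_Mbar[of 0 2] embo_Mbar[of 1 2]
      by (simp_all del: M_bar.simps Mbar.simps add: numeral_2_eq_2)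
    then show ?thesis
      by (simp only: embo_prod list.map prod_list.Cons prod_list.Nil mult_1_right mult.assoc)
  qed
  ultimately have *: "r 0 * (M_bar 0 * M_bar (Suc 0)) - M_bar 0 * M_bar (Suc 0) * r 0 = embo 0 2 (qma_relation R F)"
    unfolding embo_diff[symmetric] by simp
  have "qma_relation R F (get 0 2 s) ys \<in> qma_ideal R F" if "length ys = 2" for s ys
  proof -
    have "qma_relation R F (get 0 2 s) ys \<in> {qma_relation R F xs ys | xs ys. length xs = 2 \<and> length ys = 2}"
      using that length_get by blast
    then show ?thesis
      unfolding qma_ideal_def
      using ring.genideal_self[OF ring_class_ring, of "{qma_relation R F xs ys | xs ys. length xs = 2 \<and> length ys = 2}"]
      by (auto simp: class_ring_def)
  qed
  then show ?case
    unfolding * ideal_valued_def app_embo by (auto intro!: ideal_sum ideal_mult_right)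
next
  case (Suc i)
  let ?P = "Phi i 2" and ?P' = "Phi' i 2"
  let ?N = "\<lambda>i. r i * (M_bar i * M_bar (Suc i)) - M_bar i * M_bar (Suc i) * r i"
  have p: "?P * r i = r (Suc i) * ?P" "?P * M_bar i = M_bar (Suc i) * ?P" "?P * M_bar (Suc i) = M_bar (Suc (Suc i)) * ?P"
    by (auto intro!: Phi_op2 compat2 Phi_M_bar simp del: M_bar.simps)
  have "?P * (r i * (M_bar i * M_bar (Suc i))) = r (Suc i) * (M_bar (Suc i) * M_bar (Suc (Suc i))) * ?P"
    by (simp only: mult.assoc[symmetric] p) (simp only: mult.assoc p)
  moreover have "?P * (M_bar i * M_bar (Suc i) * r i) = M_bar (Suc i) * M_bar (Suc (Suc i)) * r (Suc i) * ?P"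
    by (simp only: mult.assoc[symmetric] p) (simp only: mult.assoc p)
  ultimately have "?P * ?N i = ?N (Suc i) * ?P"
    by (simp only: right_diff_distrib left_diff_distrib)
  then have "?N (Suc i) = ?P * ?N i * ?P'"
    using Phi_Phi' by (rule conjugate_eq)
  moreover have "ideal_preserving ?P"
    unfolding Phi_def by (rule ideal_preserving_prod_list) (auto simp: ideal_preserving_op2)
  ultimately show ?case
    using Suc by (metis ideal_valued_mult_left ideal_valued_mult_right)
qed

text \<open>The copies of \<open>M\<close> below position \<open>i\<close> are trivial where
  \<open>r i\<close> acts, those above \<open>Suc i\<close> commute with it by compatibility, and
  the middle pair is the defining relation.\<close>

lemma M_prod_r: "Suc i < n \<Longrightarrow> ideal_valued (r i * M_prod 0 n - M_prod 0 n * r i)"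
proof -
  assume "Suc i < n"
  then obtain k where n: "n = i + Suc (Suc k)"
    by (metis add_Suc_right less_iff_Suc_add add.commute)
  have b: "r i * M_prod 0 i = M_prod 0 i * r i"
    unfolding M_prod_def
    by (rule prod_list_commute) (auto simp: M_bar_commute_above)
  have a: "r i * M_prod (Suc (Suc i)) k = M_prod (Suc (Suc i)) k * r i"
    unfolding M_prod_def
    by (rule prod_list_commute) (auto intro!: M_bar_commute_below compat1)
  have Mp2: "M_prod i (Suc (Suc k)) = M_bar i * M_bar (Suc i) * M_prod (Suc (Suc i)) k"
    by (simp add: M_prod_def upt_conv_Cons mult.assoc del: upt_Suc M_bar.simps)
  let ?A = "M_prod 0 i" and ?B = "M_bar i * M_bar (Suc i)" and ?C = "M_prod (Suc (Suc i)) k"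
  have "r i * M_prod 0 n = (r i * ?A) * ?B * ?C"
    by (simp only: n M_prod_add[of 0] Mp2 add_0 mult.assoc)
  also have "\<dots> = ?A * (r i * ?B) * ?C"
    unfolding b by (simp only: mult.assoc)
  finally have 1: "r i * M_prod 0 n = ?A * (r i * ?B) * ?C" .
  have "M_prod 0 n * r i = ?A * ?B * (?C * r i)"
    by (simp only: n M_prod_add[of 0] Mp2 add_0 mult.assoc)
  also have "\<dots> = ?A * (?B * r i) * ?C"
    unfolding a[symmetric] by (simp only: mult.assoc)
  finally have "r i * M_prod 0 n - M_prod 0 n * r i = ?A * (r i * ?B - ?B * r i) * ?C"
    using 1 by (simp only: left_diff_distrib right_diff_distrib)
  moreover have "ideal_preserving ?A"
    unfolding M_prod_def by (rule ideal_preserving_prod_list) (auto simp: ideal_preserving_M_bar simp del: M_bar.simps)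
  ultimately show ?thesis
    using ideal_valued_mult_right[OF ideal_valued_mult_left[OF _ qma_relation_ideal_valued]] by metis
qed

lemma D_prod_r: "Suc i < n \<Longrightarrow> r i * D_prod 0 n = D_prod 0 n * r i"
proof -
  assume "Suc i < n"
  then obtain k where n: "n = i + Suc (Suc k)"
    by (metis add_Suc_right less_iff_Suc_add add.commute)
  have "D_prod i (Suc (Suc k)) = (d i * d (Suc i)) * D_prod (Suc (Suc i)) k"
    by (simp add: D_prod_def upt_conv_Cons mult.assoc del: upt_Suc)
  then have D: "D_prod 0 n = D_prod 0 i * (d i * d (Suc i)) * D_prod (Suc (Suc i)) k"
    by (simp only: n D_prod_add[of 0] add_0 mult.assoc)
  have c: "D_prod 0 i * r i = r i * D_prod 0 i" "D_prod (Suc (Suc i)) k * r i = r i * D_prod (Suc (Suc i)) k"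
    by (auto intro!: triv_commute_op2 triv_D_prod)
  have "r i * D_prod 0 n = D_prod 0 i * (r i * (d i * d (Suc i))) * D_prod (Suc (Suc i)) k"
    unfolding D by (simp only: mult.assoc[symmetric] c(1))
  also have "\<dots> = D_prod 0 i * (d i * d (Suc i)) * (r i * D_prod (Suc (Suc i)) k)"
    unfolding d_commute_r[symmetric] by (simp only: mult.assoc)
  also have "\<dots> = D_prod 0 n * r i"
    unfolding D c(2)[symmetric] by (simp only: mult.assoc)
  finally show ?thesis .
qed

text \<open>The matrix \<open>r i\<close> has scalar entries, so the trace can be rotated past it;
  on its way back to \<open>x\<close> it commutes with \<open>D_prod\<close> exactly and with
  \<open>M_prod\<close> modulo the relations.\<close>

lemma T_commute_r:
  assumes i: "Suc i < n" and x: "local n x"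
  shows "T n (x * r i) - T n (r i * x) \<in> qma_ideal R F"
proof -
  have "T n (x * r i) = tr n (r i * (D_prod 0 n * M_prod 0 n * x))"
    unfolding T_def
    by (subst tr_commute_op2[OF i]) (auto simp: mult.assoc intro!: local_mult local_D_prod local_M_prod x)
  also have "r i * (D_prod 0 n * M_prod 0 n * x) = D_prod 0 n * (r i * M_prod 0 n) * x"
    by (simp only: mult.assoc[symmetric] D_prod_r[OF i])
  finally have "T n (x * r i) - T n (r i * x) = tr n (D_prod 0 n * (r i * M_prod 0 n - M_prod 0 n * r i) * x)"
    by (simp add: T_def tr_diff[symmetric] right_diff_distrib left_diff_distrib mult.assoc)
  moreover have "ideal_preserving (D_prod 0 n)"
    unfolding D_prod_def by (rule ideal_preserving_prod_list) (auto simp: ideal_preserving_op1)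
  ultimately show ?thesis
    using tr_ideal_valued ideal_valued_mult_right ideal_valued_mult_left M_prod_r[OF i] by metis
qed

lemma T_commute_r':
  assumes i: "Suc i < n" and x: "local n x"
  shows "T n (x * r' i) - T n (r' i * x) \<in> qma_ideal R F"
proof -
  \<comment> \<open>For this element \<open>T_commute_r\<close> compares \<open>r' i * x\<close>
    with \<open>x * r' i\<close>.\<close>
  have "local n (r' i * x * r' i)"
    using i x by (auto intro!: local_mult local_op2)
  from T_commute_r[OF i this] have "T n (r' i * x) - T n (x * r' i) \<in> qma_ideal R F"
    by (simp add: mult.assoc)
  then show ?thesis
    using ideal_uminus by fastforce
qed

theorem T_cyclic:
  assumes "w \<in> braid_words n" and "local n x"
  shows "T n (x * rw w) - T n (rw w * x) \<in> qma_ideal R F"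
  using assms
proof (induction w arbitrary: x)
  case Nil
  then show ?case by (simp add: ideal_0)
next
  case (Cons l w)
  obtain j e where l: "l = (j, e)" by (cases l)
  have j: "Suc j < n" and w: "w \<in> braid_words n"
    using Cons.prems by (auto simp: braid_words_def l)
  have loc: "local n (x * letter l)" "local n (rw w * x)"
    using Cons.prems w j by (auto simp: l intro!: local_mult local_op2 local_rw)
  have "T n (x * letter l * rw w) - T n (rw w * (x * letter l)) \<in> qma_ideal R F"
    by (rule Cons.IH[OF w loc(1)])
  moreover have "T n (rw w * x * letter l) - T n (letter l * (rw w * x)) \<in> qma_ideal R F"
    using T_commute_r[OF j loc(2)] T_commute_r'[OF j loc(2)] by (cases e) (simp_all add: l)
  ultimately show ?case
    using ideal_add by (fastforce simp: rw_Cons mult.assoc)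
qed

lemma T_add: "T n (x + y) = T n x + T n y" and T_sc: "T n (sc c * x) = scal c * T n x"
  by (simp_all add: T_def tr_add distrib_left sc_left_commute tr_lm_left)

lemma T_sum: "T n (\<Sum>a\<in>A. x a) = (\<Sum>a\<in>A. T n (x a))"
  by (simp add: T_def sum_distrib_left tr_sum)

lemma ch_T: "ch R F n \<alpha> = qma_proj R F (T n (embo 0 n (op_scal (rho R n \<alpha>))))"
proof -
  let ?A = "map (\<lambda>i. op_scal (leg1 n i (Dmat R))) [1..<n + 1] @ map (\<lambda>i. Mbar F n i) [1..<n + 1]
     @ [op_scal (rho R n \<alpha>)]"
  have D: "map (\<lambda>i. embo 0 n (op_scal (leg1 n i (Dmat R)))) [1..<n + 1] = map d [0..<n]"
    and M: "map (\<lambda>i. embo 0 n (Mbar F n i)) [1..<n + 1] = map M_bar [0..<n]"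
    by (auto simp: list_eq_iff_nth_eq embo_cop1[of _ n 0, simplified] embo_Mbar simp del: upt_Suc M_bar.simps Mbar.simps)
  have "op_trace n (op_prod n ?A) = tr n (prod_list (map (embo 0 n) ?A))"
    by (simp only: tr_embo[symmetric] embo_prod)
  also have "\<dots> = T n (embo 0 n (op_scal (rho R n \<alpha>)))"
    unfolding T_def D_prod_def M_prod_def add_0 D[symmetric] M[symmetric]
    by (simp add: o_def mult.assoc del: upt_Suc)
  finally show ?thesis by (simp add: ch_def)
qed

end

section \<open>The representation of the braid group algebra\<close>

context qma_setup
begin

lemma rw_braid_eq: "braid_eq u v \<Longrightarrow> rw u = rw v"
proof (induction rule: braid_eq.induct)
  case (cong u u' v v')
  then show ?case by (simp add: rw_append)
next
  case (cancel j e)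
  show ?case by (cases e) (simp_all add: rw_Cons)
next
  case (braid j)
  show ?case using braid_r[of j] by (simp add: rw_Cons mult.assoc)
next
  case (far j l)
  then have "j + 2 \<le> l" by simp
  then have "r j * r l = r l * r j" by (rule op2_far_commute)
  then show ?case by (simp add: rw_Cons)
qed simp_all

definition rb :: "braid \<Rightarrow> ('n, 'n falg) chain" where
  "rb b = rw (rep_braid b)"

lemma rb_abs: "rb (abs_braid w) = rw w"
proof -
  have "braid_eq (rep_braid (abs_braid w)) w"
    by (metis Quotient3_abs_rep Quotient3_braid braid.abs_eq_iff)
  then show ?thesis by (simp add: rb_def rw_braid_eq)
qed

lemma rb_plus: "rb (a + b) = rb a * rb b"
  by (induction a, induction b) (simp add: plus_braid.abs_eq rb_abs rw_append)

lemma rb_0: "rb 0 = 1"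
  by (simp add: zero_braid_def rb_abs)

text \<open>The representation as one homomorphism on the algebra of all braids, with no number of
  strands in it.\<close>

definition rhoE :: "braid_alg \<Rightarrow> ('n, 'n falg) chain" where
  "rhoE \<alpha> = (\<Sum>b\<in>Poly_Mapping.keys \<alpha>. sc (Poly_Mapping.lookup \<alpha> b) * rb b)"

lemma rhoE_superset:
  assumes "finite S" "Poly_Mapping.keys \<alpha> \<subseteq> S"
  shows "rhoE \<alpha> = (\<Sum>b\<in>S. sc (Poly_Mapping.lookup \<alpha> b) * rb b)"
  unfolding rhoE_def by (rule sum.mono_neutral_left) (use assms in \<open>auto simp: in_keys_iff\<close>)

lemma rhoE_add: "rhoE (\<alpha> + \<beta>) = rhoE \<alpha> + rhoE \<beta>"
proof -
  let ?S = "Poly_Mapping.keys \<alpha> \<union> Poly_Mapping.keys \<beta>"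
  have "Poly_Mapping.keys (\<alpha> + \<beta>) \<subseteq> ?S" by (rule keys_add)
  then show ?thesis
    by (simp add: rhoE_superset[of ?S] lookup_add scal_add lm_add distrib_right sum.distrib)
qed

lemma rhoE_0: "rhoE 0 = 0"
  by (simp add: rhoE_def)

lemma rhoE_sum: "rhoE (\<Sum>a\<in>A. x a) = (\<Sum>a\<in>A. rhoE (x a))"
  by (induction A rule: infinite_finite_induct) (simp_all add: rhoE_add rhoE_0)

lemma rhoE_single: "rhoE (Poly_Mapping.single b c) = sc c * rb b"
  by (cases "c = 0") (simp_all add: rhoE_def)

lemma rhoE_mult: "rhoE (\<alpha> * \<beta>) = rhoE \<alpha> * rhoE \<beta>"
proof -
  have "rhoE (\<alpha> * \<beta>) = (\<Sum>a\<in>Poly_Mapping.keys \<alpha>. \<Sum>b\<in>Poly_Mapping.keys \<beta>.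
      rhoE (Poly_Mapping.single a (Poly_Mapping.lookup \<alpha> a) * Poly_Mapping.single b (Poly_Mapping.lookup \<beta> b)))"
    by (subst poly_mapping_sum_single[of \<alpha>], subst poly_mapping_sum_single[of \<beta>])
      (simp add: sum_distrib_left sum_distrib_right rhoE_sum sum.swap[of _ "Poly_Mapping.keys \<alpha>"])
  also have "\<dots> = (\<Sum>a\<in>Poly_Mapping.keys \<alpha>. \<Sum>b\<in>Poly_Mapping.keys \<beta>.
      (sc (Poly_Mapping.lookup \<alpha> a) * rb a) * (sc (Poly_Mapping.lookup \<beta> b) * rb b))"
    by (simp add: mult_single rhoE_single rb_plus scal_mult lm_mult mult.assoc sc_left_commute[of "rb _"])
  also have "\<dots> = rhoE \<alpha> * rhoE \<beta>"
    by (simp add: rhoE_def sum_distrib_left sum_distrib_right sum.swap[of _ "Poly_Mapping.keys \<alpha>"])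
  finally show ?thesis .
qed

lemma rhoE_scal: "rhoE (scal c) = sc c"
  using rhoE_single[of 0 c] by (simp add: scal_def rb_0)

lemma rhoE_1: "rhoE 1 = 1"
  using rhoE_scal[of 1] by simp

lemma rhoE_uminus: "rhoE (- \<alpha>) = - rhoE \<alpha>"
  using rhoE_add[of \<alpha> "- \<alpha>"] by (simp add: rhoE_0 eq_neg_iff_add_eq_0 add.commute)

lemma rhoE_diff: "rhoE (\<alpha> - \<beta>) = rhoE \<alpha> - rhoE \<beta>"
  using rhoE_add[of \<alpha> "- \<beta>"] by (simp add: rhoE_uminus)

lemma rhoE_sigma: "rhoE (sigma i) = r (i - 1)"
  by (simp add: sigma_def rhoE_single rb_abs rw_Cons)

lemma embo_rho_word:
  assumes "w \<in> braid_words n"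
  shows "embo i n (op_scal (rho_word R n w)) = rw (shift_word i w)"
proof -
  have "embo i n (op_scal (adj n (j + 1) (if e then R else matrix_inv R))) = letter (j + i, e)"
    if "(j, e) \<in> set w" for j e
    using embo_op2[of j n i "if e then R else matrix_inv R"] braid_wordsD[OF that assms]
    by (simp add: add.commute)
  then show ?thesis
    unfolding rho_word_def embo_scal_prod rw_def shift_word_def map_map
    by (intro arg_cong[where f = prod_list] map_cong) (auto simp: o_def simp del: letter.simps)
qed

lemma braid_group_word:
  assumes "b \<in> braid_group n"
  defines "w \<equiv> SOME w. w \<in> braid_words n \<and> abs_braid w = b"
  shows "w \<in> braid_words n" and "abs_braid w = b"
proof -
  have "\<exists>w. w \<in> braid_words n \<and> abs_braid w = b"
    using assms(1) by (auto simp: braid_group_def)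
  from someI_ex[OF this] show "w \<in> braid_words n" and "abs_braid w = b"
    by (simp_all add: w_def)
qed

lemma embo_rho:
  assumes "\<alpha> \<in> braid_algebra n"
  shows "embo i n (op_scal (rho R n \<alpha>)) = (\<Sum>b\<in>Poly_Mapping.keys \<alpha>. sc (Poly_Mapping.lookup \<alpha> b) * rb (shift_braid i b))"
proof -
  let ?w = "\<lambda>b. SOME w. w \<in> braid_words n \<and> abs_braid w = b"
  have "op_scal (rho R n \<alpha>) = (\<lambda>xs ys. \<Sum>b\<in>Poly_Mapping.keys \<alpha>. scal (Poly_Mapping.lookup \<alpha> b) * op_scal (rho_word R n (?w b)) xs ys)"
    by (simp add: fun_eq_iff op_scal_def rho_def scal_sum scal_mult)
  then have "embo i n (op_scal (rho R n \<alpha>)) = (\<Sum>b\<in>Poly_Mapping.keys \<alpha>. sc (Poly_Mapping.lookup \<alpha> b) * embo i n (op_scal (rho_word R n (?w b))))"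
    by (simp add: embo_sum embo_lm)
  also have "\<dots> = (\<Sum>b\<in>Poly_Mapping.keys \<alpha>. sc (Poly_Mapping.lookup \<alpha> b) * rb (shift_braid i b))"
  proof (rule sum.cong[OF HOL.refl])
    fix b assume "b \<in> Poly_Mapping.keys \<alpha>"
    then have b: "b \<in> braid_group n"
      using assms by (auto simp: braid_algebra_def)
    have "shift_braid i b = abs_braid (shift_word i (?w b))"
      by (metis braid_group_word(2)[OF b] shift_braid.abs_eq)
    then show "sc (Poly_Mapping.lookup \<alpha> b) * embo i n (op_scal (rho_word R n (?w b))) = sc (Poly_Mapping.lookup \<alpha> b) * rb (shift_braid i b)"
      by (simp add: embo_rho_word[OF braid_group_word(1)[OF b]] rb_abs)
  qed
  finally show ?thesis .
qed

lemma rhoE_shift_alg: "rhoE (shift_alg m \<alpha>) = (\<Sum>b\<in>Poly_Mapping.keys \<alpha>. sc (Poly_Mapping.lookup \<alpha> b) * rb (shift_braid m b))"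
  by (simp add: shift_alg_def rhoE_sum rhoE_single)

lemma shift_braid_0: "shift_braid 0 b = b"
  by (induction b) (simp add: shift_braid.abs_eq shift_word_0)

text \<open>Since the offset becomes a shift, the vanishing of one \<open>rho R n \<alpha>\<close>
  makes all shifts of \<alpha> act as zero.\<close>

lemma embo_rho_shift:
  assumes "\<alpha> \<in> braid_algebra n"
  shows "embo i n (op_scal (rho R n \<alpha>)) = rhoE (shift_alg i \<alpha>)"
  by (simp add: embo_rho[OF assms] rhoE_shift_alg)

lemma embo_rho_0: "\<alpha> \<in> braid_algebra n \<Longrightarrow> embo 0 n (op_scal (rho R n \<alpha>)) = rhoE \<alpha>"
  by (simp add: embo_rho shift_braid_0 rhoE_def)

lemma ch_rhoE: "\<alpha> \<in> braid_algebra n \<Longrightarrow> ch R F n \<alpha> = qma_proj R F (T n (rhoE \<alpha>))"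
  by (simp add: ch_T embo_rho_0)

end

section \<open>Shifts and strand numbers in the braid group algebra\<close>

lemma shift_braid_plus: "shift_braid m (a + b) = shift_braid m a + shift_braid m b"
  by (induction a, induction b) (simp add: plus_braid.abs_eq shift_braid.abs_eq shift_word_def)

lemma shift_alg_single: "shift_alg m (Poly_Mapping.single b c) = Poly_Mapping.single (shift_braid m b) c"
  by (cases "c = 0") (simp_all add: shift_alg_def)

lemma shift_alg_superset:
  assumes "finite S" "Poly_Mapping.keys \<alpha> \<subseteq> S"
  shows "shift_alg m \<alpha> = (\<Sum>b\<in>S. Poly_Mapping.single (shift_braid m b) (Poly_Mapping.lookup \<alpha> b))"
  unfolding shift_alg_def by (rule sum.mono_neutral_left) (use assms in \<open>auto simp: in_keys_iff\<close>)

lemma shift_alg_add: "shift_alg m (\<alpha> + \<beta>) = shift_alg m \<alpha> + shift_alg m \<beta>"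
proof -
  let ?S = "Poly_Mapping.keys \<alpha> \<union> Poly_Mapping.keys \<beta>"
  have "Poly_Mapping.keys (\<alpha> + \<beta>) \<subseteq> ?S" by (rule keys_add)
  then show ?thesis
    by (simp add: shift_alg_superset[of ?S] lookup_add single_add sum.distrib)
qed

lemma shift_alg_0 [simp]: "shift_alg m 0 = 0"
  by (simp add: shift_alg_def)

lemma shift_alg_sum: "shift_alg m (\<Sum>a\<in>A. x a) = (\<Sum>a\<in>A. shift_alg m (x a))"
  by (induction A rule: infinite_finite_induct) (simp_all add: shift_alg_add)

lemma shift_alg_mult: "shift_alg m (\<alpha> * \<beta>) = shift_alg m \<alpha> * shift_alg m \<beta>"
proof -
  have "shift_alg m (\<alpha> * \<beta>) = (\<Sum>a\<in>Poly_Mapping.keys \<alpha>. \<Sum>b\<in>Poly_Mapping.keys \<beta>.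
      shift_alg m (Poly_Mapping.single a (Poly_Mapping.lookup \<alpha> a) * Poly_Mapping.single b (Poly_Mapping.lookup \<beta> b)))"
    by (subst poly_mapping_sum_single[of \<alpha>], subst poly_mapping_sum_single[of \<beta>])
      (simp add: sum_distrib_left sum_distrib_right shift_alg_sum sum.swap[of _ "Poly_Mapping.keys \<alpha>"])
  also have "\<dots> = shift_alg m \<alpha> * shift_alg m \<beta>"
    by (simp add: shift_alg_def[of m \<alpha>] shift_alg_def[of m \<beta>] shift_alg_single mult_single shift_braid_plus
        sum_distrib_left sum_distrib_right sum.swap[of _ "Poly_Mapping.keys \<alpha>"])
  finally show ?thesis .
qed

lemma shift_alg_scal: "shift_alg m (scal c) = scal c"
proof -
  have "shift_braid m 0 = 0"
    by (simp add: zero_braid_def shift_braid.abs_eq shift_word_def)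
  then show ?thesis
    by (simp add: scal_def shift_alg_single)
qed

lemma shift_alg_1: "shift_alg m 1 = 1"
  using shift_alg_scal[of m 1] by simp

lemma shift_alg_diff: "shift_alg m (\<alpha> - \<beta>) = shift_alg m \<alpha> - shift_alg m \<beta>"
  using shift_alg_add[of m "\<alpha> - \<beta>" \<beta>] by simp

lemma shift_alg_sigma: "i \<ge> 1 \<Longrightarrow> shift_alg m (sigma i) = sigma (i + m)"
  by (simp add: sigma_def shift_alg_single shift_braid.abs_eq shift_word_def)

lemma braid_algebra_add: "\<alpha> \<in> braid_algebra n \<Longrightarrow> \<beta> \<in> braid_algebra n \<Longrightarrow> \<alpha> + \<beta> \<in> braid_algebra n"
  using keys_add[of \<alpha> \<beta>] by (auto simp: braid_algebra_def)

lemma braid_algebra_diff: "\<alpha> \<in> braid_algebra n \<Longrightarrow> \<beta> \<in> braid_algebra n \<Longrightarrow> \<alpha> - \<beta> \<in> braid_algebra n"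
  using keys_diff[of \<alpha> \<beta>] by (auto simp: braid_algebra_def)

lemma braid_group_plus: "a \<in> braid_group n \<Longrightarrow> b \<in> braid_group n \<Longrightarrow> a + b \<in> braid_group n"
proof -
  assume "a \<in> braid_group n" "b \<in> braid_group n"
  then obtain u v where uv: "u \<in> braid_words n" "v \<in> braid_words n" "a = abs_braid u" "b = abs_braid v"
    by (auto simp: braid_group_def)
  then have "u @ v \<in> braid_words n"
    by (auto simp: braid_words_def)
  then show "a + b \<in> braid_group n"
    by (auto simp: braid_group_def uv plus_braid.abs_eq)
qed

lemma braid_algebra_mult: "\<alpha> \<in> braid_algebra n \<Longrightarrow> \<beta> \<in> braid_algebra n \<Longrightarrow> \<alpha> * \<beta> \<in> braid_algebra n"
  using keys_mult[of \<alpha> \<beta>] by (fastforce simp: braid_algebra_def intro: braid_group_plus)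

lemma braid_algebra_single: "b \<in> braid_group n \<Longrightarrow> Poly_Mapping.single b c \<in> braid_algebra n"
  by (auto simp: braid_algebra_def)

lemma zero_braid_group: "0 \<in> braid_group n"
  by (auto simp: zero_braid_def braid_group_def braid_words_def intro!: imageI)

lemma braid_algebra_scal: "scal c \<in> braid_algebra n"
  unfolding scal_def by (rule braid_algebra_single[OF zero_braid_group])

lemma braid_algebra_1: "1 \<in> braid_algebra n"
  using braid_algebra_scal[of 1] by simp

lemma braid_algebra_sigma: "1 \<le> i \<Longrightarrow> i < n \<Longrightarrow> sigma i \<in> braid_algebra n"
  unfolding sigma_def
  by (rule braid_algebra_single) (auto simp: braid_group_def braid_words_def intro!: imageI)

lemmas braid_algebra_intros = braid_algebra_add braid_algebra_diff braid_algebra_mult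
  braid_algebra_scal braid_algebra_1 braid_algebra_sigma

lemma braid_algebra_kappa: "1 \<le> i \<Longrightarrow> i < n \<Longrightarrow> kappa q \<mu> i \<in> braid_algebra n"
  unfolding kappa_def by (intro braid_algebra_intros)

lemma braid_algebra_sigma_minus: "1 \<le> i \<Longrightarrow> i < n \<Longrightarrow> sigma_minus q \<mu> i x \<in> braid_algebra n"
  unfolding sigma_minus_def by (intro braid_algebra_intros braid_algebra_kappa)

lemma braid_algebra_antisym_el: "k \<le> n \<Longrightarrow> antisym_el q \<mu> k \<in> braid_algebra n"
  by (induction k) (auto intro!: braid_algebra_intros braid_algebra_sigma_minus)

section \<open>The Birman-Murakami-Wenzl relations\<close>

lemma sc_sc: "sc a * sc b = sc (a * b)"
  by (simp add: scal_mult lm_mult)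

lemma sc_add: "sc (a + b) = sc a + sc b" and sc_diff: "sc (a - b) = sc a - sc b"
  and sc_uminus: "sc (- a) = - sc a"
  by (simp_all add: scal_add lm_add scal_diff lm_diff scal_uminus lm_uminus)

lemma sc_cancel_left: "a \<noteq> 0 \<Longrightarrow> sc (inverse a) * (sc a * x) = x"
  by (simp add: sc_sc flip: mult.assoc)

locale bmw_setup = qma_setup R F for R F :: "'n::finite mat2" +
  fixes q \<mu> :: complex
  assumes bmw: "bmw_type q \<mu> R"
begin

definition K :: "nat \<Rightarrow> ('n, 'n falg) chain" where
  "K i = op2 i (Kmat q \<mu> R)"

definition \<delta> :: complex where "\<delta> = q - inverse q"

lemma q_nz: "q \<noteq> 0" and \<mu>_nz: "\<mu> \<noteq> 0" and \<delta>_nz: "\<delta> \<noteq> 0" and eta_nz: "eta q \<mu> \<noteq> 0"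
proof -
  show "q \<noteq> 0" "\<mu> \<noteq> 0" using bmw by (auto simp: bmw_type_def)
  show d: "\<delta> \<noteq> 0"
  proof
    assume "\<delta> = 0"
    then have "q * q = 1" using \<open>q \<noteq> 0\<close> by (simp add: \<delta>_def field_simps)
    then have "q = 1 \<or> q = - 1" by (simp add: square_eq_1_iff)
    then show False using bmw by (auto simp: bmw_type_def)
  qed
  have "inverse q + \<mu> \<noteq> 0" "q \<noteq> \<mu>"
    using bmw by (auto simp: bmw_type_def add_eq_0_iff)
  then show "eta q \<mu> \<noteq> 0"
    using d \<open>\<mu> \<noteq> 0\<close> by (simp add: eta_def \<delta>_def)
qed

definition c0 :: complex where "c0 = inverse \<mu> * inverse \<delta>"

lemma c0_nz: "c0 \<noteq> 0"
  by (simp add: c0_def \<mu>_nz \<delta>_nz)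

lemma K_factor: "K i = sc c0 * (sc q - r i) * (sc (inverse q) + r i)"
  unfolding K_def Kmat_def c0_def \<delta>_def
  by (simp add: op2_mult[symmetric] op2_mat op2_diff op2_add)

lemma K_poly: "K i = sc c0 * (1 + sc \<delta> * r i - r i * r i)"
proof -
  have "(sc q - r i) * (sc (inverse q) + r i) = sc q * sc (inverse q) + (sc q * r i - r i * sc (inverse q)) - r i * r i"
    by (simp add: algebra_simps)
  also have "\<dots> = 1 + sc \<delta> * r i - r i * r i"
    by (simp add: sc_central[of "r i"] sc_sc q_nz \<delta>_def sc_diff left_diff_distrib)
  finally show ?thesis
    by (simp add: K_factor mult.assoc)
qed

lemma r_square: "r i * r i = 1 + sc \<delta> * r i - sc (inverse c0) * K i"
  unfolding K_poly by (simp add: sc_cancel_left c0_nz)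

lemma r_cubic: "r i * (r i * r i) + sc (inverse q - q - \<mu>) * (r i * r i) + sc (\<mu> * \<delta> - 1) * r i + sc \<mu> = 0"
proof -
  let ?p = "[:- q, 1:] * [:inverse q, 1:] * [:- \<mu>, 1:] :: complex poly"
  have p: "?p = [:\<mu>, \<mu> * \<delta> - 1, inverse q - q - \<mu>, 1:]"
    using q_nz by (simp add: \<delta>_def algebra_simps)
  have "matrix_poly ?p R = 0"
    using bmw unfolding bmw_type_def is_minimal_poly_def by blast
  then have "mat \<mu> + mat (\<mu> * \<delta> - 1) ** R + mat (inverse q - q - \<mu>) ** (R ** R) + R ** (R ** R) = 0"
    unfolding p by (simp add: matrix_poly_def eval_nat_numeral)
  then have "op2 i (mat \<mu> + mat (\<mu> * \<delta> - 1) ** R + mat (inverse q - q - \<mu>) ** (R ** R) + R ** (R ** R)) =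
      (0 :: ('n, 'n falg) chain)" by simp
  then show ?thesis
    by (simp add: op2_add op2_mult[symmetric] op2_mat add_ac)
qed

text \<open>The difference of the two sides is a multiple of the minimal polynomial of
  \<open>R\<close>, because \<open>K i\<close> is the quadratic factor that is missing from
  \<open>r i - \<mu>\<close>.\<close>

lemma K_r: "K i * r i = sc \<mu> * K i"
proof -
  have "(1 + sc \<delta> * r i - r i * r i) * r i - sc \<mu> * (1 + sc \<delta> * r i - r i * r i) =
      - (r i * (r i * r i) + sc (inverse q - q - \<mu>) * (r i * r i) + sc (\<mu> * \<delta> - 1) * r i + sc \<mu>)"
    by (simp add: algebra_simps sc_diff sc_add sc_sc \<delta>_def flip: mult.assoc)
  then have "(1 + sc \<delta> * r i - r i * r i) * r i = sc \<mu> * (1 + sc \<delta> * r i - r i * r i)"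
    using r_cubic[of i] by simp
  then show ?thesis
    by (simp add: K_poly mult.assoc sc_left_commute[of "sc \<mu>"])
qed

lemma r_K: "r i * K i = sc \<mu> * K i"
proof -
  have "r i * K i = K i * r i"
    by (simp add: K_poly sc_left_commute[of "r i"] sc_central[of "r i"] distrib_left distrib_right left_diff_distrib
        right_diff_distrib mult.assoc)
  then show ?thesis by (simp add: K_r)
qed

lemma K_r': "K i * r' i = sc (inverse \<mu>) * K i" and r'_K: "r' i * K i = sc (inverse \<mu>) * K i"
proof -
  have "K i * r' i = sc (inverse \<mu>) * ((K i * r i) * r' i)"
    by (simp add: K_r sc_cancel_left \<mu>_nz mult.assoc)
  then show "K i * r' i = sc (inverse \<mu>) * K i" by (simp add: mult.assoc)
  have "r' i * K i = r' i * (sc (inverse \<mu>) * (r i * K i))"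
    unfolding r_K by (simp add: sc_cancel_left \<mu>_nz)
  then have "r' i * K i = sc (inverse \<mu>) * (r' i * (r i * K i))"
    by (simp only: sc_left_commute[of "r' i"])
  then show "r' i * K i = sc (inverse \<mu>) * K i" by simp
qed

text \<open>Multiply \<open>r_square\<close> by \<open>r' i\<close>, which the contractor absorbs as
  a scalar.\<close>

lemma r'_poly: "r' i = r i - sc \<delta> + sc \<delta> * K i"
proof -
  have "r' i * (r i * r i) = r' i * (1 + sc \<delta> * r i - sc (inverse c0) * K i)"
    by (simp only: r_square)
  then have "r i = r' i + sc \<delta> - sc (inverse c0) * (sc (inverse \<mu>) * K i)"
    by (simp add: algebra_simps sc_left_commute[of "r' i"] r'_K)
  also have "sc (inverse c0) * (sc (inverse \<mu>) * K i) = sc \<delta> * K i"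
    using \<mu>_nz by (simp add: sc_sc c0_def field_simps flip: mult.assoc)
  finally show ?thesis by (simp add: algebra_simps)
qed

lemma K_K: "K i * K i = sc (eta q \<mu>) * K i"
proof -
  have "K i * K i = sc c0 * ((K i * (sc q - r i)) * (sc (inverse q) + r i))"
    by (subst (2) K_factor) (simp only: mult.assoc sc_left_commute[of "K i"])
  also have "K i * (sc q - r i) = sc (q - \<mu>) * K i"
    by (simp add: right_diff_distrib sc_diff left_diff_distrib K_r sc_central[of "K i"])
  also have "sc (q - \<mu>) * K i * (sc (inverse q) + r i) = sc (q - \<mu>) * (sc (inverse q + \<mu>) * K i)"
    by (simp add: distrib_left sc_add distrib_right K_r sc_central[of "K i"] mult.assoc)
  also have "sc c0 * (sc (q - \<mu>) * (sc (inverse q + \<mu>) * K i)) = sc (c0 * (q - \<mu>) * (inverse q + \<mu>)) * K i"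
    by (simp only: sc_sc[symmetric] mult.assoc)
  also have "c0 * (q - \<mu>) * (inverse q + \<mu>) = eta q \<mu>"
    by (simp add: c0_def eta_def \<delta>_def divide_inverse mult_ac)
  finally show ?thesis .
qed

lemma K_rel1: "K (Suc i) * K i = r i * r (Suc i) * K i"
  and K_rel3: "K i * K (Suc i) * K i = K i"
proof -
  let ?K = "Kmat q \<mu> R"
  have b: "op_prod 3 [adj 3 2 ?K, adj 3 1 ?K] = op_prod 3 [adj 3 1 R, adj 3 2 R, adj 3 1 ?K]"
    "op_prod 3 [adj 3 1 ?K, adj 3 2 ?K, adj 3 1 ?K] = adj 3 1 ?K"
    using bmw unfolding bmw_type_def Let_def by blast+
  note e = embo_scal_prod list.map embo_adj_3 prod_list.Cons prod_list.Nil mult_1_right mult.assoc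
  show "K (Suc i) * K i = r i * r (Suc i) * K i"
    using arg_cong[OF b(1), of "\<lambda>A. embo i 3 (op_scal A)"] unfolding K_def by (simp only: e)
  show "K i * K (Suc i) * K i = K i"
    using arg_cong[OF b(2), of "\<lambda>A. embo i 3 (op_scal A)"] unfolding K_def by (simp only: e)
qed

text \<open>The contractor is a polynomial in \<open>r\<close>, so it is carried along.\<close>

lemma K_intertwine:
  assumes "z * r i = r j * z"
  shows "z * K i = K j * z"
proof -
  have "z * (r i * r i) = r j * r j * z"
    by (simp add: assms flip: mult.assoc) (simp add: assms mult.assoc)
  then show ?thesis
    by (simp add: K_poly sc_left_commute[of z] sc_central[of z] mult.assoc distrib_left distrib_right right_diff_distrib
        left_diff_distrib assms)
qed

text \<open>The half twist on three strands. Conjugation by it exchanges positions \<open>i\<close>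
  and \<open>Suc i\<close>, so that every relation yields its mirror image.\<close>

definition \<Delta> :: "nat \<Rightarrow> ('n, 'n falg) chain" where
  "\<Delta> i = r i * r (Suc i) * r i"

definition \<Delta>' :: "nat \<Rightarrow> ('n, 'n falg) chain" where
  "\<Delta>' i = r' i * r' (Suc i) * r' i"

lemma \<Delta>_\<Delta>': "\<Delta> i * \<Delta>' i = 1"
  by (simp add: \<Delta>_def \<Delta>'_def mult.assoc)

lemma \<Delta>_r: "\<Delta> i * r i = r (Suc i) * \<Delta> i" "\<Delta> i * r (Suc i) = r i * \<Delta> i"
proof -
  show "\<Delta> i * r i = r (Suc i) * \<Delta> i"
    unfolding \<Delta>_def by (subst braid_r) (simp only: mult.assoc)
  show "\<Delta> i * r (Suc i) = r i * \<Delta> i"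
    unfolding \<Delta>_def by (subst (2) braid_r) (simp only: mult.assoc)
qed

lemmas \<Delta>_K = \<Delta>_r[THEN K_intertwine]

lemma \<Delta>_cancel: "x * \<Delta> i = y * \<Delta> i \<Longrightarrow> x = y"
proof -
  assume "x * \<Delta> i = y * \<Delta> i"
  then have "x * \<Delta> i * \<Delta>' i = y * \<Delta> i * \<Delta>' i" by simp
  then show "x = y" by (simp only: mult.assoc \<Delta>_\<Delta>' mult_1_right)
qed

lemma \<Delta>_move:
  "K (Suc i) * (\<Delta> i * y) = \<Delta> i * (K i * y)" "K i * (\<Delta> i * y) = \<Delta> i * (K (Suc i) * y)"
  "r (Suc i) * (\<Delta> i * y) = \<Delta> i * (r i * y)" "r i * (\<Delta> i * y) = \<Delta> i * (r (Suc i) * y)"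
  by (simp_all only: mult.assoc[symmetric] \<Delta>_r \<Delta>_K)

lemma K_rel1': "K i * K (Suc i) = r (Suc i) * r i * K (Suc i)"
proof (rule \<Delta>_cancel)
  have "K i * K (Suc i) * \<Delta> i = \<Delta> i * (K (Suc i) * K i)"
    by (simp only: mult.assoc \<Delta>_K[symmetric] \<Delta>_move)
  also have "\<dots> = r (Suc i) * r i * K (Suc i) * \<Delta> i"
    unfolding K_rel1 by (simp only: mult.assoc \<Delta>_K[symmetric] \<Delta>_move)
  finally show "K i * K (Suc i) * \<Delta> i = r (Suc i) * r i * K (Suc i) * \<Delta> i" .
qed

lemma K_rel3': "K (Suc i) * K i * K (Suc i) = K (Suc i)"
proof (rule \<Delta>_cancel)
  have "K (Suc i) * K i * K (Suc i) * \<Delta> i = \<Delta> i * (K i * K (Suc i) * K i)"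
    by (simp only: mult.assoc \<Delta>_K[symmetric] \<Delta>_move)
  then show "K (Suc i) * K i * K (Suc i) * \<Delta> i = K (Suc i) * \<Delta> i"
    unfolding K_rel3 \<Delta>_K .
qed

lemma rr_K: "r i * r (Suc i) * K i = K (Suc i) * (r i * r (Suc i))"
  by (rule K_intertwine[of "r i * r (Suc i)" i "Suc i", OF braid_r[of i, unfolded mult.assoc[of "r (Suc i)"]]])

lemma rr_K': "r (Suc i) * r i * K (Suc i) = K i * (r (Suc i) * r i)"
  by (rule K_intertwine[of "r (Suc i) * r i" "Suc i" i, OF braid_r[of i, symmetric, unfolded mult.assoc[of "r i"]]])

lemma K_K_right: "K (Suc i) * K i = K (Suc i) * r i * r (Suc i)"
  by (simp only: K_rel1 rr_K) (simp only: mult.assoc)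

lemma K_K_right': "K i * K (Suc i) = K i * r (Suc i) * r i"
  by (simp only: K_rel1' rr_K') (simp only: mult.assoc)

text \<open>Multiplying \<open>K_rel1\<close> by \<open>r' i\<close> trades the generator next to a
  contractor for a second contractor. The reductions below all rest on this move and its mirror
  images.\<close>

lemma rK: "r (Suc i) * K i = r' i * K (Suc i) * K i"
  unfolding mult.assoc K_rel1 by (simp add: mult.assoc)

lemma Kr: "K i * r (Suc i) = K i * K (Suc i) * r' i"
  unfolding K_K_right' by (simp add: mult.assoc)

lemma rKr: "r (Suc i) * K i * r (Suc i) = r' i * K (Suc i) * r' i"
proof -
  have "r (Suc i) * K i * r (Suc i) = r' i * K (Suc i) * (K i * r (Suc i))"
    by (simp only: rK mult.assoc)
  also have "\<dots> = r' i * (K (Suc i) * K i * K (Suc i)) * r' i"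
    by (simp only: Kr mult.assoc)
  finally show ?thesis by (simp only: K_rel3')
qed

lemma KKr: "K (Suc i) * K i * r (Suc i) = K (Suc i) * r' i"
  by (simp only: mult.assoc Kr) (simp only: mult.assoc[symmetric] K_rel3')

lemma rKK: "r (Suc i) * K i * K (Suc i) = r' i * K (Suc i)"
  by (simp only: rK) (simp only: mult.assoc K_rel3'[unfolded mult.assoc])

lemma KrK: "K (Suc i) * r i * K (Suc i) = sc (inverse \<mu>) * K (Suc i)"
proof -
  have "r i * K (Suc i) = r' (Suc i) * (K i * K (Suc i))"
    unfolding K_rel1' by (simp add: mult.assoc)
  then have "K (Suc i) * r i * K (Suc i) = (K (Suc i) * r' (Suc i)) * (K i * K (Suc i))"
    by (simp only: mult.assoc)
  also have "\<dots> = sc (inverse \<mu>) * (K (Suc i) * K i * K (Suc i))"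
    by (simp only: K_r' mult.assoc)
  finally show ?thesis by (simp only: K_rel3')
qed

text \<open>The algebra generated by \<open>\<sigma>\<^bsub>i+1\<^esub>\<close> for \<open>i \<in> A\<close>.\<close>

inductive_set alg :: "nat set \<Rightarrow> ('n, 'n falg) chain set" for A where
  alg_word: "fst ` set w \<subseteq> A \<Longrightarrow> rw w \<in> alg A"
| alg_add: "x \<in> alg A \<Longrightarrow> y \<in> alg A \<Longrightarrow> x + y \<in> alg A"
| alg_sc: "x \<in> alg A \<Longrightarrow> sc c * x \<in> alg A"

lemma alg_mult:
  assumes "x \<in> alg A" and "y \<in> alg A"
  shows "x * y \<in> alg A"
  using assms(1)
proof (induction x)
  case (alg_word u)
  show ?case
    using assms(2)
  proof (induction y)
    case (alg_word v)
    have "rw (u @ v) \<in> alg A"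
      using \<open>fst ` set u \<subseteq> A\<close> alg_word by (intro alg.alg_word) auto
    then show ?case by (simp add: rw_append)
  qed (auto simp: distrib_left sc_left_commute intro: alg_add alg_sc)
qed (auto simp: distrib_right mult.assoc intro: alg_add alg_sc)

lemma alg_mono: "x \<in> alg A \<Longrightarrow> A \<subseteq> B \<Longrightarrow> x \<in> alg B"
  by (induction rule: alg.induct) (auto intro: alg.intros)

lemma alg_1: "1 \<in> alg A"
  using alg_word[of "[]" A] by simp

lemma alg_sc': "sc c \<in> alg A"
  by (metis alg_sc alg_1 mult_1_right)

lemma alg_diff: "x \<in> alg A \<Longrightarrow> y \<in> alg A \<Longrightarrow> x - y \<in> alg A"
  using alg_add[of x A "sc (- 1) * y"] alg_sc[of y A "- 1"] by (simp add: sc_uminus)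

lemma alg_r: "i \<in> A \<Longrightarrow> r i \<in> alg A" and alg_r': "i \<in> A \<Longrightarrow> r' i \<in> alg A"
  using alg_word[of "[(i, True)]" A] alg_word[of "[(i, False)]" A] by (simp_all add: rw_Cons)

lemma alg_K: "i \<in> A \<Longrightarrow> K i \<in> alg A"
  unfolding K_poly by (intro alg_sc alg_diff alg_add alg_mult alg_1 alg_r alg_sc')

lemma alg_prod_list: "(\<And>x. x \<in> set xs \<Longrightarrow> x \<in> alg A) \<Longrightarrow> prod_list xs \<in> alg A"
  by (induction xs) (simp_all add: alg_1 alg_mult)

lemmas alg_intros = alg_mult alg_add alg_diff alg_sc alg_1 alg_sc' alg_r alg_r' alg_K

lemma alg_commute_op2:
  assumes "x \<in> alg A" and "\<And>i. i \<in> A \<Longrightarrow> i + 2 \<le> j \<or> j + 2 \<le> i"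
  shows "x * op2 j X = op2 j X * x"
  using assms(1)
proof (induction x)
  case (alg_word w)
  have "op2 j X * letter l = letter l * op2 j X" if "l \<in> set w" for l
  proof -
    obtain i e where l: "l = (i, e)" by (cases l)
    have "i \<in> A" using that alg_word by (auto simp: l)
    then have "op2 j X * op2 i Y = op2 i Y * (op2 j X :: ('n, 'n falg) chain)" for Y
      using assms(2)[of i] by (metis op2_far_commute)
    then show ?thesis by (simp add: l)
  qed
  then show ?case
    unfolding rw_def by (intro prod_list_commute[symmetric]) auto
next
  case (alg_sc x c)
  then show ?case by (simp add: mult.assoc sc_left_commute)
qed (simp add: distrib_left distrib_right)

lemma alg_commute:
  assumes y: "y \<in> alg B" and x: "x \<in> alg A"
    and far: "\<And>i j. i \<in> A \<Longrightarrow> j \<in> B \<Longrightarrow> i + 2 \<le> j \<or> j + 2 \<le> i"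
  shows "x * y = y * x"
  using y
proof (induction y)
  case (alg_word w)
  have "x * letter l = letter l * x" if "l \<in> set w" for l
  proof -
    obtain j e where l: "l = (j, e)" by (cases l)
    have "j \<in> B" using that alg_word by (auto simp: l)
    then show ?thesis using alg_commute_op2[OF x, of j] far by (auto simp: l)
  qed
  then show ?case
    unfolding rw_def by (intro prod_list_commute) auto
next
  case (alg_sc x c)
  then show ?case by (simp add: mult.assoc sc_left_commute)
qed (simp add: distrib_left distrib_right)

lemma alg_commute_K:
  assumes "x \<in> alg A" and "\<And>i. i \<in> A \<Longrightarrow> i + 2 \<le> j \<or> j + 2 \<le> i"
  shows "x * K j = K j * x" and "x * r j = r j * x"
  unfolding K_def by (rule alg_commute_op2[OF assms], assumption)+

section \<open>Normal form of words with respect to the last generator\<close>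

lemma alg_empty: "x \<in> alg {} \<Longrightarrow> \<exists>c. x = sc c"
proof (induction rule: alg.induct)
  case (alg_word w)
  then have "w = []" by auto
  then show ?case by (auto intro: exI[of _ 1])
next
  case (alg_add x y)
  then show ?case by (metis sc_add)
next
  case (alg_sc x c)
  then show ?case by (metis sc_sc)
qed

text \<open>With positions counted from 0, \<open>alg {..<n}\<close> is the image of the algebra on
  \<open>n + 1\<close> strands, and this set lives on \<open>n + 2\<close> strands.\<close>

inductive_set bim :: "nat \<Rightarrow> ('n, 'n falg) chain set" for n where
  bim_V: "x \<in> alg {..<n} \<Longrightarrow> x \<in> bim n"
| bim_R: "a \<in> alg {..<n} \<Longrightarrow> b \<in> alg {..<n} \<Longrightarrow> a * r n * b \<in> bim n"
| bim_K: "a \<in> alg {..<n} \<Longrightarrow> b \<in> alg {..<n} \<Longrightarrow> a * K n * b \<in> bim n"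
| bim_add: "x \<in> bim n \<Longrightarrow> y \<in> bim n \<Longrightarrow> x + y \<in> bim n"
| bim_sc: "x \<in> bim n \<Longrightarrow> sc c * x \<in> bim n"

lemma bim_right: "x \<in> bim n \<Longrightarrow> y \<in> alg {..<n} \<Longrightarrow> x * y \<in> bim n"
proof (induction rule: bim.induct)
  case (bim_R a b)
  then show ?case using bim.bim_R[of a n "b * y"] by (simp add: mult.assoc alg_mult)
next
  case (bim_K a b)
  then show ?case using bim.bim_K[of a n "b * y"] by (simp add: mult.assoc alg_mult)
qed (auto simp: distrib_right mult.assoc intro: bim.intros alg_mult)

lemma bim_left: "x \<in> bim n \<Longrightarrow> y \<in> alg {..<n} \<Longrightarrow> y * x \<in> bim n"
proof (induction rule: bim.induct)
  case (bim_R a b)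
  then show ?case using bim.bim_R[of "y * a" n b] by (simp add: mult.assoc alg_mult)
next
  case (bim_K a b)
  then show ?case using bim.bim_K[of "y * a" n b] by (simp add: mult.assoc alg_mult)
qed (auto simp: distrib_left sc_left_commute intro: bim.intros alg_mult)

lemma bim_diff: "x \<in> bim n \<Longrightarrow> y \<in> bim n \<Longrightarrow> x - y \<in> bim n"
  using bim_add[of x n "sc (- 1) * y"] bim_sc[of y n "- 1"] by (simp add: sc_uminus)

lemma bim_r: "r n \<in> bim n" and bim_K': "K n \<in> bim n" and bim_1: "1 \<in> bim n"
  using bim_R[of 1 n 1] bim_K[of 1 n 1] bim_V[of 1 n] by (simp_all add: alg_1)

lemma bim_r_r: "r n * r n \<in> bim n"
  unfolding r_square by (intro bim_diff bim_add bim_sc bim_1 bim_r bim_K')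

text \<open>An element of \<open>alg {..<n}\<close> between two factors commuting with \<open>alg {..<n - 1}\<close> can be replaced
  by a generator of position \<open>n - 1\<close>, which leaves words in three neighbouring strands.\<close>

lemma sandwich:
  assumes b: "b \<in> alg {..<n}" and IH: "n \<noteq> 0 \<Longrightarrow> alg {..<n} \<subseteq> bim (n - 1)"
    and com: "\<And>x. x \<in> alg {..<n - 1} \<Longrightarrow> x * X = X * x \<and> x * Y = Y * x"
    and S: "\<And>x y. x \<in> S \<Longrightarrow> y \<in> S \<Longrightarrow> x + y \<in> S" "\<And>x c. x \<in> S \<Longrightarrow> sc c * x \<in> S"
      "\<And>a e. a \<in> alg {..<n - 1} \<Longrightarrow> e \<in> alg {..<n - 1} \<Longrightarrow> a * (X * Y) * e \<in> S"
      "\<And>m a e t. n = Suc m \<Longrightarrow> a \<in> alg {..<m} \<Longrightarrow> e \<in> alg {..<m} \<Longrightarrow> t = r m \<or> t = K m \<Longrightarrow>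
        a * (X * t * Y) * e \<in> S"
  shows "X * b * Y \<in> S"
proof (cases n)
  case 0
  then obtain c where c: "b = sc c" using alg_empty b by auto
  show ?thesis
    using S(2)[OF S(3)[OF alg_1 alg_1], of c] by (simp add: c sc_central[of X] mult.assoc)
next
  case (Suc m)
  have com': "x * X = X * x" "x * Y = Y * x" if "x \<in> alg {..<m}" for x
    using com[of x] that Suc by auto
  have move: "X * (a * t * e) * Y = a * (X * t * Y) * e" if "a \<in> alg {..<m}" "e \<in> alg {..<m}" for a t e
  proof -
    have "X * (a * t * e) * Y = (X * a) * t * (e * Y)" by (simp only: mult.assoc)
    then show ?thesis
      by (simp only: com'(1)[OF that(1), symmetric] com'(2)[OF that(2)] mult.assoc)
  qed
  have "b \<in> bim m" using IH b Suc by auto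
  then show ?thesis
  proof (induction rule: bim.induct)
    case (bim_V x)
    then show ?case using move[OF _ alg_1, of x 1] S(3)[OF _ alg_1, of x] by (simp add: Suc)
  next
    case (bim_R a e)
    then show ?case using S(4)[OF Suc] by (simp add: move)
  next
    case (bim_K a e)
    then show ?case using S(4)[OF Suc] by (simp add: move)
  qed (auto simp: distrib_left distrib_right sc_left_commute[of X] mult.assoc intro: S(1,2))
qed

text \<open>By \<open>sandwich\<close> only words in the positions \<open>n - 1\<close> and
  \<open>n\<close> remain, and the three-strand relations rewrite these with at most one generator
  of position \<open>n\<close>.\<close>

lemma bim_absorb:
  assumes IH: "n \<noteq> 0 \<Longrightarrow> alg {..<n} \<subseteq> bim (n - 1)" and b: "b \<in> alg {..<n}"
  shows "r n * b * r n \<in> bim n" and "K n * b * r n \<in> bim n"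
proof -
  have com: "x * r n = r n * x" "x * K n = K n * x" if "x \<in> alg {..<n - 1}" for x
    using that by (auto intro!: alg_commute_K)
  have mn: "x \<in> alg {..<n}" if "x \<in> alg {..<n - 1}" for x
    using that by (rule alg_mono) auto
  have gen: "r m \<in> alg {..<n}" "r' m \<in> alg {..<n}" "K m \<in> alg {..<n}" if "n = Suc m" for m
    by (auto simp: that intro!: alg_intros)
  have both: "a * x * e \<in> bim n" if "a \<in> alg {..<n - 1}" "e \<in> alg {..<n - 1}" "x \<in> bim n" for a e x
    by (intro bim_right bim_left that mn)
  show "r n * b * r n \<in> bim n"
  proof (rule sandwich[OF b IH])
    fix m a e t assume n: "n = Suc m" and ae: "a \<in> alg {..<m}" "e \<in> alg {..<m}" and t: "t = r m \<or> t = K m"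
    have "r n * r m * r n = r m * r n * r m" "r n * K m * r n = r' m * K n * r' m"
      by (simp_all only: n braid_r rKr)
    moreover have "r m * r n * r m \<in> bim n" "r' m * K n * r' m \<in> bim n"
      by (rule bim_R[OF gen(1)[OF n] gen(1)[OF n]], rule bim_K[OF gen(2)[OF n] gen(2)[OF n]])
    ultimately have "r n * t * r n \<in> bim n" using t by metis
    then show "a * (r n * t * r n) * e \<in> bim n" using both[of a e] ae n by simp
  qed (auto intro: bim_add bim_sc both bim_r_r com)
  show "K n * b * r n \<in> bim n"
  proof (rule sandwich[OF b IH])
    show "a * (K n * r n) * e \<in> bim n" if "a \<in> alg {..<n - 1}" "e \<in> alg {..<n - 1}" for a e
      using both[OF that bim_sc[OF bim_K']] by (simp only: K_r)
    fix m a e t assume n: "n = Suc m" and ae: "a \<in> alg {..<m}" "e \<in> alg {..<m}" and t: "t = r m \<or> t = K m"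
    have "K n * r m * r n = 1 * K n * K m"
      by (simp only: n K_K_right mult_1_left)
    moreover have "K n * K m * r n = 1 * K n * r' m"
      by (simp only: n KKr mult_1_left)
    moreover have "1 * K n * K m \<in> bim n" "1 * K n * r' m \<in> bim n"
      by (rule bim_K[OF alg_1 gen(3)[OF n]], rule bim_K[OF alg_1 gen(2)[OF n]])
    ultimately have "K n * t * r n \<in> bim n" using t by metis
    then show "a * (K n * t * r n) * e \<in> bim n" using both[of a e] ae n by simp
  qed (auto intro: bim_add bim_sc com)
qed

text \<open>Right multiplication by \<open>r n\<close> is the case that needs
  \<open>bim_absorb\<close>: \<open>K n\<close> is a polynomial in \<open>r n\<close>, and
  \<open>r' n\<close> is a combination of \<open>r n\<close>, 1 and \<open>K n\<close>.\<close>

lemma bim_closed: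
  assumes IH: "n \<noteq> 0 \<Longrightarrow> alg {..<n} \<subseteq> bim (n - 1)"
  shows "alg {..<Suc n} \<subseteq> bim n"
proof
  have r_closed: "x * r n \<in> bim n" if "x \<in> bim n" for x
    using that
  proof (induction rule: bim.induct)
    case (bim_V x)
    then show ?case using bim.bim_R[of x n 1] by (simp add: alg_1)
  next
    case (bim_R a b)
    then show ?case using bim_left[OF bim_absorb(1)[OF IH, of b], of a] by (simp add: mult.assoc)
  next
    case (bim_K a b)
    then show ?case using bim_left[OF bim_absorb(2)[OF IH, of b], of a] by (simp add: mult.assoc)
  qed (auto simp: distrib_right mult.assoc intro: bim_add bim_sc)
  have K_closed: "x * K n \<in> bim n" if "x \<in> bim n" for x
  proof -
    have "x * K n = sc c0 * (x + sc \<delta> * (x * r n) - x * r n * r n)"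
      by (simp add: K_poly sc_left_commute[of x] sc_central[of x] distrib_left right_diff_distrib mult.assoc)
    then show ?thesis by (simp add: that r_closed bim_add bim_diff bim_sc)
  qed
  have r'_closed: "x * r' n \<in> bim n" if "x \<in> bim n" for x
  proof -
    have "x * r' n = x * r n - sc \<delta> * x + sc \<delta> * (x * K n)"
      by (simp add: r'_poly sc_left_commute[of x] distrib_left right_diff_distrib sc_central[of x])
    then show ?thesis by (simp add: that r_closed K_closed bim_add bim_diff bim_sc)
  qed
  fix x assume "x \<in> alg {..<Suc n}"
  then show "x \<in> bim n"
  proof (induction rule: alg.induct)
    case (alg_word w)
    then show ?case
    proof (induction w rule: rev_induct)
      case Nil
      show ?case by (simp add: bim_1)
    next
      case (snoc l w)
      obtain j e where l: "l = (j, e)" by (cases l)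
      have w: "rw w \<in> bim n" and j: "j < Suc n" using snoc by (auto simp: l)
      show ?case
      proof (cases "j = n")
        case True
        then show ?thesis using w r_closed r'_closed by (cases e) (auto simp: rw_append rw_Cons l)
      next
        case False
        then have "letter l \<in> alg {..<n}" using j by (cases e) (auto simp: l intro: alg_r alg_r')
        then show ?thesis using bim_right[OF w] by (simp add: rw_append rw_Cons)
      qed
    qed
  qed (auto intro: bim_add bim_sc)
qed

lemma alg_bim: "alg {..<Suc n} \<subseteq> bim n"
proof (induction n)
  case 0
  show ?case by (rule bim_closed) simp
next
  case (Suc n)
  then show ?case by (intro bim_closed) simp
qed

lemma alg_bim': "n \<noteq> 0 \<Longrightarrow> alg {..<n} \<subseteq> bim (n - 1)"
  using alg_bim[of "n - 1"] by simp

section \<open>Words next to the last contractor\<close>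

definition Kmod :: "nat set \<Rightarrow> nat \<Rightarrow> ('n, 'n falg) chain set" where
  "Kmod A n = (\<lambda>z. z * K n) ` alg A"

lemma Kmod_add: "x \<in> Kmod A n \<Longrightarrow> y \<in> Kmod A n \<Longrightarrow> x + y \<in> Kmod A n"
  by (auto simp: Kmod_def distrib_right[symmetric] intro: alg_add)

lemma Kmod_left: "z \<in> alg A \<Longrightarrow> x \<in> Kmod A n \<Longrightarrow> z * x \<in> Kmod A n"
  by (auto simp: Kmod_def mult.assoc[symmetric] intro: alg_mult)

lemma Kmod_sc: "x \<in> Kmod A n \<Longrightarrow> sc c * x \<in> Kmod A n"
  by (rule Kmod_left[OF alg_sc'])

lemma Kmod_diff: "x \<in> Kmod A n \<Longrightarrow> y \<in> Kmod A n \<Longrightarrow> x - y \<in> Kmod A n"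
  using Kmod_add[of x A n "sc (- 1) * y"] Kmod_sc[of y A n "- 1"] by (simp add: sc_uminus)

lemma Kmod_mono: "x \<in> Kmod A n \<Longrightarrow> A \<subseteq> A' \<Longrightarrow> x \<in> Kmod A' n"
  by (auto simp: Kmod_def intro: alg_mono)

lemma Kmod_both:
  assumes "a \<in> alg A" "e \<in> alg A" "z \<in> alg A" "e * K n = K n * e"
  shows "a * (z * K n) * e \<in> Kmod A n"
proof -
  have "a * (z * K n) * e = (a * z * e) * K n"
    by (simp only: mult.assoc assms(4))
  then show ?thesis using assms by (auto simp: Kmod_def intro!: alg_mult)
qed

text \<open>Between the two contractors \<open>sandwich\<close> leaves nothing,
  \<open>r (n - 1)\<close> or \<open>K (n - 1)\<close>, and each of these three products is a scalar
  multiple of \<open>K n\<close>.\<close>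

lemma K_alg_K:
  assumes "y \<in> alg {..<n}"
  shows "K n * y * K n \<in> Kmod {..<n - 1} n"
proof (rule sandwich[OF assms alg_bim'])
  have com: "x * K n = K n * x" if "x \<in> alg {..<n - 1}" for x
    using that by (auto intro!: alg_commute_K)
  then show "x * K n = K n * x \<and> x * K n = K n * x" if "x \<in> alg {..<n - 1}" for x
    using that by simp
  show "a * (K n * K n) * e \<in> Kmod {..<n - 1} n" if "a \<in> alg {..<n - 1}" "e \<in> alg {..<n - 1}" for a e
    unfolding K_K using that com by (intro Kmod_both alg_sc')
  fix m a e t assume n: "n = Suc m" and ae: "a \<in> alg {..<m}" "e \<in> alg {..<m}" and t: "t = r m \<or> t = K m"
  have "K n * r m * K n = sc (inverse \<mu>) * K n" "K n * K m * K n = sc 1 * K n"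
    by (simp_all add: n KrK K_rel3')
  moreover have "a * (sc c * K n) * e \<in> Kmod {..<n - 1} n" for c
    using ae com n by (intro Kmod_both alg_sc') simp_all
  ultimately show "a * (K n * t * K n) * e \<in> Kmod {..<n - 1} n"
    using t by metis
qed (auto intro: Kmod_add Kmod_sc)

lemma r_alg_K:
  assumes "y \<in> alg {..<n}"
  shows "r n * y * K n \<in> Kmod {..<n} n"
proof (rule sandwich[OF assms alg_bim'])
  have com: "x * r n = r n * x" "x * K n = K n * x" if "x \<in> alg {..<n - 1}" for x
    using that by (auto intro!: alg_commute_K)
  then show "x * r n = r n * x \<and> x * K n = K n * x" if "x \<in> alg {..<n - 1}" for x
    using that by simp
  have mn: "x \<in> alg {..<n}" if "x \<in> alg {..<n - 1}" for x
    using that by (rule alg_mono) auto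
  show "a * (r n * K n) * e \<in> Kmod {..<n} n" if "a \<in> alg {..<n - 1}" "e \<in> alg {..<n - 1}" for a e
    unfolding r_K using that com mn by (intro Kmod_both alg_sc') auto
  fix m a e t assume n: "n = Suc m" and ae: "a \<in> alg {..<m}" "e \<in> alg {..<m}" and t: "t = r m \<or> t = K m"
  have "r n * r m * K n = K m * K n" "r n * K m * K n = r' m * K n"
    by (simp_all only: n K_rel1' rKK)
  moreover have "K m \<in> alg {..<n}" "r' m \<in> alg {..<n}"
    by (auto simp: n intro: alg_K alg_r')
  then have "a * (K m * K n) * e \<in> Kmod {..<n} n" "a * (r' m * K n) * e \<in> Kmod {..<n} n"
    using ae com mn n by (auto intro!: Kmod_both)
  ultimately show "a * (r n * t * K n) * e \<in> Kmod {..<n} n"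
    using t by metis
qed (auto intro: Kmod_add Kmod_sc)

text \<open>Read the word from the right: letters below position \<open>n\<close> join the
  coefficient, \<open>r n\<close> is absorbed by \<open>r_alg_K\<close>, and its inverse reduces to
  \<open>r n\<close>, 1 and \<open>K n\<close>.\<close>

lemma alg_Suc_K:
  assumes "x \<in> alg {..<Suc n}"
  shows "x * K n \<in> Kmod {..<n} n"
  using assms
proof (induction rule: alg.induct)
  case (alg_word w)
  then show ?case
  proof (induction w)
    case Nil
    then show ?case using alg_1 by (auto simp: Kmod_def intro: image_eqI[of _ _ 1])
  next
    case (Cons l w)
    obtain j e where l: "l = (j, e)" by (cases l)
    have w: "rw w * K n \<in> Kmod {..<n} n" using Cons by auto
    then obtain y where y: "y \<in> alg {..<n}" "rw w * K n = y * K n" by (auto simp: Kmod_def)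
    have "letter l * (rw w * K n) \<in> Kmod {..<n} n"
    proof (cases "j = n")
      case False
      then show ?thesis
        using Cons.prems w by (cases e) (auto simp: l intro!: Kmod_left alg_r alg_r')
    next
      case True
      have K_y: "K n * y * K n \<in> Kmod {..<n} n"
        by (rule Kmod_mono[OF K_alg_K[OF y(1)]]) auto
      have "r' n * (y * K n) = r n * y * K n - sc \<delta> * (y * K n) + sc \<delta> * (K n * y * K n)"
        by (simp add: r'_poly left_diff_distrib distrib_right mult.assoc)
      then have "r' n * (y * K n) \<in> Kmod {..<n} n"
        using w y(2) by (auto intro: Kmod_add Kmod_diff Kmod_sc r_alg_K[OF y(1)] K_y)
      then show ?thesis
        using r_alg_K[OF y(1)] True unfolding y(2) by (cases e) (simp_all add: l mult.assoc)
    qed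
    then show ?case by (simp add: rw_Cons mult.assoc)
  qed
qed (auto simp: distrib_right mult.assoc intro: Kmod_add Kmod_sc)

lemma K_alg_Suc_K:
  assumes "x \<in> alg {..<Suc n}"
  shows "\<exists>z\<in>alg {..<n - 1}. K n * x * K n = z * K n"
proof -
  obtain y where y: "y \<in> alg {..<n}" "x * K n = y * K n"
    using alg_Suc_K[OF assms] by (auto simp: Kmod_def)
  have "K n * x * K n = K n * y * K n" by (simp only: mult.assoc y(2))
  then show ?thesis using K_alg_K[OF y(1)] by (auto simp: Kmod_def)
qed

end

section \<open>Spanning the characteristic subalgebra\<close>

context bmw_setup
begin

lemma alg_cyclic:
  assumes "y \<in> alg {i. Suc i < N}" and "local N x"
  shows "T N (x * y) - T N (y * x) \<in> qma_ideal R F"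
  using assms(1)
proof (induction rule: alg.induct)
  case (alg_word w)
  then have "w \<in> braid_words N" by (force simp: braid_words_def)
  then show ?case using T_cyclic assms(2) by blast
next
  case (alg_add y z)
  have "T N (x * (y + z)) - T N ((y + z) * x) = (T N (x * y) - T N (y * x)) + (T N (x * z) - T N (z * x))"
    by (simp add: distrib_left distrib_right T_add)
  then show ?case using alg_add by (simp add: ideal_add)
next
  case (alg_sc y c)
  have "T N (x * (sc c * y)) - T N (sc c * y * x) = scal c * (T N (x * y) - T N (y * x))"
    by (simp add: sc_left_commute[of x] mult.assoc T_sc right_diff_distrib)
  then show ?case using alg_sc by (simp add: ideal_mult_left)
qed

lemma local_embo_lm: "local n x \<Longrightarrow> local n (lm c * x)"
  unfolding local_def by (metis embo_lm)

lemma local_add: "local n x \<Longrightarrow> local n y \<Longrightarrow> local n (x + y)"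
proof -
  assume "local n x" "local n y"
  then obtain A B where "x = embo 0 n A" "y = embo 0 n B" by (auto simp: local_def)
  then have "x + y = embo 0 n (\<lambda>xs ys. A xs ys + B xs ys)"
    by (auto intro!: endo_eqI simp: app_embo app_simps distrib_right sum.distrib)
  then show ?thesis by (auto simp: local_def)
qed

lemma alg_local: "x \<in> alg {i. Suc i < N} \<Longrightarrow> local N x"
proof (induction rule: alg.induct)
  case (alg_word w)
  then have "w \<in> braid_words N" by (force simp: braid_words_def)
  then show ?case by (rule local_rw)
qed (auto intro: local_add local_embo_lm)

lemma scal_left_commute: "x * (scal c * y) = scal c * (x * (y :: 'n falg))"
  by (metis mult.assoc scal_central)

lemma T_alg_word_mult:
  assumes "x \<in> alg {i. Suc i < m}" and v: "v \<in> braid_words n"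
  shows "T (m + n) (x * rw (shift_word m v)) = T m x * T n (rw v)"
  using assms(1)
proof (induction rule: alg.induct)
  case (alg_word w)
  then have "w \<in> braid_words m" by (force simp: braid_words_def)
  then show ?case using v by (rule T_mult)
qed (simp_all add: distrib_right mult.assoc T_add T_sc)

lemma T_alg_mult:
  assumes "y \<in> alg {i. m \<le> i \<and> Suc i < m + n}"
  shows "\<exists>z\<in>alg {i. Suc i < n}. \<forall>x\<in>alg {i. Suc i < m}. T (m + n) (x * y) = T m x * T n z"
  using assms
proof (induction rule: alg.induct)
  case (alg_word w)
  define v where "v = map (\<lambda>(j, e). (j - m, e)) w"
  have w: "w = shift_word m v"
    using alg_word by (force simp: v_def shift_word_def intro!: map_idI[symmetric])
  have "\<forall>(j, e)\<in>set w. m \<le> j \<and> Suc j < m + n"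
    using alg_word by force
  then have v: "v \<in> braid_words n"
    by (fastforce simp: v_def braid_words_def)
  then have "rw v \<in> alg {i. Suc i < n}"
    by (intro alg.alg_word) (auto dest: braid_wordsD)
  then show ?case
    using T_alg_word_mult[OF _ v] by (auto simp: w)
next
  case (alg_add y y')
  then obtain z z' where z: "z \<in> alg {i. Suc i < n}" "z' \<in> alg {i. Suc i < n}"
    "\<forall>x\<in>alg {i. Suc i < m}. T (m + n) (x * y) = T m x * T n z"
    "\<forall>x\<in>alg {i. Suc i < m}. T (m + n) (x * y') = T m x * T n z'"
    by auto
  then show ?case
    by (intro bexI[of _ "z + z'"]) (simp_all add: distrib_left T_add alg.alg_add)
next
  case (alg_sc y c)
  then obtain z where z: "z \<in> alg {i. Suc i < n}"
    "\<forall>x\<in>alg {i. Suc i < m}. T (m + n) (x * y) = T m x * T n z"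
    by auto
  then show ?case
    by (intro bexI[of _ "sc c * z"])
      (simp_all add: sc_left_commute[of "_ :: ('n, 'n falg) chain" c y] T_sc scal_left_commute alg.alg_sc)
qed

text \<open>The contractor is a combination of the words 1, \<open>r n\<close> and
  \<open>r n * r n\<close>, to which \<open>T_alg_word_mult\<close> applies.\<close>

lemma T_mult_K:
  assumes z: "z \<in> alg {i. Suc i < n}"
  shows "T (n + 2) (z * K n) = T n z * T 2 (K 0)"
proof -
  have w: "T (n + 2) (z * rw (shift_word n v)) = T n z * T 2 (rw v)" if "v \<in> braid_words 2" for v
    by (rule T_alg_word_mult[OF z that])
  have 1: "T (n + 2) z = T n z * T 2 1"
    using w[of "[]"] by (simp add: braid_words_def shift_word_def)
  have 2: "T (n + 2) (z * r n) = T n z * T 2 (r 0)"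
    using w[of "[(0, True)]"] by (simp add: braid_words_def shift_word_def rw_Cons)
  have 3: "T (n + 2) (z * (r n * r n)) = T n z * T 2 (r 0 * r 0)"
    using w[of "[(0, True), (0, True)]"] by (simp add: braid_words_def shift_word_def rw_Cons)
  define u :: "nat \<Rightarrow> ('n, 'n falg) chain" where "u i = 1 + sc \<delta> * r i - r i * r i" for i
  have "T (n + 2) (z * u n) + T (n + 2) (z * (r n * r n)) = T (n + 2) (z + sc \<delta> * (z * r n))"
    unfolding T_add[symmetric] by (simp add: u_def sc_left_commute[of z] distrib_left right_diff_distrib)
  also have "\<dots> = T n z * T 2 (1 + sc \<delta> * r 0)"
    by (simp only: T_add T_sc 1 2 scal_left_commute[of "T n z"] distrib_left)
  also have "1 + sc \<delta> * r 0 = u 0 + r 0 * r 0"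
    by (simp add: u_def)
  finally have "T (n + 2) (z * u n) = T n z * T 2 (u 0)"
    by (simp only: 3 T_add distrib_left add_right_cancel)
  moreover have "K i = sc c0 * u i" for i
    by (simp add: K_poly u_def)
  ultimately show ?thesis
    by (simp add: sc_left_commute[of z] T_sc scal_left_commute[of "T n z"])
qed

end

text \<open>Later \<open>B\<close> is the preimage of a subalgebra of the quantum matrix algebra, so
  that \<open>T N x \<in> B\<close> says that the corresponding character lies in this
  subalgebra.\<close>

locale bmw_sub = bmw_setup R F q \<mu> for R F :: "'n::finite mat2" and q \<mu> +
  fixes B :: "'n falg set"
  assumes B_ideal: "qma_ideal R F \<subseteq> B"
    and B_add: "x \<in> B \<Longrightarrow> y \<in> B \<Longrightarrow> x + y \<in> B"
    and B_mult: "x \<in> B \<Longrightarrow> y \<in> B \<Longrightarrow> x * y \<in> B"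
    and B_scal: "scal c \<in> B"
begin

abbreviation W :: "nat \<Rightarrow> ('n, 'n falg) chain set" where
  "W N \<equiv> alg {i. Suc i < N}"

lemma W_Suc: "W (Suc n) = alg {..<n}"
  by (rule arg_cong[where f = alg]) auto

section \<open>Traces with values in a fixed subalgebra\<close>

lemma B_smult: "x \<in> B \<Longrightarrow> scal c * x \<in> B"
  by (simp add: B_mult B_scal)

lemma B_uminus: "x \<in> B \<Longrightarrow> - x \<in> B"
  using B_smult[of x "- 1"] by (simp add: scal_uminus)

lemma B_diff: "x \<in> B \<Longrightarrow> y \<in> B \<Longrightarrow> x - y \<in> B"
  using B_add[of x "- y"] B_uminus by simp

lemma B_cancel: "c \<noteq> 0 \<Longrightarrow> scal c * x \<in> B \<Longrightarrow> x \<in> B"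
  using B_smult[of "scal c * x" "inverse c"] by (simp add: scal_mult[symmetric] flip: mult.assoc)

lemma T_diff: "T N (x - y) = T N x - T N y"
  using T_add[of N "x - y" y] by simp

lemma B_cyclic:
  assumes "x \<in> W N" "y \<in> W N"
  shows "T N (x * y) \<in> B \<longleftrightarrow> T N (y * x) \<in> B"
proof -
  have "T N (x * y) - T N (y * x) \<in> B" "T N (y * x) - T N (x * y) \<in> B"
    using alg_cyclic assms alg_local B_ideal by blast+
  then show ?thesis
    by (metis B_add diff_add_cancel)
qed

definition good :: "nat \<Rightarrow> bool" where
  "good N \<longleftrightarrow> (\<forall>x\<in>W N. T N x \<in> B)"

lemma good_0: "good 0"
proof -
  have "T 0 (sc c) \<in> B" for c
    by (simp add: T_def D_prod_def M_prod_def tr_0_lm B_scal)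
  then show ?thesis
    unfolding good_def using alg_empty by auto
qed

lemma good_split:
  assumes "good m" "good n" "x \<in> W m" "y \<in> alg {i. m \<le> i \<and> Suc i < m + n}"
  shows "T (m + n) (x * y) \<in> B"
  using T_alg_mult[OF assms(4)] assms(1-3) by (auto simp: good_def B_mult)

text \<open>At the last position \<open>K n * K n\<close> is a nonzero multiple of
  \<open>K n\<close>, so cyclicity replaces \<open>x * K n\<close> by
  \<open>K n * x * K n = z * K n\<close> with \<open>z\<close> on two strands less, and the trace of
  \<open>K 0\<close> splits off. Lower positions are conjugate to the last one, whence the downward
  induction.\<close>

lemma good_K:
  assumes less: "\<And>M. M < N \<Longrightarrow> good M" and g: "T 2 (K 0) \<in> B"
    and x: "x \<in> W N" and i: "Suc i < N"
  shows "T N (x * K i) \<in> B"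
proof -
  obtain n where N: "N = Suc (Suc n)"
    using i by (metis Suc_lessE less_imp_Suc_add)
  have mem: "K j \<in> W N" "r j \<in> W N" "r' j \<in> W N" if "j \<le> n" for j
    using that by (auto simp: N intro!: alg_intros)
  have "i \<le> n" using i N by simp
  then show ?thesis
    using x
  proof (induction arbitrary: x rule: inc_induct)
    case base
    obtain z where z: "z \<in> W n" "K n * x * K n = z * K n"
    proof -
      have "x \<in> alg {..<Suc n}" using base W_Suc[of "Suc n"] N by simp
      moreover have "{..<n - 1} = {i. Suc i < n}" by auto
      ultimately show ?thesis using K_alg_Suc_K[of x n] that by auto
    qed
    have "T N (K n * (x * K n)) \<in> B"
      using T_mult_K[OF z(1)] less[of n] z g by (simp add: N good_def B_mult mult.assoc)
    then have "T N (x * K n * K n) \<in> B"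
      using B_cyclic[of "K n" N "x * K n"] base mem[of n] by (simp add: alg_mult)
    then have "scal (eta q \<mu>) * T N (x * K n) \<in> B"
      by (simp add: mult.assoc K_K sc_left_commute[of x] T_sc)
    then show ?case using B_cancel eta_nz by blast
  next
    case (step j)
    let ?p = "r j * r (Suc j)" and ?p' = "r' (Suc j) * r' j"
    have "?p * r j = r (Suc j) * ?p"
      using braid_r[of j] by (simp only: mult.assoc)
    then have pK: "?p * K j = K (Suc j) * ?p"
      by (rule K_intertwine)
    have p: "?p \<in> W N" "?p' \<in> W N"
      using step.hyps by (auto intro!: alg_mult mem)
    have "?p' * ?p = 1" by (simp add: mult.assoc)
    then have "x * K j = x * (?p' * ?p * K j)" by simp
    also have "\<dots> = (x * ?p' * K (Suc j)) * ?p"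
      by (simp only: mult.assoc pK[unfolded mult.assoc])
    finally have xK: "x * K j = (x * ?p' * K (Suc j)) * ?p" .
    have "T N (?p * x * ?p' * K (Suc j)) \<in> B"
      by (rule step.IH) (intro alg_mult step.prems p)
    then have "T N (?p * (x * ?p' * K (Suc j))) \<in> B"
      by (simp only: mult.assoc)
    moreover have "x * ?p' * K (Suc j) \<in> W N"
      using step.hyps by (intro alg_mult step.prems p mem) simp
    ultimately show ?case
      unfolding xK using B_cyclic p(1) by blast
  qed
qed

text \<open>\<open>desc 0 n\<close> is the string
  \<open>\<sigma>\<^sub>n \<dots> \<sigma>\<^sub>1\<close>, whose character is the power sum on
  \<open>n + 1\<close> strands.\<close>

definition desc :: "nat \<Rightarrow> nat \<Rightarrow> ('n, 'n falg) chain" where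
  "desc m n = prod_list (map r (rev [m..<n]))"

lemma desc_refl [simp]: "desc n n = 1"
  by (simp add: desc_def)

lemma desc_Suc: "m < n \<Longrightarrow> desc m n = desc (Suc m) n * r m"
  by (simp add: desc_def upt_conv_Cons)

lemma desc_Suc_top: "m \<le> n \<Longrightarrow> desc m (Suc n) = r n * desc m n"
  by (simp add: desc_def)

lemma alg_desc: "{m..<n} \<subseteq> A \<Longrightarrow> desc m n \<in> alg A"
  unfolding desc_def by (rule alg_prod_list) (auto intro: alg_r)

lemma good_Suc:
  assumes less: "\<And>M. M \<le> n \<Longrightarrow> good M" and g: "T 2 (K 0) \<in> B"
    and p: "T (Suc n) (desc 0 n) \<in> B"
  shows "good (Suc n)"
proof -
  let ?N = "Suc n"
  \<comment> \<open>This claim interpolates between the power sum (\<open>m = 0\<close>) and an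
    arbitrary element (\<open>m = n\<close>). Write \<open>x\<close> in normal form with respect to
    position \<open>m\<close>: a term without that generator decomposes, \<open>K m\<close> is
    covered by \<open>good_K\<close>, and \<open>r m\<close> lengthens the string, which lowers
    \<open>m\<close>.\<close>
  have "T ?N (desc m n * x) \<in> B" if "m \<le> n" "x \<in> alg {..<m}" for m x
    using that
  proof (induction m arbitrary: x)
    case 0
    then obtain c where "x = sc c" using alg_empty by auto
    then show ?case using p by (simp add: sc_central[of "desc 0 n"] T_sc B_smult)
  next
    case (Suc m)
    have W: "y \<in> W ?N" if "y \<in> alg {..<m}" for y
      using that Suc.prems by (elim alg_mono) auto
    have D: "desc (Suc m) n \<in> W ?N" "desc m n \<in> W ?N"
      by (auto intro!: alg_desc)
    have gens: "r m \<in> W ?N" "K m \<in> W ?N"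
      using Suc.prems by (auto intro!: alg_intros)
    have D': "desc (Suc m) n \<in> alg {Suc m..<n}"
      by (auto intro!: alg_desc)
    have com: "desc (Suc m) n * a = a * desc (Suc m) n" if "a \<in> alg {..<m}" for a
      by (rule alg_commute[OF that D']) auto
    have "x \<in> bim m" using Suc.prems alg_bim by auto
    then show ?case
    proof (induction rule: bim.induct)
      case (bim_V x)
      have "T (Suc m + (n - m)) (x * desc (Suc m) n) \<in> B"
      proof (rule good_split)
        show "good (Suc m)" "good (n - m)"
          using Suc.prems by (auto intro: less)
        show "x \<in> W (Suc m)" using bim_V by (simp only: W_Suc)
        show "desc (Suc m) n \<in> alg {i. Suc m \<le> i \<and> Suc i < Suc m + (n - m)}"
          using Suc.prems by (auto intro!: alg_desc)
      qed
      then show ?case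
        using B_cyclic[OF D(1) W[OF bim_V]] Suc.prems by simp
    next
      case (bim_R a b)
      have "desc (Suc m) n * (a * r m * b) = (desc (Suc m) n * a) * (r m * b)"
        by (simp only: mult.assoc)
      also have "\<dots> = a * (desc m n * b)"
        unfolding com[OF bim_R(1)] using Suc.prems by (simp add: desc_Suc[of m n] mult.assoc)
      finally have eq: "desc (Suc m) n * (a * r m * b) = a * (desc m n * b)" .
      have "T ?N (desc m n * (b * a)) \<in> B"
        using Suc.IH[of "b * a"] bim_R Suc.prems by (simp add: alg_mult)
      then have "T ?N (desc m n * b * a) \<in> B"
        by (simp only: mult.assoc)
      moreover have "desc m n * b \<in> W ?N"
        by (intro alg_mult D W bim_R)
      ultimately show ?case
        unfolding eq using B_cyclic W[OF bim_R(1)] by blast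
    next
      case (bim_K a b)
      have "T ?N (b * desc (Suc m) n * a * K m) \<in> B"
        by (rule good_K) (use less g bim_K W D Suc.prems in \<open>auto intro!: alg_mult\<close>)
      moreover have "desc (Suc m) n * (a * K m * b) = (desc (Suc m) n * a * K m) * b"
        by (simp only: mult.assoc)
      ultimately show ?case
        using B_cyclic[of "desc (Suc m) n * a * K m" ?N b] bim_K W D gens
        by (simp add: alg_mult mult.assoc)
    next
      case (bim_add x y)
      then show ?case by (simp add: distrib_left T_add B_add)
    next
      case (bim_sc x c)
      then show ?case by (simp add: sc_left_commute[of "desc (Suc m) n"] T_sc B_smult)
    qed
  qed
  from this[of n] show ?thesis
    unfolding good_def W_Suc by simp
qed

end

section \<open>Antisymmetrizers modulo the ideal of the contractors\<close>

context bmw_sub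
begin

section \<open>Congruence modulo the contractors\<close>

inductive_set K_ideal :: "nat \<Rightarrow> ('n, 'n falg) chain set" for N where
  K_ideal_0: "0 \<in> K_ideal N"
| K_ideal_K: "a \<in> W N \<Longrightarrow> b \<in> W N \<Longrightarrow> Suc i < N \<Longrightarrow> a * K i * b \<in> K_ideal N"
| K_ideal_add: "x \<in> K_ideal N \<Longrightarrow> y \<in> K_ideal N \<Longrightarrow> x + y \<in> K_ideal N"

lemma K_ideal_left: "x \<in> K_ideal N \<Longrightarrow> y \<in> W N \<Longrightarrow> y * x \<in> K_ideal N"
proof (induction rule: K_ideal.induct)
  case (K_ideal_K a b i)
  then show ?case using K_ideal.K_ideal_K[of "y * a" N b i] by (simp add: mult.assoc alg_mult)
qed (auto simp: distrib_left intro: K_ideal.intros)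

lemma K_ideal_right: "x \<in> K_ideal N \<Longrightarrow> y \<in> W N \<Longrightarrow> x * y \<in> K_ideal N"
proof (induction rule: K_ideal.induct)
  case (K_ideal_K a b i)
  then show ?case using K_ideal.K_ideal_K[of a N "b * y" i] by (simp add: mult.assoc alg_mult)
qed (auto simp: distrib_right intro: K_ideal.intros)

lemma K_ideal_sc: "x \<in> K_ideal N \<Longrightarrow> sc c * x \<in> K_ideal N"
  by (rule K_ideal_left[OF _ alg_sc'])

lemma K_ideal_uminus: "x \<in> K_ideal N \<Longrightarrow> - x \<in> K_ideal N"
  using K_ideal_sc[of x N "- 1"] by (simp add: sc_uminus)

text \<open>This licenses the computations below: once fewer strands are settled, contractors cannot
  affect membership in \<open>B\<close>.\<close>

lemma T_K_ideal:
  assumes "\<And>M. M < N \<Longrightarrow> good M" and "T 2 (K 0) \<in> B"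
  shows "x \<in> K_ideal N \<Longrightarrow> T N x \<in> B"
proof (induction rule: K_ideal.induct)
  case K_ideal_0
  show ?case using T_sc[of N 0 0] B_scal[of 0] by simp
next
  case (K_ideal_K a b i)
  have "T N (b * a * K i) \<in> B"
    using K_ideal_K by (intro good_K assms alg_mult)
  moreover have "a * K i \<in> W N"
    using K_ideal_K by (intro alg_mult alg_K) auto
  ultimately show ?case
    using B_cyclic[of "a * K i" N b] K_ideal_K by (simp add: mult.assoc)
next
  case (K_ideal_add x y)
  then show ?case by (simp add: T_add B_add)
qed

definition eqv :: "nat \<Rightarrow> ('n, 'n falg) chain \<Rightarrow> ('n, 'n falg) chain \<Rightarrow> bool" where
  "eqv N x y \<longleftrightarrow> x - y \<in> K_ideal N"

lemma eqv_refl [simp]: "eqv N x x"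
  by (simp add: eqv_def K_ideal_0)

lemma eqv_sym: "eqv N x y \<Longrightarrow> eqv N y x"
  using K_ideal_uminus[of "x - y" N] by (simp add: eqv_def)

lemma eqv_trans [trans]: "eqv N x y \<Longrightarrow> eqv N y z \<Longrightarrow> eqv N x z"
  using K_ideal_add[of "x - y" N "y - z"] by (simp add: eqv_def)

lemma eqv_eq [trans]: "eqv N x y \<Longrightarrow> y = z \<Longrightarrow> eqv N x z" and eq_eqv [trans]: "x = y \<Longrightarrow> eqv N y z \<Longrightarrow> eqv N x z"
  by simp_all

lemma eqv_add: "eqv N x y \<Longrightarrow> eqv N x' y' \<Longrightarrow> eqv N (x + x') (y + y')"
  using K_ideal_add[of "x - y" N "x' - y'"] by (simp add: eqv_def algebra_simps)

lemma eqv_left: "eqv N x y \<Longrightarrow> a \<in> W N \<Longrightarrow> eqv N (a * x) (a * y)"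
  using K_ideal_left[of "x - y" N a] by (simp add: eqv_def right_diff_distrib)

lemma eqv_right: "eqv N x y \<Longrightarrow> a \<in> W N \<Longrightarrow> eqv N (x * a) (y * a)"
  using K_ideal_right[of "x - y" N a] by (simp add: eqv_def left_diff_distrib)

lemma eqv_sc: "eqv N x y \<Longrightarrow> eqv N (sc c * x) (sc c * y)"
  by (rule eqv_left[OF _ alg_sc'])

lemma eqv_T:
  assumes "\<And>M. M < N \<Longrightarrow> good M" and "T 2 (K 0) \<in> B" and "eqv N x y"
  shows "T N x \<in> B \<longleftrightarrow> T N y \<in> B"
proof -
  have "T N x - T N y \<in> B"
    using T_K_ideal[OF assms(1,2)] assms(3) by (simp add: eqv_def flip: T_diff)
  then show ?thesis
    using B_add[of "T N x - T N y" "T N y"] B_diff[of "T N x" "T N x - T N y"] by auto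
qed

section \<open>The antisymmetrizer of the Hecke algebra\<close>

definition al :: "nat \<Rightarrow> complex" where "al m = q ^ m / qnum q (m + 1)"
text \<open>In the recursion for the antisymmetrizers, \<open>al m\<close> is the prefactor of
  \<open>a\<^sup>(\<^sup>m\<^sup>+\<^sup>1\<^sup>)\<close>, and \<open>be m\<close> is this
  prefactor times the coefficient
  \<open>(q\<^sup>-\<^sup>2\<^sup>m - 1) / (q - q\<^sup>-\<^sup>1)\<close> of the braid generator
  (\<open>al_y\<close>).\<close>

definition be :: "nat \<Rightarrow> complex" where "be m = - qnum q m / qnum q (m + 1)"

lemma qnum_Suc: "qnum q (Suc m) = q ^ m + inverse q * qnum q m"
proof -
  have "(q * q ^ m - inverse q * inverse q ^ m) / (q - inverse q) =
      q ^ m + inverse q * ((q ^ m - inverse q ^ m) / (q - inverse q))"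
    using \<delta>_nz unfolding \<delta>_def by (simp add: divide_simps) (simp add: algebra_simps q_nz)
  then show ?thesis by (simp add: qnum_def)
qed

lemma qnum_1: "qnum q (Suc 0) = 1"
  using qnum_Suc[of 0] by (simp add: qnum_def)

text \<open>The normalisation: at the eigenvalue \<open>- inverse q\<close> of the new generator the
  recursion step has total weight 1.\<close>

lemma al_be: "qnum q (Suc m) \<noteq> 0 \<Longrightarrow> al m + be m * - inverse q = 1"
  by (simp add: al_def be_def qnum_Suc divide_simps q_nz)

lemma al_Suc: "qnum q (Suc m) \<noteq> 0 \<Longrightarrow> al (Suc m) = - q * (be (Suc m) * al m)"
  by (simp add: al_def be_def)

lemma al_0: "al 0 = 1"
  by (simp add: al_def qnum_1)

text \<open>For \<open>s i = \<sigma>\<^bsub>i+1\<^esub>\<close> this is \<open>a\<^bsup>(m+1)\<^esup>\<close> modulo the contractors.\<close>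

primrec h :: "(nat \<Rightarrow> ('n, 'n falg) chain) \<Rightarrow> nat \<Rightarrow> ('n, 'n falg) chain" where
  "h s 0 = 1"
| "h s (Suc m) = sc (al (Suc m)) * h s m + sc (be (Suc m)) * (h s m * s m * h s m)"

lemma h_alg: "(\<And>i. i < m \<Longrightarrow> s i \<in> alg A) \<Longrightarrow> h s m \<in> alg A"
  by (induction m) (auto intro!: alg_1 alg_add alg_sc alg_mult)

lemma h_commute: "(\<And>i. i < m \<Longrightarrow> x * s i = s i * x) \<Longrightarrow> x * h s m = h s m * x"
proof (induction m)
  case (Suc m)
  then have c: "x * h s m = h s m * x" "x * s m = s m * x" by auto
  have "x * (h s m * s m * h s m) = (x * h s m) * s m * h s m" by (simp only: mult.assoc)
  also have "\<dots> = h s m * (x * s m) * h s m" by (simp only: c(1) mult.assoc)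
  also have "\<dots> = h s m * s m * (x * h s m)" by (simp only: c(2) mult.assoc)
  also have "\<dots> = h s m * s m * h s m * x" by (simp only: c(1) mult.assoc)
  finally show ?case
    by (simp add: distrib_left distrib_right sc_left_commute[of x] c(1) mult.assoc)
qed simp

text \<open>The generators form an arbitrary sequence, so the results apply to adjacent positions in
  ascending and in descending order. Only the quadratic relation is taken modulo the
  contractors.\<close>

definition hecke :: "nat \<Rightarrow> nat \<Rightarrow> (nat \<Rightarrow> ('n, 'n falg) chain) \<Rightarrow> bool" where
  "hecke N m s \<longleftrightarrow> (\<forall>i<m. s i \<in> W N \<and> eqv N (s i * s i) (1 + sc \<delta> * s i)) \<and>
     (\<forall>i. Suc i < m \<longrightarrow> s i * s (Suc i) * s i = s (Suc i) * s i * s (Suc i)) \<and>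
     (\<forall>i j. i + 2 \<le> j \<longrightarrow> j < m \<longrightarrow> s i * s j = s j * s i) \<and>
     (\<forall>j\<in>{2..Suc m}. qnum q j \<noteq> 0)"

lemma hecke_less: "hecke N (Suc m) s \<Longrightarrow> hecke N m s"
  unfolding hecke_def by (meson Suc_lessD atLeastAtMost_iff less_SucI le_SucI)

lemma hecke_far: "hecke N m s \<Longrightarrow> i + 2 \<le> j \<Longrightarrow> j < m \<Longrightarrow> s i * s j = s j * s i"
  unfolding hecke_def by blast

lemma hecke_qnum: "hecke N m s \<Longrightarrow> i \<le> m \<Longrightarrow> qnum q (Suc i) \<noteq> 0"
  by (cases i) (auto simp: hecke_def qnum_1)

lemma h_W: "hecke N m s \<Longrightarrow> h s m \<in> W N"
  by (rule h_alg) (auto simp: hecke_def)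

text \<open>Modulo the contractors, \<open>z\<close> spans the one-dimensional representation
  sending every generator to \<open>- inverse q\<close>.\<close>

definition eigL :: "nat \<Rightarrow> nat \<Rightarrow> (nat \<Rightarrow> ('n, 'n falg) chain) \<Rightarrow> ('n, 'n falg) chain \<Rightarrow> bool" where
  "eigL N m s z \<longleftrightarrow> (\<forall>i<m. eqv N (s i * z) (sc (- inverse q) * z))"
definition eigR :: "nat \<Rightarrow> nat \<Rightarrow> (nat \<Rightarrow> ('n, 'n falg) chain) \<Rightarrow> ('n, 'n falg) chain \<Rightarrow> bool" where
  "eigR N m s z \<longleftrightarrow> (\<forall>i<m. eqv N (z * s i) (sc (- inverse q) * z))"

lemma absorbL: "hecke N m s \<Longrightarrow> eigL N m s z \<Longrightarrow> eqv N (h s m * z) z"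
proof (induction m)
  case (Suc m)
  have IH: "eqv N (h s m * z) z"
    using Suc by (auto simp: eigL_def dest: hecke_less)
  have W: "h s m \<in> W N" "s m \<in> W N"
    using h_W[OF hecke_less[OF Suc.prems(1)]] Suc.prems(1) by (simp_all add: hecke_def)
  have "eqv N (h s m * s m * (h s m * z)) (h s m * s m * z)"
    by (rule eqv_left[OF IH]) (intro alg_mult W)
  also have "h s m * s m * z = h s m * (s m * z)" by (rule mult.assoc)
  also have "eqv N \<dots> (h s m * (sc (- inverse q) * z))"
    by (rule eqv_left[OF _ W(1)]) (use Suc.prems in \<open>auto simp: eigL_def\<close>)
  also have "h s m * (sc (- inverse q) * z) = sc (- inverse q) * (h s m * z)"
    by (rule sc_left_commute)
  also have "eqv N \<dots> (sc (- inverse q) * z)"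
    by (rule eqv_sc[OF IH])
  finally have "eqv N (sc (al (Suc m)) * (h s m * z) + sc (be (Suc m)) * (h s m * s m * (h s m * z)))
      (sc (al (Suc m)) * z + sc (be (Suc m)) * (sc (- inverse q) * z))"
    by (intro eqv_add eqv_sc IH)
  also have "\<dots> = sc (al (Suc m) + be (Suc m) * - inverse q) * z"
    by (simp only: sc_add sc_sc[symmetric] distrib_right mult.assoc)
  also have "\<dots> = z"
    using al_be[OF hecke_qnum[OF Suc.prems(1), of "Suc m"]] by simp
  finally show ?case by (simp add: distrib_right mult.assoc)
qed simp

lemma absorbR: "hecke N m s \<Longrightarrow> eigR N m s z \<Longrightarrow> eqv N (z * h s m) z"
proof (induction m)
  case (Suc m)
  have IH: "eqv N (z * h s m) z"
    using Suc by (auto simp: eigR_def dest: hecke_less)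
  have W: "h s m \<in> W N" "s m \<in> W N"
    using h_W[OF hecke_less[OF Suc.prems(1)]] Suc.prems(1) by (simp_all add: hecke_def)
  have "eqv N ((z * h s m) * (s m * h s m)) (z * (s m * h s m))"
    by (rule eqv_right[OF IH]) (intro alg_mult W)
  also have "z * (s m * h s m) = (z * s m) * h s m" by (rule mult.assoc[symmetric])
  also have "eqv N \<dots> ((sc (- inverse q) * z) * h s m)"
    by (rule eqv_right[OF _ W(1)]) (use Suc.prems in \<open>auto simp: eigR_def\<close>)
  also have "(sc (- inverse q) * z) * h s m = sc (- inverse q) * (z * h s m)"
    by (rule mult.assoc)
  also have "eqv N \<dots> (sc (- inverse q) * z)"
    by (rule eqv_sc[OF IH])
  finally have "eqv N (sc (al (Suc m)) * (z * h s m) + sc (be (Suc m)) * (z * h s m * (s m * h s m)))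
      (sc (al (Suc m)) * z + sc (be (Suc m)) * (sc (- inverse q) * z))"
    by (intro eqv_add eqv_sc IH)
  also have "\<dots> = sc (al (Suc m) + be (Suc m) * - inverse q) * z"
    by (simp only: sc_add sc_sc[symmetric] distrib_right mult.assoc)
  also have "\<dots> = z"
    using al_be[OF hecke_qnum[OF Suc.prems(1), of "Suc m"]] by simp
  finally show ?case
    by (simp add: distrib_left sc_left_commute[of z] mult.assoc)
qed simp

text \<open>The scalar identity behind the induction step of \<open>eig_h\<close>; \<open>Y\<close> is the term that only involves
  the two last generators.\<close>

lemma eig_combine:
  assumes p': "p' = - q * (b' * p)"
    and 1: "eqv N hsh (sc p * sh + sc b * Y)"
    and 2: "eqv N shsh (sc p * (hm + sc \<delta> * sh) + sc b * (sc (- inverse q) * Y))"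
  shows "eqv N (sc p' * sh + sc b' * shsh) (sc (- inverse q) * (sc p' * hm + sc b' * hsh))"
proof -
  have "eqv N (sc p' * sh + sc b' * shsh)
      (sc p' * sh + sc b' * (sc p * (hm + sc \<delta> * sh) + sc b * (sc (- inverse q) * Y)))"
    by (intro eqv_add eqv_sc 2 eqv_refl)
  also have "\<dots> = sc (b' * p) * hm + sc (p' + b' * p * \<delta>) * sh + sc (b' * b * - inverse q) * Y"
    by (simp only: sc_add sc_sc[symmetric] distrib_right distrib_left mult.assoc add_ac)
  also have "\<dots> = sc (- inverse q * p') * hm + sc (- inverse q * (b' * p)) * sh + sc (- inverse q * (b' * b)) * Y"
  proof -
    have "b' * p = - inverse q * p'" "p' + b' * p * \<delta> = - inverse q * (b' * p)"
      using q_nz by (simp_all add: p' \<delta>_def algebra_simps)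
    then show ?thesis by (simp only: mult_ac)
  qed
  also have "\<dots> = sc (- inverse q) * (sc p' * hm + sc b' * (sc p * sh + sc b * Y))"
    by (simp only: sc_sc[symmetric] distrib_left mult.assoc add_ac)
  also have "eqv N \<dots> (sc (- inverse q) * (sc p' * hm + sc b' * hsh))"
    by (intro eqv_add eqv_sc eqv_refl eqv_sym[OF 1])
  finally show ?thesis .
qed

text \<open>For the old generators the induction hypothesis acts on the outer factor of each term.
  For the new generator one outer factor is expanded once more, after which the braid relation
  brings the previous generator next to an eigenvector.\<close>

lemma eig_h: "hecke N m s \<Longrightarrow> eigL N m s (h s m) \<and> eigR N m s (h s m)"
proof (induction m)
  case 0
  show ?case by (simp add: eigL_def eigR_def)
next
  case (Suc m)
  let ?h = "h s m" and ?s = "s m" and ?c = "sc (- inverse q)"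
  let ?p' = "al (Suc m)" and ?b' = "be (Suc m)"
  have H: "hecke N m s" using Suc.prems by (rule hecke_less)
  have L: "eigL N m s ?h" and R: "eigR N m s ?h" using Suc.IH[OF H] by auto
  have W: "?h \<in> W N" "?s \<in> W N"
    using h_W[OF H] Suc.prems by (simp_all add: hecke_def)
  have sq: "eqv N (?s * ?s) (1 + sc \<delta> * ?s)"
    using Suc.prems by (auto simp: hecke_def)
  have p': "?p' = - q * (?b' * al m)"
    by (rule al_Suc[OF hecke_qnum[OF Suc.prems]]) simp
  have lowL: "eqv N (s i * h s (Suc m)) (?c * h s (Suc m))" if "i < m" for i
  proof -
    have e: "eqv N (s i * ?h) (?c * ?h)" using L that by (simp add: eigL_def)
    have "s i * h s (Suc m) = sc ?p' * (s i * ?h) + sc ?b' * ((s i * ?h) * (?s * ?h))"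
      by (simp add: distrib_left sc_left_commute[of "s i"] mult.assoc)
    also have "eqv N \<dots> (sc ?p' * (?c * ?h) + sc ?b' * ((?c * ?h) * (?s * ?h)))"
      by (intro eqv_add eqv_sc e eqv_right[OF e] alg_mult W)
    also have "\<dots> = ?c * h s (Suc m)"
      by (simp add: distrib_left sc_left_commute[of ?c] mult.assoc)
    finally show ?thesis .
  qed
  have lowR: "eqv N (h s (Suc m) * s i) (?c * h s (Suc m))" if "i < m" for i
  proof -
    have e: "eqv N (?h * s i) (?c * ?h)" using R that by (simp add: eigR_def)
    have "h s (Suc m) * s i = sc ?p' * (?h * s i) + sc ?b' * ((?h * ?s) * (?h * s i))"
      by (simp add: distrib_right mult.assoc)
    also have "eqv N \<dots> (sc ?p' * (?c * ?h) + sc ?b' * ((?h * ?s) * (?c * ?h)))"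
      by (intro eqv_add eqv_sc e eqv_left[OF e] alg_mult W)
    also have "\<dots> = ?c * h s (Suc m)"
      by (simp add: distrib_left sc_left_commute[of ?c] sc_left_commute[of "?h"] sc_left_commute[of ?s] mult.assoc)
    finally show ?thesis .
  qed
  have "eqv N (?s * h s (Suc m)) (?c * h s (Suc m)) \<and> eqv N (h s (Suc m) * ?s) (?c * h s (Suc m))"
  proof (cases m)
    case 0
    \<comment> \<open>With a single generator there is no inner term: \<open>eig_combine\<close> is
      used with \<open>b = 0\<close> and \<open>Y = 0\<close>.\<close>
    have 1: "eqv N (?h * ?s * ?h) (sc (al m) * (?s * ?h) + sc 0 * 0)"
      "eqv N (?h * ?s * ?h) (sc (al m) * (?h * ?s) + sc 0 * 0)"
      by (simp_all add: 0 al_0)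
    have 2: "eqv N (?s * (?h * ?s * ?h)) (sc (al m) * (?h + sc \<delta> * (?s * ?h)) + sc 0 * (?c * 0))"
      "eqv N (?h * ?s * ?h * ?s) (sc (al m) * (?h + sc \<delta> * (?h * ?s)) + sc 0 * (?c * 0))"
      using sq by (simp_all add: 0 al_0)
    show ?thesis
      using eig_combine[OF p' 1(1) 2(1)] eig_combine[OF p' 1(2) 2(2)]
      by (simp add: distrib_left distrib_right sc_left_commute[of ?s] mult.assoc)
  next
    case (Suc k)
    let ?k = "h s k" and ?t = "s k"
    have Hk: "hecke N k s" using H Suc by (auto dest: hecke_less)
    have Wk: "?k \<in> W N" "?t \<in> W N"
      using h_W[OF Hk] H by (simp_all add: hecke_def Suc)
    have kh: "eqv N (?k * ?h) ?h" "eqv N (?h * ?k) ?h"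
      using L R by (auto intro!: absorbL[OF Hk] absorbR[OF Hk] simp: eigL_def eigR_def Suc)
    have th: "eqv N (?t * ?h) (?c * ?h)" "eqv N (?h * ?t) (?c * ?h)"
      using L R by (auto simp: eigL_def eigR_def Suc)
    have com: "?s * ?k = ?k * ?s"
    proof (rule h_commute)
      fix i assume "i < k"
      then have "s i * ?s = ?s * s i" using Suc by (intro hecke_far[OF Suc.prems]) auto
      then show "?s * s i = s i * ?s" ..
    qed
    have braid: "?t * ?s * ?t = ?s * ?t * ?s"
      using Suc.prems by (auto simp: hecke_def Suc)
    have hm: "?h = sc (al m) * ?k + sc (be m) * (?k * ?t * ?k)"
      by (simp add: Suc)
    let ?Y = "?k * ?t * ?s * ?h" and ?Z = "?h * ?s * ?t * ?k"
    \<comment> \<open>Expand the left \<open>?h\<close>; then \<open>?s\<close> passes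
      \<open>?k\<close>, and \<open>?k\<close> is absorbed by the other \<open>?h\<close>.\<close>
    have "?h * ?s * ?h = (sc (al m) * ?k + sc (be m) * (?k * ?t * ?k)) * (?s * ?h)"
      using hm by (simp add: mult.assoc)
    also have "\<dots> = sc (al m) * (?k * ?s * ?h) + sc (be m) * (?k * ?t * (?k * ?s) * ?h)"
      by (simp only: distrib_right mult.assoc)
    also have "\<dots> = sc (al m) * (?s * (?k * ?h)) + sc (be m) * ((?k * ?t * ?s) * (?k * ?h))"
      by (simp only: com[symmetric]) (simp only: mult.assoc)
    also have "eqv N \<dots> (sc (al m) * (?s * ?h) + sc (be m) * ?Y)"
      by (intro eqv_add eqv_sc eqv_left kh alg_mult W Wk)
    finally have 1: "eqv N (?h * ?s * ?h) (sc (al m) * (?s * ?h) + sc (be m) * ?Y)" .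
    \<comment> \<open>The mirror image, with the right \<open>?h\<close> expanded.\<close>
    have "?h * ?s * ?h = (?h * ?s) * (sc (al m) * ?k + sc (be m) * (?k * ?t * ?k))"
      using hm by simp
    also have "\<dots> = sc (al m) * (?h * (?s * ?k)) + sc (be m) * (?h * (?s * ?k) * ?t * ?k)"
      by (simp only: distrib_left sc_left_commute[of ?h] sc_left_commute[of ?s] mult.assoc)
    also have "\<dots> = sc (al m) * ((?h * ?k) * ?s) + sc (be m) * ((?h * ?k) * (?s * ?t * ?k))"
      by (simp only: com) (simp only: mult.assoc)
    also have "eqv N \<dots> (sc (al m) * (?h * ?s) + sc (be m) * (?h * (?s * ?t * ?k)))"
      by (intro eqv_add eqv_sc eqv_right kh alg_mult W Wk)
    finally have F1: "eqv N (?h * ?s * ?h) (sc (al m) * (?h * ?s) + sc (be m) * ?Z)"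
      by (simp only: mult.assoc)
    have "eqv N (?s * (?h * ?s * ?h)) (?s * (sc (al m) * (?s * ?h) + sc (be m) * ?Y))"
      by (rule eqv_left[OF 1 W(2)])
    also have "\<dots> = sc (al m) * (?s * ?s * ?h) + sc (be m) * ((?s * ?k) * ?t * ?s * ?h)"
      by (simp only: distrib_left sc_left_commute[of ?s] mult.assoc)
    \<comment> \<open>The braid relation puts \<open>?t\<close> next to \<open>?h\<close>, where it
      becomes a scalar.\<close>
    also have "\<dots> = sc (al m) * (?s * ?s * ?h) + sc (be m) * ((?k * (?t * ?s)) * (?t * ?h))"
    proof -
      have "(?s * ?k) * ?t * ?s * ?h = ?k * (?s * ?t * ?s) * ?h"
        by (simp only: com mult.assoc)
      also have "\<dots> = (?k * (?t * ?s)) * (?t * ?h)"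
        by (simp only: braid[symmetric]) (simp only: mult.assoc)
      finally show ?thesis by simp
    qed
    also have "eqv N \<dots> (sc (al m) * ((1 + sc \<delta> * ?s) * ?h) + sc (be m) * ((?k * (?t * ?s)) * (?c * ?h)))"
      by (intro eqv_add eqv_sc eqv_right[OF sq] eqv_left[OF th(1)] alg_mult W Wk)
    also have "\<dots> = sc (al m) * (?h + sc \<delta> * (?s * ?h)) + sc (be m) * (?c * ?Y)"
      by (simp only: distrib_right mult_1_left mult.assoc sc_left_commute[of "?k"] sc_left_commute[of ?t] sc_left_commute[of ?s])
    finally have 2: "eqv N (?s * (?h * ?s * ?h)) (sc (al m) * (?h + sc \<delta> * (?s * ?h)) + sc (be m) * (?c * ?Y))" .
    have "eqv N (?h * ?s * ?h * ?s) ((sc (al m) * (?h * ?s) + sc (be m) * ?Z) * ?s)"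
      by (rule eqv_right[OF F1 W(2)])
    also have "\<dots> = sc (al m) * (?h * (?s * ?s)) + sc (be m) * (?h * ?s * ?t * (?k * ?s))"
      by (simp only: distrib_right mult.assoc)
    also have "\<dots> = sc (al m) * (?h * (?s * ?s)) + sc (be m) * ((?h * ?t) * (?s * ?t * ?k))"
    proof -
      have "?h * ?s * ?t * (?k * ?s) = ?h * (?s * ?t * ?s) * ?k"
        by (simp only: com[symmetric] mult.assoc)
      also have "\<dots> = (?h * ?t) * (?s * ?t * ?k)"
        by (simp only: braid[symmetric]) (simp only: mult.assoc)
      finally show ?thesis by simp
    qed
    also have "eqv N \<dots> (sc (al m) * (?h * (1 + sc \<delta> * ?s)) + sc (be m) * ((?c * ?h) * (?s * ?t * ?k)))"
      by (intro eqv_add eqv_sc eqv_left[OF sq] eqv_right[OF th(2)] alg_mult W Wk)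
    also have "\<dots> = sc (al m) * (?h + sc \<delta> * (?h * ?s)) + sc (be m) * (?c * ?Z)"
      by (simp only: distrib_left mult_1_right mult.assoc sc_left_commute[of "?h"])
    finally have F2: "eqv N (?h * ?s * ?h * ?s) (sc (al m) * (?h + sc \<delta> * (?h * ?s)) + sc (be m) * (?c * ?Z))" .
    have "?s * h s (Suc m) = sc ?p' * (?s * ?h) + sc ?b' * (?s * (?h * ?s * ?h))"
      "h s (Suc m) * ?s = sc ?p' * (?h * ?s) + sc ?b' * (?h * ?s * ?h * ?s)"
      by (simp_all only: h.simps distrib_left distrib_right sc_left_commute[of ?s] mult.assoc)
    then show ?thesis
      using eig_combine[OF p' 1 2] eig_combine[OF p' F1 F2] by (simp only: h.simps)
  qed
  then show ?case
    using lowL lowR by (auto simp: eigL_def eigR_def less_Suc_eq simp del: h.simps)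
qed

lemma h_idem: "hecke N m s \<Longrightarrow> eqv N (h s m * h s m) (h s m)"
  using absorbL eig_h by blast

text \<open>The product \<open>h s m * h t m\<close> is congruent to its right factor, a left
  eigenvector of every \<open>s i\<close>, and to its left factor, a right eigenvector of every
  \<open>t i\<close>.\<close>

lemma h_unique:
  assumes s: "hecke N m s" and t: "hecke N m t" and st: "s ` {..<m} = t ` {..<m}"
  shows "eqv N (h s m) (h t m)"
proof -
  have "eigL N m s (h t m)"
    unfolding eigL_def
  proof (intro allI impI)
    fix i assume "i < m"
    then obtain j where "j < m" "s i = t j" using st by (metis imageE image_eqI lessThan_iff)
    then show "eqv N (s i * h t m) (sc (- inverse q) * h t m)"
      using eig_h[OF t] by (simp add: eigL_def)
  qed
  then have "eqv N (h s m * h t m) (h t m)" by (rule absorbL[OF s])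
  moreover have "eigR N m t (h s m)"
    unfolding eigR_def
  proof (intro allI impI)
    fix i assume "i < m"
    then obtain j where "j < m" "t i = s j" using st by (metis imageE image_eqI lessThan_iff)
    then show "eqv N (h s m * t i) (sc (- inverse q) * h s m)"
      using eig_h[OF s] by (simp add: eigR_def)
  qed
  then have "eqv N (h s m * h t m) (h s m)" by (rule absorbR[OF t])
  ultimately show ?thesis using eqv_sym eqv_trans by blast
qed

end

section \<open>Images of the antisymmetrizers under the representation\<close>

lemma shift_shift_alg: "shift_alg m (shift_alg n \<alpha>) = shift_alg (m + n) \<alpha>"
proof -
  have "shift_word m (shift_word n w) = shift_word (m + n) w" for w
    by (induction w) (auto simp: shift_word_def)
  then have "shift_braid m (shift_braid n b) = shift_braid (m + n) b" for b
    by (induction b) (simp add: shift_braid.abs_eq)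
  then show ?thesis
    by (simp add: shift_alg_def[of n] shift_alg_def[of "m + n"] shift_alg_sum shift_alg_single)
qed

lemma shift_alg_kappa: "i \<ge> 1 \<Longrightarrow> shift_alg m (kappa q \<mu> i) = kappa q \<mu> (i + m)"
  by (simp add: kappa_def shift_alg_mult shift_alg_scal shift_alg_diff shift_alg_add shift_alg_sigma)

lemma shift_alg_sigma_minus: "i \<ge> 1 \<Longrightarrow> shift_alg m (sigma_minus q \<mu> i x) = sigma_minus q \<mu> (i + m) x"
  by (simp add: sigma_minus_def shift_alg_mult shift_alg_scal shift_alg_add shift_alg_1 shift_alg_sigma
      shift_alg_kappa)

context bmw_setup
begin

lemma rhoE_kappa: "rhoE (kappa q \<mu> i) = K (i - 1)"
proof -
  have "1 / (\<mu> * (q - inverse q)) = c0"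
    by (simp add: c0_def \<delta>_def field_simps)
  then show ?thesis
    by (simp add: kappa_def rhoE_mult rhoE_scal rhoE_diff rhoE_add rhoE_sigma K_factor)
qed

lemma rhoE_sigma_minus: "rhoE (sigma_minus q \<mu> i x) =
    1 + sc ((x - 1) / \<delta>) * r (i - 1) + sc ((x - 1) / (q * inverse \<mu> * x + 1)) * K (i - 1)"
  by (simp add: sigma_minus_def rhoE_add rhoE_mult rhoE_scal rhoE_1 rhoE_sigma rhoE_kappa \<delta>_def)

end

context bmw_sub
begin

lemma eqv_r_square:
  assumes "Suc i < N"
  shows "eqv N (r i * r i) (1 + sc \<delta> * r i)"
proof -
  have "1 * K i * 1 \<in> K_ideal N"
    using assms by (intro K_ideal_K alg_1)
  then have "- (sc (inverse c0) * K i) \<in> K_ideal N"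
    by (intro K_ideal_uminus K_ideal_sc) simp
  then show ?thesis
    by (simp add: eqv_def r_square)
qed

lemma hecke_up:
  assumes "a + m < N" and "\<forall>j\<in>{2..Suc m}. qnum q j \<noteq> 0"
  shows "hecke N m (\<lambda>i. r (a + i))"
  unfolding hecke_def using assms
  by (auto intro!: alg_r eqv_r_square braid_r op2_far_commute)

lemma hecke_down:
  assumes "m \<le> n" and "n < N" and "\<forall>j\<in>{2..Suc m}. qnum q j \<noteq> 0"
  shows "hecke N m (\<lambda>i. r (n - Suc i))"
  unfolding hecke_def
proof (intro conjI allI impI)
  fix i assume "Suc i < m"
  then have "n - Suc i = Suc (n - Suc (Suc i))" using assms by simp
  then show "r (n - Suc i) * r (n - Suc (Suc i)) * r (n - Suc i) =
      r (n - Suc (Suc i)) * r (n - Suc i) * r (n - Suc (Suc i))"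
    by (simp only: braid_r)
next
  fix i j assume "i + 2 \<le> j" "j < m"
  then show "r (n - Suc i) * r (n - Suc j) = r (n - Suc j) * r (n - Suc i)"
    using assms by (intro op2_far_commute[symmetric]) auto
qed (use assms in \<open>auto intro!: alg_r eqv_r_square\<close>)

lemma powi_minus_double: "(x::complex) powi (- 2 * int k) = inverse (x ^ k * x ^ k)"
proof -
  have "- 2 * int k = - int (k + k)" by simp
  then show ?thesis by (simp only: power_int_minus power_int_of_nat power_add)
qed

lemma al_y: "al (Suc m) * ((q powi (- 2 * int (Suc m)) - 1) / \<delta>) = be (Suc m)"
proof -
  define u where "u = q ^ Suc m"
  have "u \<noteq> 0" by (simp add: u_def q_nz)
  then have "u * (inverse (u * u) - 1) = - (u - inverse u)"
    by (simp add: right_diff_distrib inverse_mult_distrib)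
  then have "u * ((inverse (u * u) - 1) / \<delta>) = - ((u - inverse u) / \<delta>)"
    by (simp only: times_divide_eq_right minus_divide_left)
  then have "u * ((q powi (- 2 * int (Suc m)) - 1) / \<delta>) = - qnum q (Suc m)"
    by (simp only: powi_minus_double u_def qnum_def \<delta>_def power_inverse)
  then show ?thesis
    by (simp only: al_def be_def u_def[symmetric] times_divide_eq_left)
qed

lemma eqv_K: "Suc i < N \<Longrightarrow> eqv N (x + sc c * K i) x"
  using K_ideal_sc[OF K_ideal_K[OF alg_1 alg_1, of i N], of c] by (simp add: eqv_def)

text \<open>The recursion for the antisymmetrizers and the height condition share this shape; the
  \<open>K i\<close> term falls into the ideal.\<close>

lemma eqv_sandwich:
  assumes A: "eqv N A H" "A \<in> W N" "H \<in> W N" and idem: "eqv N (H * H) H" and i: "Suc i < N"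
  shows "eqv N (A * (1 + sc y * r i + sc z * K i) * A) (H + sc y * (H * r i * H))"
proof -
  have W: "1 + sc y * r i + sc z * K i \<in> W N" "1 + sc y * r i \<in> W N"
    using i by (auto intro!: alg_intros)
  have "eqv N (A * (1 + sc y * r i + sc z * K i) * A) (H * (1 + sc y * r i + sc z * K i) * A)"
    by (intro eqv_right A W)
  also have "eqv N \<dots> (H * (1 + sc y * r i + sc z * K i) * H)"
    by (intro eqv_left A alg_mult W)
  also have "eqv N \<dots> (H * (1 + sc y * r i) * H)"
    by (intro eqv_right eqv_left eqv_K A i)
  also have "\<dots> = H * H + sc y * (H * r i * H)"
    by (simp add: distrib_left distrib_right sc_left_commute[of H] mult.assoc)
  also have "eqv N \<dots> (H + sc y * (H * r i * H))"
    by (intro eqv_add idem eqv_refl)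
  finally show ?thesis .
qed

lemma rhoE_antisym:
  assumes "t + m < N" and "\<forall>j\<in>{2..Suc m}. qnum q j \<noteq> 0"
  shows "rhoE (shift_alg t (antisym_el q \<mu> (Suc m))) \<in> W N \<and>
    eqv N (rhoE (shift_alg t (antisym_el q \<mu> (Suc m)))) (h (\<lambda>i. r (t + i)) m)"
  using assms
proof (induction m)
  case 0
  show ?case by (simp add: shift_alg_1 rhoE_1 alg_1)
next
  case (Suc m)
  let ?A = "rhoE (shift_alg t (antisym_el q \<mu> (Suc m)))" and ?s = "\<lambda>i. r (t + i)"
  let ?x = "q powi (- 2 * int (Suc m))"
  let ?y = "(?x - 1) / \<delta>" and ?z = "(?x - 1) / (q * inverse \<mu> * ?x + 1)"
  have H: "hecke N m ?s" using Suc.prems by (intro hecke_up) auto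
  have A: "?A \<in> W N" "eqv N ?A (h ?s m)" using Suc by auto
  have eq: "rhoE (shift_alg t (antisym_el q \<mu> (Suc (Suc m)))) =
      sc (al (Suc m)) * (?A * (1 + sc ?y * r (t + m) + sc ?z * K (t + m)) * ?A)"
    by (subst antisym_el.simps(2))
      (simp add: shift_alg_mult shift_alg_scal shift_alg_sigma_minus rhoE_mult rhoE_scal rhoE_sigma_minus
        al_def mult.assoc add.commute[of m t] del: antisym_el.simps)
  have "eqv N (rhoE (shift_alg t (antisym_el q \<mu> (Suc (Suc m)))))
      (sc (al (Suc m)) * (h ?s m + sc ?y * (h ?s m * r (t + m) * h ?s m)))"
    unfolding eq using Suc.prems
    by (intro eqv_sc eqv_sandwich A h_W[OF H] h_idem[OF H]) simp
  also have "\<dots> = h ?s (Suc m)"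
    by (simp add: distrib_left sc_sc al_y[symmetric] flip: mult.assoc)
  finally have "eqv N (rhoE (shift_alg t (antisym_el q \<mu> (Suc (Suc m))))) (h ?s (Suc m))" .
  moreover have "rhoE (shift_alg t (antisym_el q \<mu> (Suc (Suc m)))) \<in> W N"
    unfolding eq using Suc.prems by (intro alg_intros A) auto
  ultimately show ?case by blast
qed

text \<open>Peeling off the generators of the mirrored antisymmetrizer one by one, the other terms being
  decomposable.\<close>

lemma telescope:
  assumes less: "\<And>M. M \<le> n \<Longrightarrow> good M" and g: "T 2 (K 0) \<in> B"
  shows "m \<le> n \<Longrightarrow> \<forall>j\<in>{2..Suc m}. qnum q j \<noteq> 0 \<Longrightarrow>
    T (Suc n) (h (\<lambda>i. r (n - Suc i)) m * desc 0 (n - m)) \<in> B \<Longrightarrow> T (Suc n) (desc 0 n) \<in> B"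
proof (induction m)
  case (Suc m)
  let ?s = "\<lambda>i. r (n - Suc i)"
  let ?h = "h ?s m" and ?w = "desc 0 (n - Suc m)" and ?N = "Suc n"
  have H: "hecke ?N m ?s" using Suc.prems by (intro hecke_down) auto
  have less': "\<And>M. M < ?N \<Longrightarrow> good M" using less by simp
  have up: "?h \<in> alg {i. n - m \<le> i \<and> Suc i < (n - m) + Suc m}"
    using Suc.prems by (intro h_alg alg_r) auto
  have low: "?w \<in> alg {..<n - Suc m}"
    by (intro alg_desc) auto
  have com: "?h * ?w = ?w * ?h"
    by (rule alg_commute[OF low up]) auto
  have W: "?h \<in> W ?N" "?w \<in> W ?N" "?s m \<in> W ?N"
    using h_W[OF H] Suc.prems by (auto intro!: alg_desc alg_r)
  \<comment> \<open>The first term of the recursion decomposes: \<open>?w\<close> lives on the first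
    \<open>n - m\<close> strands and \<open>?h\<close> on the remaining
    \<open>m + 1\<close>.\<close>
  have "T ((n - m) + Suc m) (?w * ?h) \<in> B"
  proof (rule good_split[OF _ _ _ up])
    show "?w \<in> W (n - m)"
      by (rule alg_mono[OF low]) auto
  qed (use Suc.prems in \<open>auto intro: less\<close>)
  then have first: "T ?N (?h * ?w) \<in> B"
    using Suc.prems by (simp add: com)
  have "T ?N (h ?s (Suc m) * ?w) = scal (al (Suc m)) * T ?N (?h * ?w) + scal (be (Suc m)) * T ?N (?h * ?s m * (?h * ?w))"
    by (simp add: distrib_right mult.assoc T_add T_sc)
  then have "scal (be (Suc m)) * T ?N (?h * ?s m * (?h * ?w)) \<in> B"
    using Suc.prems B_diff[of "T ?N (h ?s (Suc m) * ?w)" "scal (al (Suc m)) * T ?N (?h * ?w)"] B_smult[OF first]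
    by simp
  moreover have "be (Suc m) \<noteq> 0"
  proof -
    have "qnum q (Suc m) \<noteq> 0"
      using hecke_qnum[OF H, of m] by simp
    moreover have "qnum q (Suc m + 1) \<noteq> 0"
      using Suc.prems by simp
    ultimately show ?thesis by (simp add: be_def)
  qed
  ultimately have "T ?N (?h * ?s m * (?h * ?w)) \<in> B"
    by (rule B_cancel[rotated])
  \<comment> \<open>Cyclicity brings the two copies of \<open>?h\<close> together, idempotency
    leaves one, and \<open>?s m\<close> lengthens the string \<open>?w\<close>.\<close>
  then have "T ?N ((?h * ?s m * ?w) * ?h) \<in> B"
    by (simp only: com mult.assoc)
  then have "T ?N (?h * (?h * ?s m * ?w)) \<in> B"
    using B_cyclic[of "?h * ?s m * ?w" ?N ?h] W by (simp add: alg_mult)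
  moreover have "eqv ?N (?h * ?h * (?s m * ?w)) (?h * (?s m * ?w))"
    by (rule eqv_right[OF h_idem[OF H]]) (intro alg_mult W)
  ultimately have "T ?N (?h * (?s m * ?w)) \<in> B"
    using eqv_T[OF less' g] by (simp add: mult.assoc)
  moreover have "?s m * ?w = desc 0 (n - m)"
    using Suc.prems desc_Suc_top[of 0 "n - Suc m"] by (simp add: Suc_diff_Suc)
  ultimately show ?case
    using Suc by simp
qed simp

section \<open>Induction on the number of strands\<close>

lemma good_antisym:
  assumes less: "\<And>M. M \<le> n \<Longrightarrow> good M" and g: "T 2 (K 0) \<in> B"
    and qn: "\<forall>j\<in>{2..Suc n}. qnum q j \<noteq> 0"
    and a: "T (Suc n) (rhoE (antisym_el q \<mu> (Suc n))) \<in> B"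
  shows "good (Suc n)"
proof (rule good_Suc[OF less g])
  let ?N = "Suc n" and ?s = "\<lambda>i. r (n - Suc i)" and ?t = "\<lambda>i. r (0 + i)"
  have less': "\<And>M. M < ?N \<Longrightarrow> good M" using less by simp
  have sh: "shift_alg 0 \<alpha> = \<alpha>" for \<alpha>
    by (simp add: shift_alg_def shift_braid_0 poly_mapping_sum_single[symmetric])
  have "eqv ?N (rhoE (antisym_el q \<mu> (Suc n))) (h ?t n)"
    using rhoE_antisym[of 0 n ?N] qn unfolding sh by simp
  \<comment> \<open>Telescoping needs the generators adjoined from the top down; both orders give
    the same idempotent.\<close>
  also have "eqv ?N (h ?t n) (h ?s n)"
  proof (rule h_unique)
    have "?t i \<in> ?s ` {..<n}" if "i < n" for i
      using that by (intro image_eqI[of _ _ "n - Suc i"]) auto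
    moreover have "?s i \<in> ?t ` {..<n}" if "i < n" for i
      using that by (intro image_eqI[of _ _ "n - Suc i"]) auto
    ultimately show "?t ` {..<n} = ?s ` {..<n}" by auto
    show "hecke ?N n ?t" using qn by (intro hecke_up) auto
    show "hecke ?N n ?s" using qn by (intro hecke_down) auto
  qed
  finally have "T ?N (h ?s n) \<in> B"
    using eqv_T[OF less' g] a by blast
  then show "T ?N (desc 0 n) \<in> B"
    using telescope[OF less g, of n n] qn by (simp add: desc_def)
qed

text \<open>The relation shifted by \<open>n - k\<close> occupies the last \<open>k + 1\<close> of
  the \<open>n + 1\<close> strands. Multiplied by the string on the strands before, it leaves just
  one term that does not decompose, and this term is an intermediate stage of
  \<open>telescope\<close>, from which the power sum follows.\<close>

lemma good_height:
  assumes less: "\<And>M. M \<le> n \<Longrightarrow> good M" and g: "T 2 (K 0) \<in> B"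
    and k: "2 \<le> k" "k \<le> n" and qn: "\<forall>j\<in>{2..k}. qnum q j \<noteq> 0"
    and height: "\<And>t. rhoE (shift_alg t (shift_alg 1 (antisym_el q \<mu> k) *
      sigma_minus q \<mu> 1 (q powi (- 2 * int k)) * shift_alg 1 (antisym_el q \<mu> k))) = 0"
  shows "good (Suc n)"
proof (rule good_Suc[OF less g])
  obtain l where l: "k = Suc l" using k by (cases k) auto
  define t where "t = n - k"
  have n: "n = Suc (t + l)" using k by (simp add: t_def l)
  let ?N = "Suc n" and ?s = "\<lambda>i. r (n - Suc i)" and ?u = "\<lambda>i. r (Suc t + i)"
  let ?A = "rhoE (shift_alg (Suc t) (antisym_el q \<mu> k))" and ?H = "h ?u l" and ?w = "desc 0 t"
  let ?x = "q powi (- 2 * int k)"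
  let ?y = "(?x - 1) / \<delta>" and ?z = "(?x - 1) / (q * inverse \<mu> * ?x + 1)"
  have less': "\<And>M. M < ?N \<Longrightarrow> good M" using less by simp
  have qn': "\<forall>j\<in>{2..Suc l}. qnum q j \<noteq> 0" using qn l by simp
  have H: "hecke ?N l ?u" using qn' by (intro hecke_up) (auto simp: n)
  have HW: "?H \<in> W ?N" by (rule h_W[OF H])
  have A: "?A \<in> W ?N" "eqv ?N ?A ?H"
    using rhoE_antisym[of "Suc t" l ?N] qn' by (simp_all add: n l)
  \<comment> \<open>The shifted height condition: \<open>?A\<close> acts on the last
    \<open>k\<close> strands, and \<open>r t\<close> is the generator just below them.\<close>
  have "?A * (1 + sc ?y * r t + sc ?z * K t) * ?A = 0"
    using height[of t]
    by (simp add: shift_alg_mult shift_shift_alg shift_alg_sigma_minus rhoE_mult rhoE_sigma_minus)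
  then have "eqv ?N 0 (?H + sc ?y * (?H * r t * ?H))"
    using eqv_sandwich[OF A(2,1) HW h_idem[OF H], of t ?y ?z] by (simp add: n)
  moreover have wW: "?w \<in> W ?N"
    by (intro alg_desc) (auto simp: n)
  ultimately have "eqv ?N (0 * ?w) ((?H + sc ?y * (?H * r t * ?H)) * ?w)"
    by (rule eqv_right)
  moreover have "T ?N (0 * ?w) \<in> B"
    using T_sc[of ?N 0 0] B_scal[of 0] by simp
  ultimately have "T ?N ((?H + sc ?y * (?H * r t * ?H)) * ?w) \<in> B"
    using eqv_T[OF less' g] by blast
  then have sum: "T ?N (?H * ?w) + scal ?y * T ?N (?H * r t * (?H * ?w)) \<in> B"
    by (simp add: distrib_right mult.assoc T_add T_sc)
  have up: "?H \<in> alg {i. Suc t \<le> i \<and> Suc i < Suc t + k}"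
    by (intro h_alg alg_r) (auto simp: l)
  have low: "?w \<in> alg {..<t}"
    by (intro alg_desc) auto
  have com: "?H * ?w = ?w * ?H"
    by (rule alg_commute[OF low up]) auto
  have "T (Suc t + k) (?w * ?H) \<in> B"
  proof (rule good_split[OF _ _ _ up])
    show "?w \<in> W (Suc t)" using low by (simp only: W_Suc)
  qed (auto intro!: less simp: n l)
  moreover have "Suc t + k = ?N" by (simp add: n l)
  ultimately have first: "T ?N (?H * ?w) \<in> B"
    by (simp only: com)
  \<comment> \<open>If it vanished, \<open>q\<close> to the power \<open>2 * k\<close> would be 1,
    contradicting the assumption on the quantum number of \<open>k\<close>.\<close>
  have "?y \<noteq> 0"
  proof
    assume "?y = 0"
    then have "q powi (- 2 * int k) = 1" using \<delta>_nz by simp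
    then have "inverse (q ^ k) * inverse (q ^ k) = 1"
      by (simp only: powi_minus_double inverse_mult_distrib)
    then have "q ^ k = inverse q ^ k"
      by (metis inverse_unique inverse_inverse_eq power_inverse)
    then have "qnum q k = 0" by (simp add: qnum_def)
    then show False using qn k by simp
  qed
  moreover have "scal ?y * T ?N (?H * r t * (?H * ?w)) \<in> B"
    using B_diff[OF sum first] by (simp only: add_diff_cancel_left')
  ultimately have "T ?N (?H * r t * (?H * ?w)) \<in> B"
    by (rule B_cancel)
  then have "T ?N ((?H * r t * ?w) * ?H) \<in> B"
    by (simp only: com mult.assoc)
  moreover have rW: "r t \<in> W ?N" by (rule alg_r) (simp add: n)
  ultimately have "T ?N (?H * (?H * r t * ?w)) \<in> B"
    using B_cyclic[of "?H * r t * ?w" ?N ?H] HW wW by (simp add: alg_mult)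
  moreover have D: "r t * ?w = desc 0 (Suc t)"
    by (simp add: desc_Suc_top)
  ultimately have "T ?N ((?H * ?H) * desc 0 (Suc t)) \<in> B"
    by (simp add: mult.assoc)
  moreover have DW: "desc 0 (Suc t) \<in> W ?N"
    by (intro alg_desc) (auto simp: n)
  ultimately have "T ?N (?H * desc 0 (Suc t)) \<in> B"
    using eqv_T[OF less' g eqv_right[OF h_idem[OF H] DW]] by blast
  moreover have "eqv ?N ?H (h ?s l)"
  proof (rule h_unique[OF H])
    show "hecke ?N l ?s" using qn' by (intro hecke_down) (auto simp: n)
    have "r (Suc t + i) \<in> ?s ` {..<l}" if "i < l" for i
      using that by (intro image_eqI[of _ _ "l - Suc i"]) (auto simp: n)
    moreover have "r (n - Suc i) \<in> ?u ` {..<l}" if "i < l" for i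
    proof -
      have "n - Suc i = Suc t + (l - Suc i)" using that by (simp add: n)
      then show ?thesis using that by (intro image_eqI[of _ _ "l - Suc i"]) auto
    qed
    ultimately show "?u ` {..<l} = ?s ` {..<l}" by auto
  qed
  ultimately have "T ?N (h ?s l * desc 0 (Suc t)) \<in> B"
    using eqv_T[OF less' g eqv_right[OF _ DW]] by blast
  moreover have "n - l = Suc t" "l \<le> n" by (simp_all add: n)
  ultimately show "T ?N (desc 0 n) \<in> B"
    using telescope[OF less g _ qn'] by metis
qed

theorem good_all_antisym:
  assumes g: "T 2 (K 0) \<in> B"
    and qn: "\<And>j. 2 \<le> j \<Longrightarrow> qnum q j \<noteq> 0"
    and a: "\<And>i. 1 \<le> i \<Longrightarrow> T i (rhoE (antisym_el q \<mu> i)) \<in> B"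
  shows "good N"
proof (induction N rule: less_induct)
  case (less N)
  show ?case
  proof (cases N)
    case 0
    then show ?thesis by (simp add: good_0)
  next
    case (Suc n)
    then show ?thesis using less qn unfolding Suc by (intro good_antisym g a) auto
  qed
qed

theorem good_all_height:
  assumes g: "T 2 (K 0) \<in> B"
    and k: "2 \<le> k" and qn: "\<forall>j\<in>{2..k}. qnum q j \<noteq> 0"
    and a: "\<And>i. 1 \<le> i \<Longrightarrow> i \<le> k \<Longrightarrow> T i (rhoE (antisym_el q \<mu> i)) \<in> B"
    and height: "\<And>t. rhoE (shift_alg t (shift_alg 1 (antisym_el q \<mu> k) *
      sigma_minus q \<mu> 1 (q powi (- 2 * int k)) * shift_alg 1 (antisym_el q \<mu> k))) = 0"
  shows "good N"
proof (induction N rule: less_induct)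
  case (less N)
  show ?case
  proof (cases N)
    case 0
    then show ?thesis by (simp add: good_0)
  next
    case (Suc n)
    then have l: "\<And>M. M \<le> n \<Longrightarrow> good M" using less by simp
    show ?thesis
    proof (cases "N \<le> k")
      case True
      then show ?thesis unfolding Suc using Suc qn by (intro good_antisym l g a) auto
    next
      case False
      then show ?thesis unfolding Suc using Suc by (intro good_height[OF l g k _ qn height]) auto
    qed
  qed
qed

end

section \<open>The quotient algebra and its subalgebras\<close>

lemma carrier_qma: "carrier (qma R F) = range (qma_proj R F)"
  by (auto simp: qma_def Let_def FactRing_def A_RCOSETS_def' qma_proj_def class_ring_def)

lemma qma_proj_add: "qma_proj R F x \<oplus>\<^bsub>qma R F\<^esub> qma_proj R F y = qma_proj R F (x + y)"
proof -
  interpret I: ideal "qma_ideal R F" class_ring by (rule ideal_qma_ideal)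
  show ?thesis
    using I.a_rcos_sum[of x y] by (simp add: qma_def Let_def FactRing_def qma_proj_def class_ring_def)
qed

lemma qma_proj_mult: "qma_proj R F x \<otimes>\<^bsub>qma R F\<^esub> qma_proj R F y = qma_proj R F (x * y)"
proof -
  interpret I: ideal "qma_ideal R F" class_ring by (rule ideal_qma_ideal)
  show ?thesis
    using I.rcoset_mult_add[of x y] by (simp add: qma_def Let_def FactRing_def qma_proj_def class_ring_def)
qed

lemma qma_proj_smult: "c \<odot>\<^bsub>qma R F\<^esub> qma_proj R F x = qma_proj R F (scal c * x)"
  using qma_proj_mult[of R F "scal c" x] by (simp add: qma_def Let_def)

lemma qma_proj_1: "\<one>\<^bsub>qma R F\<^esub> = qma_proj R F 1"
  by (simp add: qma_def Let_def FactRing_def qma_proj_def class_ring_def)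

lemma qma_proj_ideal:
  assumes "x \<in> qma_ideal R F"
  shows "qma_proj R F x = \<zero>\<^bsub>qma R F\<^esub>"
proof -
  interpret I: ideal "qma_ideal R F" class_ring by (rule ideal_qma_ideal)
  show ?thesis
    using I.a_rcos_const[OF assms] by (simp add: qma_def Let_def FactRing_def qma_proj_def)
qed

lemma qma_smult_mult:
  assumes "X \<in> carrier (qma R F)" "Y \<in> carrier (qma R F)"
  shows "(c \<odot>\<^bsub>qma R F\<^esub> X) \<otimes>\<^bsub>qma R F\<^esub> Y = c \<odot>\<^bsub>qma R F\<^esub> (X \<otimes>\<^bsub>qma R F\<^esub> Y)"
    and "X \<otimes>\<^bsub>qma R F\<^esub> (c \<odot>\<^bsub>qma R F\<^esub> Y) = c \<odot>\<^bsub>qma R F\<^esub> (X \<otimes>\<^bsub>qma R F\<^esub> Y)"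
proof -
  obtain x y where xy: "X = qma_proj R F x" "Y = qma_proj R F y"
    using assms by (auto simp: carrier_qma)
  have "x * (scal c * y) = scal c * (x * y)"
    by (simp add: scal_central[of c] mult.assoc)
  then show "(c \<odot>\<^bsub>qma R F\<^esub> X) \<otimes>\<^bsub>qma R F\<^esub> Y = c \<odot>\<^bsub>qma R F\<^esub> (X \<otimes>\<^bsub>qma R F\<^esub> Y)"
    "X \<otimes>\<^bsub>qma R F\<^esub> (c \<odot>\<^bsub>qma R F\<^esub> Y) = c \<odot>\<^bsub>qma R F\<^esub> (X \<otimes>\<^bsub>qma R F\<^esub> Y)"
    by (simp_all add: xy qma_proj_smult qma_proj_mult mult.assoc)
qed

lemma lin_span_least: "submodule H class_ring A \<Longrightarrow> S \<subseteq> H \<Longrightarrow> lin_span A S \<subseteq> H"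
  by (auto simp: lin_span_def)

lemma lin_span_superset: "S \<subseteq> lin_span A S"
  by (auto simp: lin_span_def)

lemma submodule_zero: "submodule H A M \<Longrightarrow> \<zero>\<^bsub>M\<^esub> \<in> H"
  using submodule.axioms(1) subgroup.one_closed by fastforce

lemma lin_span_submodule:
  assumes "S \<subseteq> carrier (qma R F)"
  shows "submodule (lin_span (qma R F) S) class_ring (qma R F)"
proof -
  interpret M: module class_ring "qma R F" by (rule module_qma)
  show ?thesis
  proof (rule M.submoduleI)
    show "lin_span (qma R F) S \<subseteq> carrier (qma R F)"
      by (rule lin_span_least[OF M.carrier_is_submodule assms])
    show "\<zero>\<^bsub>qma R F\<^esub> \<in> lin_span (qma R F) S"
      unfolding lin_span_def by (auto intro: submodule_zero)
  qed (auto simp: lin_span_def dest: M.submoduleE)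
qed

text \<open>For a fixed factor, the elements whose product with it lies in the span form a
  submodule. This is used once with the left factor in \<open>S\<close> and once with the right
  factor in the span.\<close>

lemma lin_span_mult_closed:
  assumes S: "S \<subseteq> carrier (qma R F)" and mult: "\<And>s t. s \<in> S \<Longrightarrow> t \<in> S \<Longrightarrow> s \<otimes>\<^bsub>qma R F\<^esub> t \<in> S"
    and X: "X \<in> lin_span (qma R F) S" and Y: "Y \<in> lin_span (qma R F) S"
  shows "X \<otimes>\<^bsub>qma R F\<^esub> Y \<in> lin_span (qma R F) S"
proof -
  interpret M: module class_ring "qma R F" by (rule module_qma)
  interpret Q: ring "qma R F" by (rule ring_qma)
  let ?L = "lin_span (qma R F) S"
  note sub = lin_span_submodule[OF S]
  note L = M.submoduleE[OF sub]
  note zero = submodule_zero[OF sub]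
  have car: "?L \<subseteq> carrier (qma R F)" using L(1) .
  have left: "submodule {Y \<in> carrier (qma R F). Z \<otimes>\<^bsub>qma R F\<^esub> Y \<in> ?L} class_ring (qma R F)"
    if "Z \<in> carrier (qma R F)" for Z
    using that zero L by (intro M.submoduleI) (auto simp: Q.r_distr Q.r_minus qma_smult_mult)
  have right: "submodule {X \<in> carrier (qma R F). X \<otimes>\<^bsub>qma R F\<^esub> Z \<in> ?L} class_ring (qma R F)"
    if "Z \<in> carrier (qma R F)" for Z
    using that zero L by (intro M.submoduleI) (auto simp: Q.l_distr Q.l_minus qma_smult_mult)
  have step: "?L \<subseteq> {Y \<in> carrier (qma R F). s \<otimes>\<^bsub>qma R F\<^esub> Y \<in> ?L}" if "s \<in> S" for s
  proof (rule lin_span_least[OF left])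
    show "s \<in> carrier (qma R F)" using that S by (rule rev_subsetD)
    show "S \<subseteq> {Y \<in> carrier (qma R F). s \<otimes>\<^bsub>qma R F\<^esub> Y \<in> ?L}"
      using mult[OF that] by (auto intro: subsetD[OF S] subsetD[OF lin_span_superset])
  qed
  have "?L \<subseteq> {X \<in> carrier (qma R F). X \<otimes>\<^bsub>qma R F\<^esub> Y \<in> ?L}"
  proof (rule lin_span_least[OF right])
    show "Y \<in> carrier (qma R F)" using Y car by (rule rev_subsetD)
    show "S \<subseteq> {X \<in> carrier (qma R F). X \<otimes>\<^bsub>qma R F\<^esub> Y \<in> ?L}"
      using subsetD[OF step Y] by (auto intro: subsetD[OF S])
  qed
  then show ?thesis using X by (auto dest: subsetD)
qed

lemma braid_algebra_sum: "(\<And>a. a \<in> A \<Longrightarrow> x a \<in> braid_algebra n) \<Longrightarrow> sum x A \<in> braid_algebra n"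
  using braid_algebra_scal[of 0 n]
  by (induction A rule: infinite_finite_induct) (simp_all add: braid_algebra_add)

lemma braid_algebra_shift:
  assumes "\<alpha> \<in> braid_algebra n"
  shows "shift_alg m \<alpha> \<in> braid_algebra (m + n)"
proof -
  have "shift_braid m b \<in> braid_group (m + n)" if b: "b \<in> braid_group n" for b
  proof -
    obtain w where w: "w \<in> braid_words n" "b = abs_braid w"
      using b unfolding braid_group_def by blast
    then have "shift_word m w \<in> braid_words (m + n)"
      by (force simp: shift_word_def braid_words_def)
    then show ?thesis by (auto simp: w shift_braid.abs_eq braid_group_def)
  qed
  then show ?thesis
    using assms unfolding shift_alg_def
    by (intro braid_algebra_sum braid_algebra_single) (auto simp: braid_algebra_def)
qed

lemma braid_algebra_mono: "m \<le> n \<Longrightarrow> \<alpha> \<in> braid_algebra m \<Longrightarrow> \<alpha> \<in> braid_algebra n"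
  by (fastforce simp: braid_algebra_def braid_group_def braid_words_def)

section \<open>The characteristic subalgebra as a generated subalgebra\<close>

context bmw_setup
begin

lemma rhoE_alg:
  assumes "\<alpha> \<in> braid_algebra N"
  shows "rhoE \<alpha> \<in> alg {i. Suc i < N}"
proof -
  have "rb b \<in> alg {i. Suc i < N}" if b: "b \<in> Poly_Mapping.keys \<alpha>" for b
  proof -
    have "b \<in> braid_group N" using b assms by (auto simp: braid_algebra_def)
    then obtain w where "w \<in> braid_words N" "b = abs_braid w"
      unfolding braid_group_def by blast
    then show ?thesis
      by (auto simp: rb_abs intro!: alg_word dest: braid_wordsD)
  qed
  moreover have "(\<Sum>a\<in>X. x a) \<in> alg A" if "\<And>a. a \<in> X \<Longrightarrow> x a \<in> alg A" for x A and X :: "braid set"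
    using that alg_sc'[of 0 A] by (induction X rule: infinite_finite_induct) (simp_all add: alg_add)
  ultimately show ?thesis
    unfolding rhoE_def by (simp add: alg_sc)
qed

lemma ch_mult:
  assumes a: "\<alpha> \<in> braid_algebra m" and b: "\<beta> \<in> braid_algebra n"
  shows "ch R F m \<alpha> \<otimes>\<^bsub>qma R F\<^esub> ch R F n \<beta> = ch R F (m + n) (\<alpha> * shift_alg m \<beta>)"
proof -
  have "T (m + n) (rhoE \<alpha> * (sc c * rb (shift_braid m b))) = T m (rhoE \<alpha>) * T n (sc c * rb b)"
    if c: "b \<in> Poly_Mapping.keys \<beta>" for b c
  proof -
    have "b \<in> braid_group n" using b c by (auto simp: braid_algebra_def)
    then obtain v where v: "v \<in> braid_words n" "b = abs_braid v"
      unfolding braid_group_def by blast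
    show ?thesis
      using T_alg_word_mult[OF rhoE_alg[OF a] v(1)]
      by (simp add: v(2) shift_braid.abs_eq rb_abs sc_left_commute[of "rhoE \<alpha>"] T_sc scal_left_commute)
  qed
  then have "T (m + n) (rhoE (\<alpha> * shift_alg m \<beta>)) = T m (rhoE \<alpha>) * T n (rhoE \<beta>)"
    by (simp add: rhoE_mult rhoE_shift_alg sum_distrib_left T_sum rhoE_def[of \<beta>])
  moreover have "\<alpha> * shift_alg m \<beta> \<in> braid_algebra (m + n)"
    using a by (intro braid_algebra_mult braid_algebra_shift b) (auto elim: braid_algebra_mono[rotated])
  ultimately show ?thesis
    by (simp add: ch_rhoE a b qma_proj_mult)
qed

lemma ch_carrier: "ch R F n \<alpha> \<in> carrier (qma R F)"
  by (simp add: ch_def carrier_qma)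

lemma char_submodule: "submodule (char_subalgebra R F) class_ring (qma R F)"
  unfolding char_subalgebra_def
  by (rule lin_span_submodule) (auto simp: ch_carrier ring.ring_simprules(6)[OF ring_qma])

lemma ch_char: "1 \<le> n \<Longrightarrow> \<alpha> \<in> braid_algebra n \<Longrightarrow> ch R F n \<alpha> \<in> char_subalgebra R F"
  unfolding char_subalgebra_def by (rule subsetD[OF lin_span_superset]) auto

lemma one_char: "\<one>\<^bsub>qma R F\<^esub> \<in> char_subalgebra R F"
  unfolding char_subalgebra_def by (rule subsetD[OF lin_span_superset]) auto

lemma char_subring: "subring (char_subalgebra R F) (qma R F)"
proof -
  interpret M: module class_ring "qma R F" by (rule module_qma)
  interpret Q: ring "qma R F" by (rule ring_qma)
  note E = M.submoduleE[OF char_submodule]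
  show ?thesis
  proof (rule Q.subringI)
    fix X Y assume "X \<in> char_subalgebra R F" "Y \<in> char_subalgebra R F"
    then show "X \<otimes>\<^bsub>qma R F\<^esub> Y \<in> char_subalgebra R F"
      unfolding char_subalgebra_def
    proof (rule lin_span_mult_closed[rotated -2])
      let ?S = "{\<one>\<^bsub>qma R F\<^esub>} \<union> {ch R F n \<alpha> |n \<alpha>. 1 \<le> n \<and> \<alpha> \<in> braid_algebra n}"
      show "?S \<subseteq> carrier (qma R F)" by (auto simp: ch_carrier)
      fix s t assume st: "s \<in> ?S" "t \<in> ?S"
      show "s \<otimes>\<^bsub>qma R F\<^esub> t \<in> ?S"
      proof (cases "s = \<one>\<^bsub>qma R F\<^esub> \<or> t = \<one>\<^bsub>qma R F\<^esub>")
        case True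
        then show ?thesis using st by (auto simp: ch_carrier)
      next
        case False
        then obtain m \<alpha> n \<beta> where ab: "1 \<le> m" "\<alpha> \<in> braid_algebra m" "s = ch R F m \<alpha>"
            "1 \<le> n" "\<beta> \<in> braid_algebra n" "t = ch R F n \<beta>"
          using st by auto
        have "\<alpha> * shift_alg m \<beta> \<in> braid_algebra (m + n)"
          using ab by (intro braid_algebra_mult braid_algebra_shift) (auto elim: braid_algebra_mono[rotated])
        then show ?thesis
          unfolding ab ch_mult[OF ab(2,5)] using ab(1) by (intro UnI2 CollectI) (metis trans_le_add1)
      qed
    qed
  qed (use E one_char in auto)
qed

lemma subalgebra_bmw_sub:
  assumes sm: "submodule H class_ring (qma R F)" and sr: "subring H (qma R F)"
  shows "bmw_sub R F q \<mu> {x. qma_proj R F x \<in> H}"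
proof unfold_locales
  interpret M: module class_ring "qma R F" by (rule module_qma)
  note m = M.submoduleE[OF sm] and s = subringE[OF sr]
  show "qma_ideal R F \<subseteq> {x. qma_proj R F x \<in> H}"
    using s by (auto simp: qma_proj_ideal)
  fix x y and c :: complex
  show "x \<in> {x. qma_proj R F x \<in> H} \<Longrightarrow> y \<in> {x. qma_proj R F x \<in> H} \<Longrightarrow> x + y \<in> {x. qma_proj R F x \<in> H}"
    "x \<in> {x. qma_proj R F x \<in> H} \<Longrightarrow> y \<in> {x. qma_proj R F x \<in> H} \<Longrightarrow> x * y \<in> {x. qma_proj R F x \<in> H}"
    using s by (simp_all flip: qma_proj_add qma_proj_mult)
  have "c \<odot>\<^bsub>qma R F\<^esub> qma_proj R F 1 \<in> H"
    using m(4)[of c] s(3) by (simp add: class_ring_def qma_proj_1)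
  then show "scal c \<in> {x. qma_proj R F x \<in> H}"
    by (simp add: qma_proj_smult)
qed

text \<open>The generated subalgebra is an intersection, so it suffices to find every character in
  each subalgebra \<open>H\<close> that contains \<open>G\<close>; this is what \<open>good\<close>
  says for the preimage of \<open>H\<close>.\<close>

lemma char_eq_generated:
  assumes G: "G \<subseteq> char_subalgebra R F"
    and good: "\<And>H. submodule H class_ring (qma R F) \<Longrightarrow> subring H (qma R F) \<Longrightarrow> G \<subseteq> H \<Longrightarrow>
      (\<And>N. bmw_sub.good R F {x. qma_proj R F x \<in> H} N)"
  shows "char_subalgebra R F = generated_subalgebra (qma R F) G"
proof
  show "generated_subalgebra (qma R F) G \<subseteq> char_subalgebra R F"
    unfolding generated_subalgebra_def using char_submodule char_subring G by auto
  show "char_subalgebra R F \<subseteq> generated_subalgebra (qma R F) G"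
    unfolding generated_subalgebra_def
  proof (intro Inter_greatest, elim CollectE conjE)
    fix H assume H: "submodule H class_ring (qma R F)" "subring H (qma R F)" "G \<subseteq> H"
    interpret bmw_sub R F q \<mu> "{x. qma_proj R F x \<in> H}"
      by (rule subalgebra_bmw_sub[OF H(1,2)])
    have "ch R F n \<alpha> \<in> H" if "\<alpha> \<in> braid_algebra n" for n \<alpha>
      using good[OF H, of n] rhoE_alg[OF that] by (simp add: good_def ch_rhoE[OF that])
    then show "char_subalgebra R F \<subseteq> H"
      unfolding char_subalgebra_def using subringE(3)[OF H(2)]
      by (intro lin_span_least[OF H(1)]) auto
  qed
qed

lemma kappa_braid_algebra: "kappa q \<mu> 1 \<in> braid_algebra 2"
  by (rule braid_algebra_kappa) auto

lemma g_el_char: "g_el q \<mu> R F \<in> char_subalgebra R F"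
proof -
  interpret M: module class_ring "qma R F" by (rule module_qma)
  show ?thesis
    unfolding g_el_def using M.submoduleE(4)[OF char_submodule] ch_char[OF _ kappa_braid_algebra]
    by (simp add: class_ring_def)
qed

lemma a_el_char: "a_el q \<mu> R F i \<in> char_subalgebra R F"
  by (simp add: a_el_def one_char ch_char braid_algebra_antisym_el)

lemma g_el_K:
  assumes "submodule H class_ring (qma R F)" and "g_el q \<mu> R F \<in> H"
  shows "qma_proj R F (T 2 (K 0)) \<in> H"
proof -
  interpret M: module class_ring "qma R F" by (rule module_qma)
  have "eta q \<mu> \<odot>\<^bsub>qma R F\<^esub> g_el q \<mu> R F \<in> H"
    using M.submoduleE(4)[OF assms(1) _ assms(2)] by (simp add: class_ring_def)
  then show ?thesis
    by (simp add: g_el_def ch_rhoE[OF kappa_braid_algebra] rhoE_kappa qma_proj_smult scal_mult[symmetric]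
        eta_nz flip: mult.assoc del: One_nat_def)
qed

lemma a_el_T: "1 \<le> i \<Longrightarrow> a_el q \<mu> R F i = qma_proj R F (T i (rhoE (antisym_el q \<mu> i)))"
  by (simp add: a_el_def ch_rhoE braid_algebra_antisym_el)

theorem char_generated_antisym:
  assumes qn: "\<And>j. 2 \<le> j \<Longrightarrow> qnum q j \<noteq> 0"
  shows "char_subalgebra R F =
    generated_subalgebra (qma R F) ({g_el q \<mu> R F} \<union> {a_el q \<mu> R F i | i. True})"
proof (rule char_eq_generated)
  fix H N assume H: "submodule H class_ring (qma R F)" "subring H (qma R F)"
    "{g_el q \<mu> R F} \<union> {a_el q \<mu> R F i | i. True} \<subseteq> H"
  interpret bmw_sub R F q \<mu> "{x. qma_proj R F x \<in> H}"
    by (rule subalgebra_bmw_sub[OF H(1,2)])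
  have "qma_proj R F (T i (rhoE (antisym_el q \<mu> i))) \<in> H" if "1 \<le> i" for i
    using H(3) a_el_T[OF that] by auto
  moreover have "qma_proj R F (T 2 (K 0)) \<in> H"
    using g_el_K[OF H(1)] H(3) by auto
  ultimately show "good N"
    using qn by (intro good_all_antisym) auto
qed (auto simp: g_el_char a_el_char)

text \<open>The height condition shared by both types handles more than \<open>k\<close> strands;
  \<open>embo_rho_shift\<close> spreads it to all positions.\<close>

theorem char_generated_height:
  assumes "finite_height q \<mu> k R"
  shows "char_subalgebra R F =
    generated_subalgebra (qma R F) ({g_el q \<mu> R F} \<union> {a_el q \<mu> R F i | i. i \<le> k})"
proof (rule char_eq_generated)
  let ?\<alpha> = "shift_alg 1 (antisym_el q \<mu> k) * sigma_minus q \<mu> 1 (q powi (- 2 * int k)) * shift_alg 1 (antisym_el q \<mu> k)"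
  have k: "2 \<le> k" "\<forall>j\<in>{2..k}. qnum q j \<noteq> 0" and zero: "rho R (k + 1) ?\<alpha> = op_zero"
    using assms by (auto simp: finite_height_def)
  have \<alpha>: "?\<alpha> \<in> braid_algebra (k + 1)"
    using k braid_algebra_shift[OF braid_algebra_antisym_el[of k k q \<mu>], of 1]
    by (intro braid_algebra_mult braid_algebra_sigma_minus) simp_all
  have height: "rhoE (shift_alg t ?\<alpha>) = 0" for t
  proof -
    have "op_scal op_zero = (op_zero :: ('n, 'n falg) oper)"
      by (simp add: fun_eq_iff op_scal_def op_zero_def)
    then show ?thesis
      using embo_rho_shift[OF \<alpha>, of t] unfolding zero by (simp only: embo_zero)
  qed
  fix H N assume H: "submodule H class_ring (qma R F)" "subring H (qma R F)"
    "{g_el q \<mu> R F} \<union> {a_el q \<mu> R F i | i. i \<le> k} \<subseteq> H"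
  interpret bmw_sub R F q \<mu> "{x. qma_proj R F x \<in> H}"
    by (rule subalgebra_bmw_sub[OF H(1,2)])
  have "qma_proj R F (T i (rhoE (antisym_el q \<mu> i))) \<in> H" if "1 \<le> i" "i \<le> k" for i
    using H(3) a_el_T[OF that(1)] that(2) by auto
  moreover have "qma_proj R F (T 2 (K 0)) \<in> H"
    using g_el_K[OF H(1)] H(3) by auto
  ultimately show "good N"
    using k height by (intro good_all_height[of k]) auto
qed (auto simp: g_el_char a_el_char)

end

subsection \<open>The symmetry \<open>q \<mapsto> - q\<^sup>-\<^sup>1\<close>\<close>

lemma kappa_neg_inverse:
  assumes "q \<noteq> 0"
  shows "kappa (- inverse q) \<mu> i = kappa q \<mu> i"
proof -
  have "(scal (- inverse q) - sigma i) * (scal (inverse (- inverse q)) + sigma i) =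
      (scal q - sigma i) * (scal (inverse q) + sigma i)"
    by (simp add: scal_uminus algebra_simps scal_central[of q] scal_mult[symmetric] assms
        scal_central[of "inverse q"])
  moreover have "- inverse q - inverse (- inverse q) = q - inverse q"
    by simp
  ultimately show ?thesis
    by (simp only: kappa_def mult.assoc)
qed

lemma qnum_neg_inverse:
  assumes "q \<noteq> 0"
  shows "qnum (- inverse q) j = - ((- 1) ^ j * qnum q j)"
proof -
  have "(- inverse q) ^ j - inverse (- inverse q) ^ j = - ((- 1) ^ j * (q ^ j - inverse q ^ j))"
    by (simp add: power_minus[of "inverse q"] power_minus[of q] algebra_simps)
  then show ?thesis
    by (simp add: qnum_def)
qed

lemma sigma_minus_neg_inverse:
  assumes "q \<noteq> 0"
  shows "sigma_minus (- inverse q) \<mu> i x = sigma_plus q \<mu> i x"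
  by (simp add: sigma_minus_def sigma_plus_def kappa_neg_inverse[OF assms])

lemma antisym_el_neg_inverse:
  assumes "q \<noteq> 0"
  shows "antisym_el (- inverse q) \<mu> i = sym_el q \<mu> i"
proof (induction i)
  case (Suc i)
  \<comment> \<open>The sign of the power cancels against that of the quantum number.\<close>
  have "(- inverse q) ^ i / qnum (- inverse q) (i + 1) = q powi (- int i) / qnum q (i + 1)"
    by (simp add: qnum_neg_inverse[OF assms] power_minus[of "inverse q"] power_int_minus power_inverse)
  moreover have "(- inverse q) powi (- 2 * int i) = q ^ (2 * i)"
  proof -
    have "- 2 * int i = - int (2 * i)" by simp
    then show ?thesis
      by (simp only: power_int_minus power_int_of_nat) (simp add: power_mult power_inverse)
  qed
  ultimately show ?case
    by (simp only: antisym_el.simps sym_el.simps Suc sigma_minus_neg_inverse[OF assms])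
qed simp

lemma bmw_type_neg_inverse:
  fixes R :: "'n::finite mat2"
  assumes "bmw_type q \<mu> R"
  shows "bmw_type (- inverse q) \<mu> R"
proof -
  have q: "q \<noteq> 0" using assms by (simp add: bmw_type_def)
  \<comment> \<open>The substitution exchanges the first two linear factors.\<close>
  have p: "[:- (- inverse q), 1:] * [:inverse (- inverse q), 1:] * [:- \<mu>, 1:] =
      [:- q, 1:] * [:inverse q, 1:] * [:- \<mu>, 1:]"
    by (simp add: mult.commute[of "[:inverse q, 1:]"])
  \<comment> \<open>The product depends only on \<open>a * b\<close> and \<open>a - b\<close>, which
    are the same for the pairs \<open>(q, inverse q)\<close> and
    \<open>(- inverse q, - q)\<close>.\<close>
  have "(mat a - R) ** (mat b + R) = (\<chi> i j. a * mat b $ i $ j + (a - b) * R $ i $ j - (R ** R) $ i $ j)" for a b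
  proof -
    have m: "mat c ** A = (\<chi> i j. c * A $ i $ j)" "A ** mat c = (\<chi> i j. c * A $ i $ j)"
      "(A - C) ** A' = A ** A' - C ** A'" for c and A A' C :: "'n mat2"
      by (simp_all add: vec_eq_iff mat_def matrix_matrix_mult_def if_distrib[of "\<lambda>x. x * _"]
          if_distrib[of "(*) _"] mult.commute left_diff_distrib right_diff_distrib sum_subtractf cong: if_cong)
    show ?thesis
      unfolding matrix_add_ldistrib m by (simp add: vec_eq_iff mat_def algebra_simps)
  qed
  then have "(mat (- inverse q) - R) ** (mat (inverse (- inverse q)) + R) = (mat q - R) ** (mat (inverse q) + R)"
    using q by (simp add: vec_eq_iff mat_def)
  then have K: "Kmat (- inverse q) \<mu> R = Kmat q \<mu> R"
    by (simp add: Kmat_def flip: matrix_mul_assoc)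
  have "q \<noteq> 1" "q \<noteq> - 1" "\<mu> \<noteq> 0" "\<mu> \<noteq> q" "\<mu> \<noteq> - inverse q"
    using assms by (auto simp: bmw_type_def)
  moreover from this have "inverse q \<noteq> 1" "inverse q \<noteq> inverse (- 1)"
    by (auto simp only: inverse_eq_iff_eq inverse_eq_1_iff)
  ultimately have "- inverse q \<notin> {0, 1, - 1}" "\<mu> \<notin> {0, - inverse q, - inverse (- inverse q)}"
    using q by (auto simp: minus_equation_iff[of "inverse q"])
  then show ?thesis
    using assms unfolding bmw_type_def p K by simp
qed

theorem proposition4p8:
  fixes R F :: "'n::finite mat2" and q \<mu> :: complex
  assumes "qma_pair R F" and "bmw_type q \<mu> R"
  shows
    "((\<forall>j\<ge>2. qnum q j \<noteq> 0 \<and> \<mu> \<noteq> - (q powi (- 2 * int j + 3))) \<longrightarrow>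
       char_subalgebra R F =
         generated_subalgebra (qma R F) ({g_el q \<mu> R F} \<union> {a_el q \<mu> R F i | i. True}))
     \<and>
     ((\<forall>j\<ge>2. qnum q j \<noteq> 0 \<and> \<mu> \<noteq> q powi (2 * int j - 3)) \<longrightarrow>
       char_subalgebra R F =
         generated_subalgebra (qma R F) ({g_el q \<mu> R F} \<union> {s_el q \<mu> R F i | i. True}))
     \<and>
     (\<forall>k\<ge>2. type_Sp q \<mu> k R \<or> type_O q \<mu> k R \<longrightarrow>
       char_subalgebra R F =
         generated_subalgebra (qma R F) ({g_el q \<mu> R F} \<union> {a_el q \<mu> R F i | i. i \<le> k}))"
proof -
  interpret bmw_setup R F q \<mu>
    by unfold_locales (rule assms)+
  interpret sym: bmw_setup R F "- inverse q" \<mu>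
    by unfold_locales (rule bmw_type_neg_inverse[OF assms(2)])
  have "(- inverse q - \<mu>) * (inverse (- inverse q) + \<mu>) = (q - \<mu>) * (inverse q + \<mu>)"
    by (simp add: algebra_simps)
  then have "eta (- inverse q) \<mu> = eta q \<mu>"
    by (simp add: eta_def)
  then have "g_el (- inverse q) \<mu> R F = g_el q \<mu> R F"
    unfolding g_el_def by (simp only: kappa_neg_inverse[OF q_nz])
  moreover have "a_el (- inverse q) \<mu> R F i = s_el q \<mu> R F i" for i
    by (simp add: a_el_def s_el_def antisym_el_neg_inverse[OF q_nz])
  ultimately show ?thesis
    using char_generated_antisym sym.char_generated_antisym char_generated_height
    by (auto simp: type_Sp_def type_O_def qnum_neg_inverse[OF q_nz])
qed

end
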